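(* Let $\mathcal{H}$ be a hereditary graph property. The following are equivalent. (1) There are constants $C,C'>0$ such that $Tw(\epsilon^{-C})\leq M_{\mathcal{H}}(\epsilon)\leq Tw(\epsilon^{-C'})$ for all sufficiently small $\epsilon>0$. (2) For all $k\geq 1$, $U(k)\in \text{Bip}(\mathcal{H})$. (3) $\mathcal{H}$ has infinite VC-dimension.
   Context: Graphs are $G=(V,E)$ with $E\subseteq\binom V2$; a hereditary graph property is a class of finite graphs closed under isomorphism and induced subgraphs. For nonempty $X,Y\subseteq V$, $d_G(X,Y)=|\{(x,y)\in X\times Y:xy\in E\}|/(|X||Y|)$; $(X,Y)$ is $\epsilon$-regular if $|d_G(X,Y)-d_G(X',Y')|\le\epsilon$ for all $X'\subseteq X,Y'\subseteq Y$ with $|X'|\ge\epsilon|X|,|Y'|\ge\epsilon|Y|$; a partition $\mathcal P$ of $V$ is $\epsilon$-regular if at least $(1-\epsilon)|V|^2$ pairs $(x,y)\in V^2$ lie in $X\times Y$ for some $\epsilon$-regular $(X,Y)\in\mathcal P^2$. $M_{\mathcal H}(\epsilon)$ is the least integer $M$ such that all sufficiently large graphs in $\mathcal H$ have $\epsilon$-regular partitions with at most $M$ parts. $Tw(1)=1$, $Tw(i)=2^{Tw(i-1)}$. For a graph $G=(V,E)$, $\text{Bip}(G)$ is the bipartite graph with vertex set $\{u_v:v\in V\}\cup\{w_v:v\in V\}$ and edges $u_vw_{v'}$ for $vv'\in E$; $\text{Bip}(\mathcal H)$ is the closure of $\{\text{Bip}(G):G\in\mathcal H\}$ under isomorphism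 and induced subgraphs. $U(k)$ is the bipartite graph with vertices $a_1,\dots,a_k$ and $b_S$ ($S\subseteq[k]$) and edges $a_ib_S$ for $i\in S$. The VC-dimension of a graph $G$ is the largest $k$ for which there are vertices $a_i$ ($i\in[k]$), $b_S$ ($S\subseteq[k]$) of $G$ with $a_ib_S\in E$ iff $i\in S$; the VC-dimension of $\mathcal H$ is the supremum over $G\in\mathcal H$. *)

theory Defs
  imports Complex_Main "HOL-Library.Disjoint_Sets" "HOL-Library.Extended_Nat"
begin

text \<open>Finite simple graphs with vertices drawn from nat (every finite graph is
isomorphic to one of these). A graph is a pair (V, E) with E a set of 2-subsets of V.\<close>

type_synonym ngraph = "nat set \<times> nat set set"

definition verts :: "ngraph \<Rightarrow> nat set" where "verts G = fst G"
definition edges :: "ngraph \<Rightarrow> nat set set" where "edges G = snd G"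

definition wf_graph :: "ngraph \<Rightarrow> bool" where
  "wf_graph G \<longleftrightarrow> finite (verts G) \<and>
     (\<forall>e\<in>edges G. \<exists>x y. x \<noteq> y \<and> x \<in> verts G \<and> y \<in> verts G \<and> e = {x, y})"

definition graph_iso :: "ngraph \<Rightarrow> ngraph \<Rightarrow> bool" where
  "graph_iso G H \<longleftrightarrow> (\<exists>f. bij_betw f (verts G) (verts H) \<and>
     (\<forall>x\<in>verts G. \<forall>y\<in>verts G. {x, y} \<in> edges G \<longleftrightarrow> {f x, f y} \<in> edges H))"

definition induced :: "ngraph \<Rightarrow> nat set \<Rightarrow> ngraph" where
  "induced G S = (S, {e \<in> edges G. e \<subseteq> S})"

definition hereditary :: "ngraph set \<Rightarrow> bool" where
  "hereditary \<H> \<longleftrightarrow> (\<forall>G\<in>\<H>. wf_graph G) \<and>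
     (\<forall>G\<in>\<H>. \<forall>G'. wf_graph G' \<longrightarrow> graph_iso G' G \<longrightarrow> G' \<in> \<H>) \<and>
     (\<forall>G\<in>\<H>. \<forall>S. S \<subseteq> verts G \<longrightarrow> induced G S \<in> \<H>)"

definition density :: "ngraph \<Rightarrow> nat set \<Rightarrow> nat set \<Rightarrow> real" where
  "density G X Y = real (card {(x, y) \<in> X \<times> Y. {x, y} \<in> edges G}) / (real (card X) * real (card Y))"

definition regular_pair :: "ngraph \<Rightarrow> real \<Rightarrow> nat set \<Rightarrow> nat set \<Rightarrow> bool" where
  "regular_pair G \<epsilon> X Y \<longleftrightarrow> X \<noteq> {} \<and> Y \<noteq> {} \<and>
     (\<forall>X' Y'. X' \<subseteq> X \<longrightarrow> Y' \<subseteq> Y \<longrightarrow> real (card X') \<ge> \<epsilon> * real (card X) \<longrightarrow>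
        real (card Y') \<ge> \<epsilon> * real (card Y) \<longrightarrow>
        \<bar>density G X Y - density G X' Y'\<bar> \<le> \<epsilon>)"

definition regular_partition :: "ngraph \<Rightarrow> real \<Rightarrow> nat set set \<Rightarrow> bool" where
  "regular_partition G \<epsilon> P \<longleftrightarrow> partition_on (verts G) P \<and>
     real (card {(x, y) \<in> verts G \<times> verts G. \<exists>X\<in>P. \<exists>Y\<in>P. x \<in> X \<and> y \<in> Y \<and> regular_pair G \<epsilon> X Y})
       \<ge> (1 - \<epsilon>) * real (card (verts G))^2"

definition M_reg :: "ngraph set \<Rightarrow> real \<Rightarrow> nat" where
  "M_reg \<H> \<epsilon> = (LEAST M. \<exists>N. \<forall>G\<in>\<H>. card (verts G) \<ge> N \<longrightarrow>
       (\<exists>P. regular_partition G \<epsilon> P \<and> card P \<le> M))"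

text \<open>Tower function: Tw 1 = 1, Tw (i) = 2^Tw(i-1) (Tw 0 = 0 is a harmless convention).\<close>
fun Tw :: "nat \<Rightarrow> nat" where
  "Tw 0 = 0"
| "Tw (Suc n) = 2 ^ Tw n"

definition Tw_real :: "real \<Rightarrow> nat" where
  "Tw_real x = Tw (nat \<lceil>x\<rceil>)"

text \<open>Bip(G): u_v encoded as 2v, w_v as 2v+1.\<close>
definition Bip :: "ngraph \<Rightarrow> ngraph" where
  "Bip G = ((\<lambda>v. 2 * v) ` verts G \<union> (\<lambda>v. 2 * v + 1) ` verts G,
            {{2 * v, 2 * v' + 1} | v v'. {v, v'} \<in> edges G})"

definition Bip_class :: "ngraph set \<Rightarrow> ngraph set" where
  "Bip_class \<H> = {G'. wf_graph G' \<and>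
     (\<exists>G\<in>\<H>. \<exists>S. S \<subseteq> verts (Bip G) \<and> graph_iso G' (induced (Bip G) S))}"

definition U_a :: "nat \<Rightarrow> nat" where "U_a i = 2 * i"
definition U_b :: "nat set \<Rightarrow> nat" where "U_b S = 2 * (\<Sum>i\<in>S. 2 ^ i) + 1"

definition U :: "nat \<Rightarrow> ngraph" where
  "U k = (U_a ` {1..k} \<union> U_b ` Pow {1..k},
          {{U_a i, U_b S} | i S. S \<subseteq> {1..k} \<and> i \<in> S})"

definition has_vc :: "ngraph \<Rightarrow> nat \<Rightarrow> bool" where
  "has_vc G k \<longleftrightarrow> (\<exists>a b. (\<forall>i\<in>{1..k}. a i \<in> verts G) \<and> (\<forall>S\<in>Pow {1..k}. b S \<in> verts G) \<and>
     (\<forall>i\<in>{1..k}. \<forall>S\<in>Pow {1..k}. {a i, b S} \<in> edges G \<longleftrightarrow> i \<in> S))"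

definition vc_dim :: "ngraph \<Rightarrow> nat" where
  "vc_dim G = (GREATEST k. has_vc G k)"

definition vc_dim_class :: "ngraph set \<Rightarrow> enat" where
  "vc_dim_class \<H> = (SUP G\<in>\<H>. enat (vc_dim G))"

end

theory Submission
  imports Defs "HOL-Library.Nat_Bijection" "HOL-Real_Asymp.Real_Asymp"
begin

text \<open>
  The upper bound in (1) is Szemeredi's energy increment argument. If the VC-dimension is bounded,
  a maximal set of vertices with pairwise very different neighbourhoods has size at most
  \<open>2 ^ poly (1 / \<epsilon>)\<close>, by random sampling and the Sauer--Shelah lemma; grouping every vertex with a
  nearest element of such a set yields parts of near-twins, almost all pairs of which have density close to
  0 or 1 and are therefore regular. Hence the lower bound in (1) fails.

  If the VC-dimension is unbounded, every bipartite graph occurs between two disjoint vertex sets of some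
  graph in \<open>\<H>\<close>, with arbitrary edges inside the two sets. The hard bipartite graph has both sides
  partitioned into cells at levels \<open>0, \<dots>, s\<close>, each level exponentially finer than the previous one. At level
  \<open>i\<close>, each pair of cells \<open>(C, D)\<close> is split by a sign on the children of \<open>C\<close> and a sign on the children
  of \<open>D\<close>, and the pair of children is joined iff the signs agree; the signs come from a code of positive
  rate and distance, so that any set spread over several children of \<open>C\<close> is split evenly by a positive
  proportion of the \<open>D\<close>. The level that decides about a pair of vertices is given by a Latin square.
  For a part \<open>X\<close> essentially contained in a cell of level \<open>i\<close> but in no cell of level \<open>i + 1\<close>, one
  compares the two halves of \<open>X\<close> against a half of \<open>D\<close>: summed over all parts meeting \<open>D\<close>, the finer levels cancel
  exactly, so that \<open>X\<close> lies in many irregular pairs. So the parts of a regular partition mostly follow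
  the cells, level after level, with errors that only add up.
\<close>

section \<open>Shattering and the graphs U(k)\<close>

text \<open>Large VC-dimension controls only the edges between two chosen vertex sets. A part may
  meet both sets, and then the densities of its pairs also involve the uncontrolled edges inside
  them. So regularity is never tested against the density of a pair: two subsets of \<open>X\<close>
  are compared with the same subset of \<open>Y\<close>, and the unknown density cancels. The
  constants follow from the Latin square. A level decides only a share 1/\<open>s\<close> of the
  pairs, so its signal is of order \<open>N\<close>/\<open>s\<close>. Vertices outside the main
  cells blur it and may accumulate over \<open>s\<close> levels, which forces a tolerance \<beta> of
  order 1/\<open>s\<close>^2 per level. The regularity error, measured against a set of relative
  size \<beta>, has to stay below 1/\<open>s\<close> again, whence \<epsilon> of order
  1/\<open>s\<close>^3. So about \<epsilon>^(-1/3) levels fit, and \<open>C\<close> = 1/4 absorbs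
  the constants. The energy argument takes about \<epsilon>^(-5) rounds of three exponentials each,
  so that \<open>C'\<close> = 6 suffices.\<close>

lemma has_vc_mono:
  assumes "has_vc G k" "j \<le> k"
  shows "has_vc G j"
proof -
  obtain a b where "\<forall>i\<in>{1..k}. a i \<in> verts G" "\<forall>S\<in>Pow {1..k}. b S \<in> verts G"
    "\<forall>i\<in>{1..k}. \<forall>S\<in>Pow {1..k}. {a i, b S} \<in> edges G \<longleftrightarrow> i \<in> S"
    using assms(1) unfolding has_vc_def by blast
  moreover have "{1..j} \<subseteq> {1..k}" "Pow {1..j} \<subseteq> Pow {1..k}" using assms(2) by auto
  ultimately show ?thesis
    unfolding has_vc_def by (intro exI[of _ a] exI[of _ b]) (simp add: subset_iff)
qed

text \<open>The vertices \<open>a i\<close> tell different sets \<open>S\<close> apart, so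
  \<open>b\<close> is injective. The resulting bound on \<open>k\<close> is what makes the GREATEST
  in \<open>vc_dim\<close> attained.\<close>

lemma has_vc_card:
  assumes "wf_graph G" "has_vc G k"
  shows "2 ^ k \<le> card (verts G)"
proof -
  obtain a b where b: "\<forall>S\<in>Pow {1..k}. b S \<in> verts G"
    and ab: "\<forall>i\<in>{1..k}. \<forall>S\<in>Pow {1..k}. {a i, b S} \<in> edges G \<longleftrightarrow> i \<in> S"
    using assms(2) unfolding has_vc_def by blast
  have "inj_on b (Pow {1..k})"
  proof (rule inj_onI)
    fix S T assume ST: "S \<in> Pow {1..k}" "T \<in> Pow {1..k}" "b S = b T"
    then have "i \<in> S \<longleftrightarrow> i \<in> T" if "i \<in> {1..k}" for i
      using ab that by metis
    then show "S = T" using ST by blast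
  qed
  then have "card (Pow {1..k}) \<le> card (verts G)"
    using b assms(1) by (intro card_inj_on_le[of b]) (auto simp: wf_graph_def)
  then show ?thesis by (simp add: card_Pow)
qed

lemma has_vc_le_card: "wf_graph G \<Longrightarrow> has_vc G k \<Longrightarrow> k \<le> card (verts G)"
  using has_vc_card[of G k] less_exp[of k] by linarith

lemma has_vc_le_vc_dim: "wf_graph G \<Longrightarrow> has_vc G k \<Longrightarrow> k \<le> vc_dim G"
  unfolding vc_dim_def by (rule Greatest_le_nat[where b = "card (verts G)"]) (simp_all add: has_vc_le_card)

lemma has_vc_vc_dim:
  assumes "wf_graph G" "verts G \<noteq> {}"
  shows "has_vc G (vc_dim G)"
  unfolding vc_dim_def
proof (rule GreatestI_nat)
  \<comment> \<open>Even for k = 0 the vertex \<open>b {}\<close> has to exist, hence the nonempty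
    vertex set.\<close>
  show "has_vc G 0" using assms by (auto simp: has_vc_def)
  show "k \<le> card (verts G)" if "has_vc G k" for k
    using assms(1) that by (rule has_vc_le_card)
qed

lemma vc_dim_class_infinite_iff:
  assumes "hereditary \<H>"
  shows "vc_dim_class \<H> = \<infinity> \<longleftrightarrow> (\<forall>k. \<exists>G\<in>\<H>. has_vc G k)"
proof
  assume inf: "vc_dim_class \<H> = \<infinity>"
  show "\<forall>k. \<exists>G\<in>\<H>. has_vc G k"
  proof
    fix k :: nat
    \<comment> \<open>The empty graph has an unspecified \<open>vc_dim\<close>, so it has to be avoided explicitly.\<close>
    define u where "u = (GREATEST j::nat. False)"
    have "enat (max k u) < (SUP G\<in>\<H>. enat (vc_dim G))"
      using inf by (simp add: vc_dim_class_def)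
    then obtain G where G: "G \<in> \<H>" "max k u < vc_dim G"
      by (auto simp: less_SUP_iff)
    have "verts G \<noteq> {}"
    proof
      assume "verts G = {}"
      then have "has_vc G = (\<lambda>_. False)" by (auto simp: has_vc_def fun_eq_iff)
      then have "vc_dim G = u" by (simp add: vc_dim_def u_def)
      then show False using G by simp
    qed
    then have "has_vc G (vc_dim G)"
      using has_vc_vc_dim G assms by (auto simp: hereditary_def)
    then have "has_vc G k" using G(2) by (intro has_vc_mono[of G "vc_dim G" k]) simp_all
    then show "\<exists>G\<in>\<H>. has_vc G k" using G(1) by blast
  qed
next
  assume R: "\<forall>k. \<exists>G\<in>\<H>. has_vc G k"
  have "enat k \<le> vc_dim_class \<H>" for k
  proof -
    obtain G where G: "G \<in> \<H>" "has_vc G k" using R by blast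
    then have "enat k \<le> enat (vc_dim G)"
      using assms has_vc_le_vc_dim[of G k] by (simp add: hereditary_def)
    also have "\<dots> \<le> vc_dim_class \<H>"
      unfolding vc_dim_class_def using G(1) by (rule SUP_upper)
    finally show ?thesis .
  qed
  then show "vc_dim_class \<H> = \<infinity>"
    by (cases "vc_dim_class \<H>") (metis Suc_n_not_le_n enat_ord_simps(1), simp)
qed

lemma U_b_eq: "U_b S = 2 * set_encode S + 1"
  by (simp add: U_b_def set_encode_def)

lemma U_b_inject: "S \<subseteq> {1..k} \<Longrightarrow> T \<subseteq> {1..k} \<Longrightarrow> U_b S = U_b T \<longleftrightarrow> S = T"
  using set_encode_eq[of S T] finite_subset[of _ "{1..k}"] by (simp add: U_b_eq)

lemma edge_U_iff:
  assumes "T \<subseteq> {1..k}"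
  shows "{U_a i, U_b T} \<in> edges (U k) \<longleftrightarrow> i \<in> T"
proof
  assume "{U_a i, U_b T} \<in> edges (U k)"
  then obtain j S where S: "S \<subseteq> {1..k}" "j \<in> S" "{U_a i, U_b T} = {U_a j, U_b S}"
    by (auto simp: U_def edges_def)
  have "U_a i \<noteq> U_b S" "U_a j \<noteq> U_b T" by (simp_all add: U_a_def U_b_eq) presburger+
  then have "U_a i = U_a j" "U_b T = U_b S" using S(3) by (auto simp: doubleton_eq_iff)
  then show "i \<in> T" using S assms U_b_inject[of S k T] by (auto simp: U_a_def)
next
  show "i \<in> T \<Longrightarrow> {U_a i, U_b T} \<in> edges (U k)"
    using assms unfolding U_def edges_def snd_conv by blast
qed

lemma edge_U_parity: "{x, y} \<in> edges (U k) \<Longrightarrow> even x \<noteq> even y"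
  by (auto simp: U_def edges_def U_a_def U_b_eq doubleton_eq_iff)

lemma edge_Bip_iff:
  "{x, y} \<in> edges (Bip G) \<longleftrightarrow> even x \<noteq> even y \<and> {x div 2, y div 2} \<in> edges G"
proof
  assume "{x, y} \<in> edges (Bip G)"
  then obtain v w where "{v, w} \<in> edges G" "{x, y} = {2 * v, 2 * w + 1}"
    by (auto simp: Bip_def edges_def)
  then show "even x \<noteq> even y \<and> {x div 2, y div 2} \<in> edges G"
    by (auto simp: doubleton_eq_iff insert_commute)
next
  have main: "{x, y} \<in> edges (Bip G)"
    if "even x" "odd y" "{x div 2, y div 2} \<in> edges G" for x y
  proof -
    have "{x, y} = {2 * (x div 2), 2 * (y div 2) + 1}" using that by simp
    then show ?thesis using that(3) unfolding Bip_def edges_def snd_conv by blast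
  qed
  assume "even x \<noteq> even y \<and> {x div 2, y div 2} \<in> edges G"
  then show "{x, y} \<in> edges (Bip G)"
    using main[of x y] main[of y x] by (cases "even x") (auto simp: insert_commute)
qed

lemma wf_graph_U: "wf_graph (U k)"
proof -
  have ne: "U_a i \<noteq> U_b S" for i S by (simp add: U_a_def U_b_eq) presburger
  then show ?thesis
    unfolding wf_graph_def
  proof (intro conjI ballI)
    fix e assume "e \<in> edges (U k)"
    then obtain i S where "S \<subseteq> {1..k}" "i \<in> S" "e = {U_a i, U_b S}"
      by (auto simp: U_def edges_def)
    then show "\<exists>x y. x \<noteq> y \<and> x \<in> verts (U k) \<and> y \<in> verts (U k) \<and> e = {x, y}"
      using ne[of i S] by (intro exI[of _ "U_a i"] exI[of _ "U_b S"]) (auto simp: U_def verts_def)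
  qed (simp add: U_def verts_def)
qed

text \<open>In \<open>G\<close> some \<open>a i\<close> may equal some \<open>b S\<close>, and edges
  among the \<open>a i\<close> are arbitrary. \<open>Bip\<close> repairs both: the
  \<open>a i\<close> are taken from the first copy of the vertices, the \<open>b S\<close> from the
  second.\<close>

lemma U_in_Bip_class:
  assumes "G \<in> \<H>" "wf_graph G" "has_vc G k"
  shows "U k \<in> Bip_class \<H>"
proof -
  obtain a b where a: "\<forall>i\<in>{1..k}. a i \<in> verts G" and b: "\<forall>S\<in>Pow {1..k}. b S \<in> verts G"
    and ab: "\<forall>i\<in>{1..k}. \<forall>S\<in>Pow {1..k}. {a i, b S} \<in> edges G \<longleftrightarrow> i \<in> S"
    using assms(3) unfolding has_vc_def by blast
  \<comment> \<open>Vertices of \<open>U k\<close> are told apart by parity;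
    \<open>set_decode\<close> inverts the binary code behind \<open>U_b\<close>.\<close>
  define f where "f n = (if even n then 2 * a (n div 2) else 2 * b (set_decode (n div 2)) + 1)" for n
  have fa: "f (U_a i) = 2 * a i" for i by (simp add: f_def U_a_def)
  have fb: "f (U_b S) = 2 * b S + 1" if "S \<subseteq> {1..k}" for S
    using finite_subset[OF that] by (simp add: f_def U_b_eq set_encode_inverse)
  have vU: "x \<in> verts (U k) \<longleftrightarrow> (\<exists>i\<in>{1..k}. x = U_a i) \<or> (\<exists>S\<subseteq>{1..k}. x = U_b S)" for x
    by (auto simp: U_def verts_def)
  have f_inj: "inj_on f (verts (U k))"
  proof (rule inj_onI)
    fix x y assume xy: "x \<in> verts (U k)" "y \<in> verts (U k)" "f x = f y"
    have evf: "even (f z) = even z" for z by (simp add: f_def)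
    then have "even x = even y" using xy(3) by metis
    then consider (A) i j where "i \<in> {1..k}" "j \<in> {1..k}" "x = U_a i" "y = U_a j"
      | (B) S T where "S \<subseteq> {1..k}" "T \<subseteq> {1..k}" "x = U_b S" "y = U_b T"
      using xy(1,2) unfolding vU by (auto simp: U_a_def U_b_eq)
    then show "x = y"
    proof cases
      case A
      then have "a i = a j" using xy(3) fa by simp
      \<comment> \<open>The vertex \<open>b {i}\<close> is adjacent to \<open>a i\<close> but to no
        other \<open>a j\<close>.\<close>
      then have "i \<in> {i} \<longleftrightarrow> j \<in> {i}" using A ab by (metis Pow_iff empty_subsetI insert_subset)
      then show ?thesis using A by simp
    next
      case B
      then have "b S = b T" using xy(3) fb by simp
      then have "i \<in> S \<longleftrightarrow> i \<in> T" if "i \<in> {1..k}" for i using ab B that by (metis Pow_iff)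
      then show ?thesis using B by (metis subset_antisym subsetD subsetI)
    qed
  qed
  have par: "even (f z) = even z" for z by (simp add: f_def)
  have edge: "{x, y} \<in> edges (U k) \<longleftrightarrow> {f x, f y} \<in> edges (Bip G)"
    if xy: "x \<in> verts (U k)" "y \<in> verts (U k)" for x y
  proof -
    have AB: "{U_a i, U_b S} \<in> edges (U k) \<longleftrightarrow> {f (U_a i), f (U_b S)} \<in> edges (Bip G)"
      if "i \<in> {1..k}" "S \<subseteq> {1..k}" for i S
      using that ab by (simp add: edge_U_iff fa fb edge_Bip_iff)
    consider "even x = even y"
      | i S where "i \<in> {1..k}" "S \<subseteq> {1..k}" "x = U_a i" "y = U_b S"
      | i S where "i \<in> {1..k}" "S \<subseteq> {1..k}" "y = U_a i" "x = U_b S"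
      using xy unfolding vU by (auto simp: U_a_def U_b_eq)
    then show ?thesis
    proof cases
      case 1
      then show ?thesis using edge_U_parity edge_Bip_iff par by metis
    qed (use AB in \<open>auto simp: insert_commute\<close>)
  qed
  let ?S = "f ` verts (U k)"
  have "?S \<subseteq> verts (Bip G)"
    using a b fa fb unfolding Bip_def verts_def[of "(_, _)"] by (auto simp: vU)
  moreover have "graph_iso (U k) (induced (Bip G) ?S)"
    unfolding graph_iso_def
    by (rule exI[of _ f])
      (use f_inj edge in \<open>auto simp: bij_betw_def induced_def verts_def edges_def\<close>)
  ultimately show ?thesis using assms(1) wf_graph_U unfolding Bip_class_def by blast
qed

lemma has_vc_if_U_in_Bip_class:
  assumes "U (Suc k) \<in> Bip_class \<H>"
  shows "\<exists>G\<in>\<H>. has_vc G k"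
proof -
  let ?K = "{1..Suc k}"
  obtain G S f where G: "G \<in> \<H>" "S \<subseteq> verts (Bip G)"
    and bij: "bij_betw f (verts (U (Suc k))) S"
    and iso: "\<forall>x\<in>verts (U (Suc k)). \<forall>y\<in>verts (U (Suc k)).
        {x, y} \<in> edges (U (Suc k)) \<longleftrightarrow> {f x, f y} \<in> edges (induced (Bip G) S)"
    using assms unfolding Bip_class_def graph_iso_def by (auto simp: induced_def verts_def)
  have Ua: "U_a i \<in> verts (U (Suc k))" if "i \<in> ?K" for i
    using that by (auto simp: U_def verts_def)
  have Ub: "U_b T \<in> verts (U (Suc k))" if "T \<subseteq> ?K" for T
    using that by (auto simp: U_def verts_def)
  have fS: "f x \<in> S" if "x \<in> verts (U (Suc k))" for x
    using bij that by (auto simp: bij_betw_def)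
  have edge: "{f (U_a i), f (U_b T)} \<in> edges (Bip G) \<longleftrightarrow> i \<in> T" if "i \<in> ?K" "T \<subseteq> ?K" for i T
    using iso Ua[OF that(1)] Ub[OF that(2)] fS edge_U_iff[OF that(2)]
    by (auto simp: induced_def edges_def)
  have half: "f x div 2 \<in> verts G" if "x \<in> verts (U (Suc k))" for x
    using fS[OF that] G(2) by (auto simp: Bip_def verts_def)
  \<comment> \<open>The vertex for the full set is adjacent to every \<open>a i\<close>, so all of
    these land on the same side of \<open>Bip G\<close>.\<close>
  have par1: "even (f (U_a i)) \<noteq> even (f (U_b ?K))" if "i \<in> ?K" for i
    using edge[of i ?K] that by (auto simp: edge_Bip_iff)
  \<comment> \<open>The isolated vertex \<open>b\<^sub>\<emptyset>\<close> may lie on either side of \<open>Bip G\<close>, hence only sets containing \<open>k + 1\<close>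
      are used.\<close>
  have par: "even (f (U_a i)) \<noteq> even (f (U_b (insert (Suc k) T)))" if "i \<in> ?K" "T \<subseteq> {1..k}" for i T
  proof -
    have "insert (Suc k) T \<subseteq> ?K" using that by auto
    then have "even (f (U_a (Suc k))) \<noteq> even (f (U_b (insert (Suc k) T)))"
      using edge[of "Suc k" "insert (Suc k) T"] by (auto simp: edge_Bip_iff)
    then show ?thesis using par1[of i] par1[of "Suc k"] that by auto
  qed
  have "has_vc G k"
    unfolding has_vc_def
  proof (intro exI conjI ballI)
    fix i T assume i: "i \<in> {1..k}" and T: "T \<in> Pow {1..k}"
    have "insert (Suc k) T \<subseteq> ?K" using T by auto
    then have "{f (U_a i), f (U_b (insert (Suc k) T))} \<in> edges (Bip G) \<longleftrightarrow> i \<in> insert (Suc k) T"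
      using i edge by auto
    then show "{f (U_a i) div 2, f (U_b (insert (Suc k) T)) div 2} \<in> edges G \<longleftrightarrow> i \<in> T"
      using i T par[of i T] by (auto simp: edge_Bip_iff)
  next
    fix T assume "T \<in> Pow {1..k}"
    then show "f (U_b (insert (Suc k) T)) div 2 \<in> verts G" by (intro half Ub) auto
  qed (use half Ua in auto)
  then show ?thesis using G by blast
qed

lemma U_in_Bip_class_iff:
  assumes "hereditary \<H>"
  shows "(\<forall>k\<ge>1. U k \<in> Bip_class \<H>) \<longleftrightarrow> (\<forall>k. \<exists>G\<in>\<H>. has_vc G k)"
proof
  assume "\<forall>k\<ge>1. U k \<in> Bip_class \<H>"
  then show "\<forall>k. \<exists>G\<in>\<H>. has_vc G k" by (intro allI has_vc_if_U_in_Bip_class) simp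
next
  assume R: "\<forall>k. \<exists>G\<in>\<H>. has_vc G k"
  have "\<forall>G\<in>\<H>. wf_graph G" using assms by (simp add: hereditary_def)
  then show "\<forall>k\<ge>1. U k \<in> Bip_class \<H>" using R U_in_Bip_class by blast
qed

section \<open>Edge counts and regular partitions\<close>

definition ecount :: "ngraph \<Rightarrow> nat set \<Rightarrow> nat set \<Rightarrow> real" where
  "ecount G X Y = (\<Sum>x\<in>X. \<Sum>y\<in>Y. of_bool ({x, y} \<in> edges G))"

lemma density_eq:
  assumes "finite X" "finite Y"
  shows "density G X Y = ecount G X Y / (real (card X) * real (card Y))"
proof -
  have "card {(x, y) \<in> X \<times> Y. {x, y} \<in> edges G} = card (SIGMA x:X. {y \<in> Y. {x, y} \<in> edges G})"
    by (rule arg_cong[where f = card]) auto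
  also have "\<dots> = (\<Sum>x\<in>X. card {y \<in> Y. {x, y} \<in> edges G})"
    using assms by simp
  finally have "card {(x, y) \<in> X \<times> Y. {x, y} \<in> edges G} = (\<Sum>x\<in>X. card {y \<in> Y. {x, y} \<in> edges G})" .
  moreover have "(\<Sum>y\<in>Y. of_bool ({x, y} \<in> edges G)) = real (card {y \<in> Y. {x, y} \<in> edges G})" for x
    using assms by (simp add: sum.If_cases of_bool_def Int_def)
  ultimately show ?thesis
    by (simp add: density_def ecount_def)
qed

lemma ecount_le: "ecount G X Y \<le> real (card X) * real (card Y)"
proof -
  have "ecount G X Y \<le> (\<Sum>x\<in>X. \<Sum>y\<in>Y. 1)"
    unfolding ecount_def by (intro sum_mono) simp
  then show ?thesis by simp
qed

lemma ecount_commute: "ecount G X Y = ecount G Y X"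
  unfolding ecount_def by (subst sum.swap) (simp add: insert_commute)

lemma density_nonneg: "0 \<le> density G X Y"
  by (simp add: density_def)

lemma density_le_1:
  assumes "finite X" "finite Y"
  shows "density G X Y \<le> 1"
  unfolding density_eq[OF assms] by (rule divide_le_eq_1[THEN iffD2]) (use ecount_le[of G X Y] in force)

lemma ecount_eq_density:
  assumes "finite X" "finite Y"
  shows "ecount G X Y = density G X Y * (real (card X) * real (card Y))"
proof (cases "X = {} \<or> Y = {}")
  case True
  then show ?thesis by (auto simp: ecount_def)
qed (use assms in \<open>auto simp: density_eq\<close>)

text \<open>In this additive form regularity applies to subsets of any size: if \<open>X'\<close> or
  \<open>Y'\<close> is too small for the definition, then the product of their sizes is itself at
  most \<epsilon> times that of \<open>X\<close> and \<open>Y\<close>, and densities differ by at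
  most 1.\<close>

lemma regular_pair_ecount:
  assumes reg: "regular_pair G \<epsilon> X Y" and fin: "finite X" "finite Y"
    and sub: "X' \<subseteq> X" "Y' \<subseteq> Y"
  shows "\<bar>ecount G X' Y' - density G X Y * (real (card X') * real (card Y'))\<bar>
     \<le> \<epsilon> * (real (card X) * real (card Y))"
proof -
  have fin': "finite X'" "finite Y'" using fin sub finite_subset by blast+
  have c: "real (card X') \<le> real (card X)" "real (card Y') \<le> real (card Y)"
    using fin sub by (simp_all add: card_mono)
  let ?p = "real (card X') * real (card Y')" and ?q = "real (card X) * real (card Y)"
  have pq: "?p \<le> ?q" "0 \<le> ?p" using c by (simp_all add: mult_mono)
  have eq: "ecount G X' Y' - density G X Y * ?p = (density G X' Y' - density G X Y) * ?p"
    using ecount_eq_density[OF fin', of G] by (simp add: algebra_simps)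
  have le1: "\<bar>density G X' Y' - density G X Y\<bar> \<le> 1"
    using density_le_1[OF fin] density_le_1[OF fin'] density_nonneg[of G X Y] density_nonneg[of G X' Y']
    by (smt (verit))
  show ?thesis
  proof (cases "\<epsilon> * real (card X) \<le> real (card X') \<and> \<epsilon> * real (card Y) \<le> real (card Y')")
    case True
    then have d: "\<bar>density G X' Y' - density G X Y\<bar> \<le> \<epsilon>"
      using reg sub unfolding regular_pair_def by (metis abs_minus_commute)
    then have "\<bar>(density G X' Y' - density G X Y) * ?p\<bar> \<le> \<epsilon> * ?p"
      using pq by (simp only: abs_mult mult_right_mono abs_of_nonneg)
    also have "\<dots> \<le> \<epsilon> * ?q" using d pq by (intro mult_left_mono) auto
    finally show ?thesis unfolding eq .
  next
    case False
    have "?p \<le> \<epsilon> * ?q"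
    proof (cases "real (card X') \<le> \<epsilon> * real (card X)")
      case True
      have "?p \<le> (\<epsilon> * real (card X)) * real (card Y)"
        using True c by (intro mult_mono) (auto intro: order_trans[OF _ True])
      then show ?thesis by (simp add: mult_ac)
    next
      case f: False
      then have T: "real (card Y') \<le> \<epsilon> * real (card Y)" using False by linarith
      have "?p \<le> real (card X) * (\<epsilon> * real (card Y))"
        using T c by (intro mult_mono) auto
      then show ?thesis by (simp add: mult_ac)
    qed
    moreover have "\<bar>(density G X' Y' - density G X Y) * ?p\<bar> \<le> 1 * ?p"
      unfolding abs_mult using le1 pq by (intro mult_mono) auto
    ultimately show ?thesis unfolding eq by linarith
  qed
qed

lemma card_pairs_in_parts:
  assumes fin: "finite V" and part: "partition_on V P"
  shows "real (card {(x, y) \<in> V \<times> V. \<exists>X\<in>P. \<exists>Y\<in>P. x \<in> X \<and> y \<in> Y \<and> R X Y})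
     = (\<Sum>X\<in>P. \<Sum>Y\<in>P. of_bool (R X Y) * (real (card X) * real (card Y)))"
proof -
  have finP: "finite P" using finite_elements[OF fin part] .
  have VP: "V = \<Union>P" and disj: "disjoint P" using part by (auto simp: partition_on_def)
  have finX: "finite X" if "X \<in> P" for X using that fin VP by (metis Union_upper finite_subset)
  let ?I = "{(X, Y) \<in> P \<times> P. R X Y}"
  have "{(x, y) \<in> V \<times> V. \<exists>X\<in>P. \<exists>Y\<in>P. x \<in> X \<and> y \<in> Y \<and> R X Y} = (\<Union>(X, Y)\<in>?I. X \<times> Y)"
    unfolding VP by auto
  also have "card \<dots> = (\<Sum>p\<in>?I. card (case p of (X, Y) \<Rightarrow> X \<times> Y))"
  proof (rule card_UN_disjoint)
    show "finite ?I" using finP by (auto intro: finite_subset[of _ "P \<times> P"])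
    show "\<forall>p\<in>?I. finite (case p of (X, Y) \<Rightarrow> X \<times> Y)" using finX by auto
    show "\<forall>p\<in>?I. \<forall>q\<in>?I. p \<noteq> q \<longrightarrow>
        (case p of (X, Y) \<Rightarrow> X \<times> Y) \<inter> (case q of (X, Y) \<Rightarrow> X \<times> Y) = {}"
    proof (intro ballI impI)
      fix p q assume pq: "p \<in> ?I" "q \<in> ?I" "p \<noteq> q"
      then have "fst p \<inter> fst q = {} \<or> snd p \<inter> snd q = {}"
        using disj unfolding disjoint_def by (cases p, cases q) auto
      then show "(case p of (X, Y) \<Rightarrow> X \<times> Y) \<inter> (case q of (X, Y) \<Rightarrow> X \<times> Y) = {}"
        by (auto simp: case_prod_unfold)
    qed
  qed
  also have "\<dots> = (\<Sum>p\<in>P \<times> P. of_bool (case p of (X, Y) \<Rightarrow> R X Y) * (case p of (X, Y) \<Rightarrow> card X * card Y))"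
    using finP by (intro sum.mono_neutral_cong_left) (auto simp: card_cartesian_product)
  also have "real \<dots> = (\<Sum>X\<in>P. \<Sum>Y\<in>P. of_bool (R X Y) * (real (card X) * real (card Y)))"
    by (simp add: sum.cartesian_product case_prod_unfold)
  finally show ?thesis .
qed

text \<open>All pairs of parts together weigh |V|^2, so the definition becomes an upper bound on the
  weight of the irregular ones. Both the upper and the lower bounds on the number of parts work with
  this form.\<close>

lemma regular_partition_iff:
  assumes fin: "finite (verts G)"
  shows "regular_partition G \<epsilon> P \<longleftrightarrow> partition_on (verts G) P \<and>
     (\<Sum>X\<in>P. \<Sum>Y\<in>P. of_bool (\<not> regular_pair G \<epsilon> X Y) * (real (card X) * real (card Y)))
       \<le> \<epsilon> * (real (card (verts G)))\<^sup>2"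
proof (cases "partition_on (verts G) P")
  case True
  let ?V = "verts G"
  let ?S = "\<lambda>R. \<Sum>X\<in>P. \<Sum>Y\<in>P. of_bool (R X Y) * (real (card X) * real (card Y))"
  have "{(x, y) \<in> ?V \<times> ?V. \<exists>X\<in>P. \<exists>Y\<in>P. x \<in> X \<and> y \<in> Y \<and> True} = ?V \<times> ?V"
    using True by (auto simp: partition_on_def)
  then have "?S (\<lambda>_ _. True) = (real (card ?V))\<^sup>2"
    using card_pairs_in_parts[OF fin True, of "\<lambda>_ _. True"]
    by (simp add: card_cartesian_product power2_eq_square)
  moreover have "?S (regular_pair G \<epsilon>) + ?S (\<lambda>X Y. \<not> regular_pair G \<epsilon> X Y) = ?S (\<lambda>_ _. True)"
    unfolding sum.distrib[symmetric] by (intro sum.cong refl) auto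
  ultimately show ?thesis
    using card_pairs_in_parts[OF fin True, of "regular_pair G \<epsilon>"] True
    unfolding regular_partition_def left_diff_distrib by linarith
qed (simp add: regular_partition_def)

lemma sum_card_Int_parts:
  assumes "finite V" "partition_on V P" "S \<subseteq> V"
  shows "(\<Sum>X\<in>P. real (card (S \<inter> X))) = real (card S)"
proof -
  have "card S = card (\<Union>X\<in>P. S \<inter> X)"
    using assms by (intro arg_cong[where f = card]) (auto simp: partition_on_def)
  also have "\<dots> = (\<Sum>X\<in>P. card (S \<inter> X))"
  proof (rule card_UN_disjoint)
    show "\<forall>X\<in>P. \<forall>Y\<in>P. X \<noteq> Y \<longrightarrow> S \<inter> X \<inter> (S \<inter> Y) = {}"
      using assms by (auto simp: partition_on_def disjoint_def)
  qed (use assms in \<open>auto intro: finite_elements finite_subset\<close>)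
  finally show ?thesis by simp
qed

section \<open>Sign codes\<close>

lemma sum_power_card_Pow:
  fixes x :: "'a :: comm_semiring_1"
  assumes "finite A"
  shows "(\<Sum>D\<in>Pow A. x ^ card D) = (1 + x) ^ card A"
  using prod_add[OF assms, of "\<lambda>_. x" "\<lambda>_. 1"] by (simp add: add.commute)

text \<open>Exponential weights: with weight \<open>?x ^ card D\<close> every member of the ball
  weighs at least (5/6)^m, while the whole cube weighs (1 + \<open>?x\<close>)^m. Since (5/6)^8 <
  1/4, the base is at most 5/4 = 3/2 * 5/6.\<close>

lemma hamming_ball_bound:
  fixes m :: nat
  shows "real (card {D \<in> Pow {..<m}. 8 * card D < m}) \<le> (3 / 2) ^ m"
proof -
  let ?B = "{D \<in> Pow {..<m}. 8 * card D < m}" and ?x = "(5 / 6) ^ 8 :: real"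
  have "real (card ?B) * (5 / 6) ^ m = (\<Sum>D\<in>?B. (5 / 6) ^ m)" by simp
  also have "\<dots> \<le> (\<Sum>D\<in>?B. ?x ^ card D)"
  proof (rule sum_mono)
    fix D assume "D \<in> ?B"
    then have "(5 / 6 :: real) ^ m \<le> (5 / 6) ^ (8 * card D)" by (intro power_decreasing) auto
    then show "(5 / 6) ^ m \<le> ?x ^ card D" by (simp only: power_mult)
  qed
  also have "\<dots> \<le> (\<Sum>D\<in>Pow {..<m}. ?x ^ card D)" by (intro sum_mono2) auto
  also have "\<dots> = (1 + ?x) ^ m" by (simp only: sum_power_card_Pow finite_lessThan card_lessThan)
  also have "\<dots> \<le> (3 / 2 * (5 / 6)) ^ m" by (intro power_mono) (simp_all add: power_numeral_reduce)
  finally show ?thesis unfolding power_mult_distrib by (rule mult_right_le_imp_le) simp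
qed

text \<open>Gilbert--Varshamov: the Hamming balls around a maximal separated family have to cover the whole
  cube.\<close>

lemma exists_code:
  fixes m :: nat
  assumes "m \<ge> 1"
  obtains \<C> where "\<C> \<subseteq> Pow {..<m}" "\<And>S. S \<in> \<C> \<Longrightarrow> {..<m} - S \<in> \<C>"
    "\<And>S T. S \<in> \<C> \<Longrightarrow> T \<in> \<C> \<Longrightarrow> S \<noteq> T \<Longrightarrow> m \<le> 8 * card (sym_diff S T)"
    "real (card \<C>) \<ge> (4 / 3) ^ m"
proof -
  let ?U = "{..<m}"
  \<comment> \<open>Closure under complement will make every coordinate balanced; therefore the
    maximal family is extended by complementary pairs.\<close>
  define ok where "ok \<C> \<longleftrightarrow> \<C> \<subseteq> Pow ?U \<and> (\<forall>S\<in>\<C>. ?U - S \<in> \<C>) \<and>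
     (\<forall>S\<in>\<C>. \<forall>T\<in>\<C>. S \<noteq> T \<longrightarrow> m \<le> 8 * card (sym_diff S T))" for \<C>
  have "finite {\<C>. ok \<C>}" by (rule finite_subset[of _ "Pow (Pow ?U)"]) (auto simp: ok_def)
  moreover have "ok {}" by (simp add: ok_def)
  ultimately obtain \<C> where C: "ok \<C>" and max: "\<And>\<D>. ok \<D> \<Longrightarrow> \<C> \<subseteq> \<D> \<Longrightarrow> \<C> = \<D>"
    using finite_has_maximal[of "{\<C>. ok \<C>}"] by blast
  have compl: "sym_diff (?U - S) (?U - T) = sym_diff S T" if "S \<subseteq> ?U" "T \<subseteq> ?U" for S T
    using that by auto
  have swap: "sym_diff (?U - S) T = sym_diff S (?U - T)" if "S \<subseteq> ?U" "T \<subseteq> ?U" for S T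
    using that by auto
  have cover: "\<exists>S\<in>\<C>. 8 * card (sym_diff S T) < m" if T: "T \<subseteq> ?U" for T
  proof (rule ccontr)
    assume "\<not> ?thesis"
    then have far: "m \<le> 8 * card (sym_diff S T)" if "S \<in> \<C>" for S
      using that by (auto simp: not_less)
    \<comment> \<open>The distance from \<open>S\<close> to \<open>?U - T\<close> is that from
      \<open>?U - S\<close> to \<open>T\<close>, and \<open>?U - S\<close> belongs to the code as
      well.\<close>
    have far': "m \<le> 8 * card (sym_diff S (?U - T))" if "S \<in> \<C>" for S
      using far[of "?U - S"] C that T by (auto simp: ok_def swap)
    have opp: "card (sym_diff T (?U - T)) = m"
    proof -
      have "sym_diff T (?U - T) = ?U" using T by auto
      then show ?thesis by simp
    qed
    have sc: "sym_diff A B = sym_diff B A" for A B :: "nat set" by auto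
    have "ok (insert T (insert (?U - T) \<C>))"
      unfolding ok_def
    proof (intro conjI ballI impI)
      fix A B assume AB: "A \<in> insert T (insert (?U - T) \<C>)" "B \<in> insert T (insert (?U - T) \<C>)" "A \<noteq> B"
      show "m \<le> 8 * card (sym_diff A B)"
      proof (cases "A \<in> \<C>")
        case True
        then show ?thesis using AB far[OF True] far'[OF True] C by (auto simp: ok_def)
      next
        case A: False
        show ?thesis
        proof (cases "B \<in> \<C>")
          case True
          then show ?thesis using AB A far[OF True] far'[OF True] by (auto simp: sc[of A B])
        next
          case False
          then have "sym_diff A B = sym_diff T (?U - T)" using A AB sc by auto
          then show ?thesis using opp by simp
        qed
      qed
    qed (use C T in \<open>auto simp: ok_def double_diff\<close>)
    then have "T \<in> \<C>" using max[of "insert T (insert (?U - T) \<C>)"] by blast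
    then show False using far[of T] assms by simp
  qed
  have CU: "\<C> \<subseteq> Pow ?U" using C by (simp add: ok_def)
  then have finC: "finite \<C>" by (rule finite_subset) simp
  let ?B = "{D \<in> Pow ?U. 8 * card D < m}"
  have finB: "finite ?B" by simp
  have "Pow ?U \<subseteq> (\<Union>S\<in>\<C>. sym_diff S ` ?B)"
  proof
    fix T assume T: "T \<in> Pow ?U"
    then obtain S where S: "S \<in> \<C>" "8 * card (sym_diff S T) < m" using cover by auto
    moreover have "T = sym_diff S (sym_diff S T)" by auto
    moreover have "sym_diff S T \<in> Pow ?U" using S T CU by auto
    ultimately show "T \<in> (\<Union>S\<in>\<C>. sym_diff S ` ?B)" by blast
  qed
  then have "card (Pow ?U) \<le> card (\<Union>S\<in>\<C>. sym_diff S ` ?B)"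
    using finC finB by (intro card_mono) auto
  also have "\<dots> \<le> (\<Sum>S\<in>\<C>. card (sym_diff S ` ?B))" using finC by (rule card_UN_le)
  also have "\<dots> \<le> (\<Sum>S\<in>\<C>. card ?B)" using finB by (intro sum_mono card_image_le)
  finally have "2 ^ m \<le> card \<C> * card ?B" by (simp add: card_Pow)
  then have "real (2 ^ m) \<le> real (card \<C> * card ?B)" by (simp only: of_nat_le_iff)
  also have "\<dots> \<le> real (card \<C>) * (3 / 2) ^ m"
    using hamming_ball_bound[of m] by (simp add: mult_left_mono)
  finally have "2 ^ m / (3 / 2) ^ m \<le> real (card \<C>)"
    by (simp add: pos_divide_le_eq del: power_divide)
  then have "(4 / 3) ^ m \<le> real (card \<C>)" by (simp flip: power_divide)
  then show thesis using C by (intro that[of \<C>]) (auto simp: ok_def)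
qed

text \<open>Complementing permutes the words of the code and flips every sign, so each coordinate
  sum equals its own negative. The words become the children of a cell, the coordinates the cells on
  the opposite side.\<close>

lemma exists_sign_code:
  fixes m :: nat
  assumes "m \<ge> 1"
  shows "\<exists>r bit. (4 / 3) ^ m \<le> real r \<and> (\<forall>c q. bit c q \<in> {-1, 1 :: real}) \<and>
     (\<forall>q<m. (\<Sum>c<r. bit c q) = 0) \<and>
     (\<forall>c<r. \<forall>d<r. c \<noteq> d \<longrightarrow> m \<le> 8 * card {q. q < m \<and> bit c q \<noteq> bit d q})"
proof -
  obtain \<C> where C: "\<C> \<subseteq> Pow {..<m}" and compl: "\<And>S. S \<in> \<C> \<Longrightarrow> {..<m} - S \<in> \<C>"
    and far: "\<And>S T. S \<in> \<C> \<Longrightarrow> T \<in> \<C> \<Longrightarrow> S \<noteq> T \<Longrightarrow> m \<le> 8 * card (sym_diff S T)"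
    and large: "real (card \<C>) \<ge> (4 / 3) ^ m"
    using exists_code[OF assms] by blast
  have "finite \<C>" using C by (rule finite_subset) simp
  then obtain h where h: "bij_betw h {..<card \<C>} \<C>"
    using ex_bij_betw_nat_finite[of \<C>] by (auto simp: atLeast0LessThan)
  define bit where "bit c q = (if q \<in> h c then 1 else -1 :: real)" for c q
  have "(\<Sum>c<card \<C>. bit c q) = 0" if q: "q < m" for q
  proof -
    let ?s = "\<lambda>S. if q \<in> S then 1 else -1 :: real"
    have "(\<Sum>c<card \<C>. bit c q) = (\<Sum>S\<in>\<C>. ?s S)"
      unfolding bit_def using sum.reindex_bij_betw[OF h, of ?s] by simp
    moreover have "(\<Sum>S\<in>\<C>. ?s S) = (\<Sum>S\<in>\<C>. ?s ({..<m} - S))"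
      using C compl
      by (intro sum.reindex_bij_witness[of _ "\<lambda>S. {..<m} - S" "\<lambda>S. {..<m} - S"]) (auto simp: double_diff)
    moreover have "(\<Sum>S\<in>\<C>. ?s ({..<m} - S)) = - (\<Sum>S\<in>\<C>. ?s S)"
      unfolding sum_negf[symmetric] using q by (intro sum.cong) auto
    ultimately show ?thesis by linarith
  qed
  moreover have "m \<le> 8 * card {q. q < m \<and> bit c q \<noteq> bit d q}"
    if "c < card \<C>" "d < card \<C>" "c \<noteq> d" for c d
  proof -
    have hc: "h c \<in> \<C>" "h d \<in> \<C>" "h c \<noteq> h d"
      using h that by (auto simp: bij_betw_def inj_on_def)
    then have "{q. q < m \<and> bit c q \<noteq> bit d q} = sym_diff (h c) (h d)"
      using C by (auto simp: bit_def)
    then show ?thesis using far hc by simp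
  qed
  moreover have "bit c q \<in> {-1, 1}" for c q by (simp add: bit_def)
  ultimately show ?thesis using large by (intro exI[of _ "card \<C>"] exI[of _ bit]) blast
qed

section \<open>The multilevel sign pattern\<close>

lemma sum_lessThan_mult:
  fixes f :: "nat \<Rightarrow> 'a :: comm_monoid_add"
  shows "(\<Sum>b<x * y. f b) = (\<Sum>v<y. \<Sum>u<x. f (u + x * v))"
proof -
  have "(\<Sum>b<x * y. f b) = (\<Sum>v<y. \<Sum>b\<in>{v * x..<v * x + x}. f b)"
    by (simp add: sum.nat_group mult.commute)
  also have "\<dots> = (\<Sum>v<y. \<Sum>u<x. f (u + x * v))"
  proof (rule sum.cong[OF refl])
    fix v
    have "{v * x..<v * x + x} = {0 + v * x..<x + v * x}" by (simp add: add.commute)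
    then show "(\<Sum>b\<in>{v * x..<v * x + x}. f b) = (\<Sum>u<x. f (u + x * v))"
      unfolding lessThan_atLeast0 by (simp only: sum.shift_bounds_nat_ivl mult.commute)
  qed
  finally show ?thesis .
qed

text \<open>Raising the shift by one drops the term at \<open>k mod s\<close> and brings it back as
  \<open>(k + s) mod s\<close>. Applied to the rows of the Latin square of levels.\<close>

lemma sum_lessThan_shift_mod:
  fixes h :: "nat \<Rightarrow> 'a :: ab_group_add"
  shows "(\<Sum>v<s. h ((k + v) mod s)) = (\<Sum>v<s. h v)"
proof (induction k)
  case (Suc k)
  have "(\<Sum>v<s. h ((k + v) mod s)) + h ((k + s) mod s) = h (k mod s) + (\<Sum>v<s. h ((Suc k + v) mod s))"
    using sum.lessThan_Suc_shift[of "\<lambda>v. h ((k + v) mod s)" s] by simp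
  then show ?case using Suc by simp
qed simp

text \<open>\<open>m i\<close> is the number of cells of level \<open>i\<close>, which are the
  residue classes modulo \<open>m i\<close>. Each has \<open>r i\<close> children, and
  \<open>bit i c q\<close> is the sign of child number \<open>c\<close> towards the opposite cell
  \<open>q\<close>. As the code has length \<open>m i\<close> and \<open>r i\<close> words,
  \<open>r i\<close> can be exponential in \<open>m i\<close>; any two children are separated by an
  eighth of the opposite cells.\<close>

locale sign_tower =
  fixes m r :: "nat \<Rightarrow> nat" and bit :: "nat \<Rightarrow> nat \<Rightarrow> nat \<Rightarrow> real"
  assumes m_0: "m 0 = 1" and m_Suc: "m (Suc i) = m i * r i"
    and r_large: "(4 / 3) ^ m i \<le> real (r i)"
    and bit_range: "bit i c q \<in> {-1, 1}"
    and bit_balanced: "q < m i \<Longrightarrow> (\<Sum>c<r i. bit i c q) = 0"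
    and bit_dist: "c < r i \<Longrightarrow> d < r i \<Longrightarrow> c \<noteq> d \<Longrightarrow>
      m i \<le> 8 * card {q. q < m i \<and> bit i c q \<noteq> bit i d q}"
begin

lemma r_pos: "0 < r i"
proof -
  have "0 < (4 / 3 :: real) ^ m i" by simp
  then have "0 < real (r i)" using r_large[of i] by linarith
  then show ?thesis by simp
qed

lemma m_pos: "0 < m i"
  by (induction i) (simp_all add: m_0 m_Suc r_pos)

lemma r_ge_2: "2 \<le> r i"
proof -
  have "1 < (4 / 3 :: real) ^ m i" using m_pos by (intro one_less_power) auto
  then have "1 < real (r i)" using r_large[of i] by linarith
  then show ?thesis by simp
qed

lemma m_dvd: "i \<le> j \<Longrightarrow> m i dvd m j"
  by (induction j rule: dec_induct) (auto simp: m_Suc)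

text \<open>The digit of \<open>a\<close> at level \<open>i\<close> in the mixed-radix expansion
  with radices \<open>r\<close>: it names the child in which \<open>a\<close> lies within its cell
  of level \<open>i\<close>.\<close>

definition label :: "nat \<Rightarrow> nat \<Rightarrow> nat" where
  "label i a = a div m i mod r i"

lemma label_less: "label i a < r i"
  by (simp add: label_def r_pos)

lemma label_eq: "label i a = a mod m (Suc i) div m i"
  using m_pos[of i] by (simp add: label_def m_Suc mod_mult2_eq)

lemma mod_m_Suc: "a mod m (Suc i) = m i * label i a + a mod m i"
  by (simp add: label_def m_Suc mod_mult2_eq)

text \<open>The first factor is the sign of the child of \<open>a\<close> towards the cell of
  \<open>b\<close>, the second one that of the child of \<open>b\<close> towards the cell of
  \<open>a\<close>. The product is 1 iff they agree, and it is symmetric, so both sides can be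
  treated alike.\<close>

definition g :: "nat \<Rightarrow> nat \<Rightarrow> nat \<Rightarrow> real" where
  "g i a b = bit i (label i a) (b mod m i) * bit i (label i b) (a mod m i)"

lemma g_commute: "g i a b = g i b a"
  by (simp add: g_def)

lemma g_range: "g i a b \<in> {-1, 1}"
  using bit_range[of i "label i a" "b mod m i"] bit_range[of i "label i b" "a mod m i"]
  by (auto simp: g_def)

lemma mod_m_cong: "a mod m j = a' mod m j \<Longrightarrow> i \<le> j \<Longrightarrow> a mod m i = a' mod m i"
  using mod_mod_cancel[OF m_dvd[of i j]] by metis

lemma label_cong: "a mod m j = a' mod m j \<Longrightarrow> i < j \<Longrightarrow> label i a = label i a'"
  unfolding label_eq using mod_m_cong[of a j a' "Suc i"] by simp

lemma g_cong: "b mod m j = b' mod m j \<Longrightarrow> i < j \<Longrightarrow> g i a b = g i a b'"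
  unfolding g_def using mod_m_cong[of b j b' i] label_cong[of b j b' i] by simp

lemma card_bit_eq_1:
  assumes "C < m i"
  shows "real (card {c. c < r i \<and> bit i c C = 1}) = real (r i) / 2"
proof -
  have "real (card {c. c < r i \<and> bit i c C = 1}) = (\<Sum>c<r i. of_bool (bit i c C = 1))"
    by (simp add: of_bool_def sum.If_cases Int_def)
  also have "\<dots> = (\<Sum>c<r i. (1 + bit i c C) / 2)"
  proof (intro sum.cong refl)
    show "of_bool (bit i c C = 1) = (1 + bit i c C) / 2" for c
      using bit_range[of i c C] by auto
  qed
  also have "\<dots> = (real (r i) + (\<Sum>c<r i. bit i c C)) / 2"
    by (simp add: sum_divide_distrib[symmetric] sum.distrib)
  finally show ?thesis using bit_balanced[OF assms] by simp
qed

lemma sum_periodic: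
  assumes "i \<le> s" and per: "\<And>b. F (b mod m i) = F b"
  shows "(\<Sum>b<m s. F b) = real (m s) / real (m i) * (\<Sum>b<m i. F b)"
proof -
  obtain k where k: "m s = m i * k" using m_dvd[OF assms(1)] by (elim dvdE)
  have "F (u + m i * v) = F u" for u v
    using per[of u] per[of "u + m i * v"] by simp
  then have "(\<Sum>b<m s. F b) = real k * (\<Sum>b<m i. F b)" unfolding k sum_lessThan_mult by simp
  then show ?thesis using k m_pos[of i] by simp
qed

lemma sum_m_Suc:
  "(\<Sum>b<m (Suc i). F b (label i b) (b mod m i)) = (\<Sum>w<m i. \<Sum>c<r i. F (w + m i * c) c w)"
proof -
  have "(\<Sum>b<m (Suc i). F b (label i b) (b mod m i))
      = (\<Sum>c<r i. \<Sum>w<m i. F (w + m i * c) (label i (w + m i * c)) ((w + m i * c) mod m i))"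
    unfolding m_Suc sum_lessThan_mult ..
  also have "\<dots> = (\<Sum>c<r i. \<Sum>w<m i. F (w + m i * c) c w)"
    using m_pos[of i] by (intro sum.cong refl) (simp add: label_def div_add1_eq)
  also have "\<dots> = (\<Sum>w<m i. \<Sum>c<r i. F (w + m i * c) c w)" by (rule sum.swap)
  finally show ?thesis .
qed

text \<open>The half of the opposite cell \<open>q\<close> whose children have sign 1 towards
  \<open>C\<close>. For \<open>a\<close> in \<open>C\<close> the value \<open>g i a b\<close> is
  constant on it, namely the sign of the child of \<open>a\<close> towards \<open>q\<close>.\<close>

definition half :: "nat \<Rightarrow> nat \<Rightarrow> nat \<Rightarrow> nat \<Rightarrow> bool" where
  "half i q C b \<longleftrightarrow> b mod m i = q \<and> bit i (label i b) C = 1"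

lemma half_cong: "b mod m j = b' mod m j \<Longrightarrow> i < j \<Longrightarrow> half i q C b = half i q C b'"
  unfolding half_def using mod_m_cong[of b j b' i] label_cong[of b j b' i] by simp

text \<open>The half cells are unions of cells of all finer levels, and on those the sign is balanced.\<close>

lemma sum_half_g_above:
  assumes "i < j" "j < s"
  shows "(\<Sum>b<m s. of_bool (half i q C b) * g j a b) = 0"
proof -
  let ?F = "\<lambda>b. of_bool (half i q C b) * g j a b"
  have "?F (b mod m (Suc j)) = ?F b" for b
    using assms half_cong[of "b mod m (Suc j)" "Suc j" b i q C] g_cong[of "b mod m (Suc j)" "Suc j" b j a]
    by simp
  then have "(\<Sum>b<m s. ?F b) = real (m s) / real (m (Suc j)) * (\<Sum>b<m (Suc j). ?F b)"
    using assms by (intro sum_periodic) auto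
  also have "(\<Sum>b<m (Suc j). ?F b) = (\<Sum>b<m (Suc j). of_bool (half i q C b) *
      (bit j (label j a) (b mod m j) * bit j (label j b) (a mod m j)))"
    by (simp add: g_def)
  also have "\<dots> = (\<Sum>w<m j. \<Sum>c<r j. of_bool (half i q C (w + m j * c)) *
      (bit j (label j a) w * bit j c (a mod m j)))"
    by (rule sum_m_Suc)
  also have "\<dots> = (\<Sum>w<m j. (of_bool (half i q C w) * bit j (label j a) w) * (\<Sum>c<r j. bit j c (a mod m j)))"
  proof -
    have eq: "half i q C (w + m j * c) = half i q C w" for w c
      using half_cong[of "w + m j * c" j w i q C] assms(1) by simp
    show ?thesis unfolding sum_distrib_left eq by (intro sum.cong refl) (simp only: mult_ac)
  qed
  also have "\<dots> = 0" using bit_balanced[of "a mod m j" j] m_pos[of j] by simp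
  finally show ?thesis by simp
qed

text \<open>On the half the second factor of \<open>g\<close> is 1, so every summand is the sign of
  \<open>a\<close>; by balance the half contains \<open>m s\<close> / (2 \<open>m i\<close>) of the
  finest residues.\<close>

lemma sum_half_g_same:
  assumes "i < s" "q < m i"
  shows "(\<Sum>b<m s. of_bool (half i q (a mod m i) b) * g i a b)
    = bit i (label i a) q * (real (m s) / (2 * real (m i)))"
proof -
  define C where "C = a mod m i"
  have C: "C < m i" using m_pos[of i] by (simp add: C_def)
  let ?F = "\<lambda>b. of_bool (half i q C b) * g i a b"
  have "?F (b mod m (Suc i)) = ?F b" for b
    using half_cong[of "b mod m (Suc i)" "Suc i" b i q C] g_cong[of "b mod m (Suc i)" "Suc i" b i a]
    by simp
  then have "(\<Sum>b<m s. ?F b) = real (m s) / real (m (Suc i)) * (\<Sum>b<m (Suc i). ?F b)"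
    using assms by (intro sum_periodic) auto
  also have "(\<Sum>b<m (Suc i). ?F b) = (\<Sum>b<m (Suc i). of_bool (b mod m i = q \<and> bit i (label i b) C = 1) *
      (bit i (label i a) (b mod m i) * bit i (label i b) C))"
    by (simp add: g_def half_def C_def)
  also have "\<dots> = (\<Sum>w<m i. \<Sum>c<r i. of_bool (w = q \<and> bit i c C = 1) * (bit i (label i a) w * bit i c C))"
    by (rule sum_m_Suc)
  also have "\<dots> = (\<Sum>w<m i. if w = q then bit i (label i a) q * (\<Sum>c<r i. of_bool (bit i c C = 1)) else 0)"
    by (intro sum.cong) (auto simp: sum_distrib_left intro!: sum.cong)
  also have "\<dots> = bit i (label i a) q * (\<Sum>c<r i. of_bool (bit i c C = 1))"
    using assms by (simp add: sum.delta)
  also have "(\<Sum>c<r i. of_bool (bit i c C = 1)) = real (card {c. c < r i \<and> bit i c C = 1})"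
    by (simp add: of_bool_def sum.If_cases Int_def)
  also have "\<dots> = real (r i) / 2" by (rule card_bit_eq_1[OF C])
  also have "real (m s) / real (m (Suc i)) * (bit i (label i a) q * (real (r i) / 2))
      = bit i (label i a) q * (real (m s) / (2 * real (m i)))"
    using m_pos[of i] r_pos[of i] by (simp add: m_Suc field_simps)
  finally show ?thesis unfolding C_def .
qed

text \<open>Coarser levels see only the cell of \<open>a\<close>, so they drop out when two vertices
  of one cell are compared.\<close>

lemma g_eq_below:
  assumes "j < i" "a mod m i = a' mod m i"
  shows "g j a b = g j a' b"
  using g_cong[OF assms(2,1), of b] by (simp add: g_commute)

text \<open>Whatever sign child \<open>c\<close> has, the vertices of the opposite sign all lie
  outside it, so one of the two classes is as small as the remainder.\<close>

lemma split_product_le: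
  assumes "finite Z"
  shows "real (card {a \<in> Z. bit i (label i a) q = 1}) * real (card {a \<in> Z. bit i (label i a) q = -1})
    \<le> real (card Z) * real (card {a \<in> Z. label i a \<noteq> c})"
proof -
  let ?p = "card {a \<in> Z. bit i (label i a) q = 1}" and ?n = "card {a \<in> Z. bit i (label i a) q = -1}"
    and ?t = "card {a \<in> Z. label i a \<noteq> c}"
  have le: "?p \<le> card Z" "?n \<le> card Z" using assms by (auto intro: card_mono)
  have "?p \<le> ?t \<or> ?n \<le> ?t"
  proof (cases "bit i c q = 1")
    case True
    then have "?n \<le> ?t" using assms by (intro card_mono) auto
    then show ?thesis ..
  next
    case False
    then have "?p \<le> ?t" using assms by (intro card_mono) auto
    then show ?thesis ..
  qed
  then have "?p * ?n \<le> card Z * ?t"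
    using mult_le_mono[of ?p "card Z" ?n ?t] mult_le_mono[of ?p ?t ?n "card Z"] le
    by (auto simp: mult.commute)
  then show ?thesis by (simp only: of_nat_mult[symmetric] of_nat_le_iff)
qed

text \<open>Count ordered pairs of \<open>Z\<close> by the coordinates that separate them. Each
  vertex has at least \<open>\<theta>\<close> partners in other children, each such pair is
  separated by \<open>m i\<close> / 8 coordinates, and a coordinate separates twice the product of
  its two classes.\<close>

lemma sum_split_products_ge:
  assumes "finite Z" and \<theta>: "\<And>c. c < r i \<Longrightarrow> \<theta> \<le> card {a \<in> Z. label i a \<noteq> c}"
  shows "real (card Z) * real \<theta> * real (m i) / 16 \<le>
    (\<Sum>q<m i. real (card {a \<in> Z. bit i (label i a) q = 1}) * real (card {a \<in> Z. bit i (label i a) q = -1}))"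
    (is "_ \<le> (\<Sum>q<m i. ?P q * ?M q)")
proof -
  let ?b = "\<lambda>a q. bit i (label i a) q"
  have PM: "(\<Sum>a\<in>Z. \<Sum>a'\<in>Z. of_bool (?b a q \<noteq> ?b a' q)) = 2 * (?P q * ?M q)" for q
  proof -
    have P: "?P q = (\<Sum>a\<in>Z. of_bool (?b a q = 1))" and M: "?M q = (\<Sum>a\<in>Z. of_bool (?b a q = -1))"
      using assms(1) by (simp_all add: of_bool_def sum.If_cases Int_def)
    have "(\<Sum>a\<in>Z. \<Sum>a'\<in>Z. of_bool (?b a q \<noteq> ?b a' q) :: real) =
      (\<Sum>a\<in>Z. \<Sum>a'\<in>Z. of_bool (?b a q = 1) * of_bool (?b a' q = -1) + of_bool (?b a q = -1) * of_bool (?b a' q = 1))"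
    proof (intro sum.cong refl)
      fix a a'
      show "(of_bool (?b a q \<noteq> ?b a' q) :: real) =
        of_bool (?b a q = 1) * of_bool (?b a' q = -1) + of_bool (?b a q = -1) * of_bool (?b a' q = 1)"
        using bit_range[of i "label i a" q] bit_range[of i "label i a'" q] by auto
    qed
    also have "\<dots> = ?P q * ?M q + ?M q * ?P q"
      unfolding P M sum.distrib sum_product ..
    finally show ?thesis by simp
  qed
  have "real (card Z) * (real \<theta> * (real (m i) / 8)) = (\<Sum>a\<in>Z. real \<theta> * (real (m i) / 8))" by simp
  also have "\<dots> \<le> (\<Sum>a\<in>Z. \<Sum>a'\<in>{a'\<in>Z. label i a' \<noteq> label i a}. real (m i) / 8)"
    using \<theta>[OF label_less] by (intro sum_mono) (simp add: mult_right_mono)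
  also have "\<dots> \<le> (\<Sum>a\<in>Z. \<Sum>a'\<in>{a'\<in>Z. label i a' \<noteq> label i a}. \<Sum>q<m i. of_bool (?b a q \<noteq> ?b a' q))"
  proof (intro sum_mono)
    fix a a' assume "a' \<in> {a' \<in> Z. label i a' \<noteq> label i a}"
    then have "m i \<le> 8 * card {q. q < m i \<and> ?b a q \<noteq> ?b a' q}"
      by (intro bit_dist label_less) auto
    then show "real (m i) / 8 \<le> (\<Sum>q<m i. of_bool (?b a q \<noteq> ?b a' q))"
      by (simp add: of_bool_def sum.If_cases Int_def)
  qed
  also have "\<dots> \<le> (\<Sum>a\<in>Z. \<Sum>a'\<in>Z. \<Sum>q<m i. of_bool (?b a q \<noteq> ?b a' q))"
    using assms(1) by (intro sum_mono sum_mono2) (auto intro: sum_nonneg)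
  also have "\<dots> = (\<Sum>a\<in>Z. \<Sum>q<m i. \<Sum>a'\<in>Z. of_bool (?b a q \<noteq> ?b a' q))"
    by (intro sum.cong refl sum.swap)
  also have "\<dots> = (\<Sum>q<m i. \<Sum>a\<in>Z. \<Sum>a'\<in>Z. of_bool (?b a q \<noteq> ?b a' q))"
    by (rule sum.swap)
  also have "\<dots> = 2 * (\<Sum>q<m i. ?P q * ?M q)"
    unfolding PM sum_distrib_left ..
  finally show ?thesis by simp
qed

text \<open>The base 4/3 of the growth is below 2, but (4/3)^3 > 2, so the factor 3 restores a full
  exponential per level. The summand 4 reproduces the factor and itself, since 3 (x + 4) \<le> 16 x
  for x \<ge> 1. Four doublings give 16 \<ge> 12 for the start.\<close>

lemma m_ge: "3 * (Tw j + 4) \<le> m (4 + j)"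
proof (induction j)
  case 0
  have "2 * m i \<le> m (Suc i)" for i using r_ge_2[of i] by (simp add: m_Suc mult.commute)
  from this[of 0] this[of 1] this[of 2] this[of 3] show ?case by (simp add: m_0 numeral_eq_Suc)
next
  case (Suc j)
  have "2 ^ (Tw j + 4) \<le> ((4 / 3) ^ 3) ^ (Tw j + 4 :: nat) * (1 :: real)"
    unfolding mult_1_right by (rule power_mono) (simp_all add: power_numeral_reduce)
  also have "\<dots> \<le> (4 / 3) ^ m (4 + j)"
    unfolding mult_1_right power_mult[symmetric] using Suc by (intro power_increasing) auto
  also have "\<dots> \<le> real (r (4 + j))" by (rule r_large)
  finally have "real (2 ^ (Tw j + 4)) \<le> real (r (4 + j))" by simp
  then have "2 ^ (Tw j + 4) \<le> r (4 + j)" by (simp only: of_nat_le_iff)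
  also have "\<dots> \<le> m (4 + Suc j)" using m_pos[of "4 + j"] m_Suc[of "4 + j"] by simp
  finally have "16 * 2 ^ Tw j \<le> m (4 + Suc j)" by (simp add: power_add)
  moreover have "3 * (x + 4) \<le> 16 * x" if "1 \<le> x" for x :: nat using that by simp
  ultimately show ?case unfolding Tw.simps by (meson le_trans one_le_numeral one_le_power)
qed

end

lemma exists_sign_tower: "\<exists>m r bit. sign_tower m r bit"
proof -
  define Q where "Q m r bit \<longleftrightarrow> (4 / 3) ^ m \<le> real r \<and> (\<forall>c q. bit c q \<in> {-1, 1 :: real}) \<and>
     (\<forall>q<m. (\<Sum>c<r. bit c q) = 0) \<and>
     (\<forall>c<r. \<forall>d<r. c \<noteq> d \<longrightarrow> m \<le> 8 * card {q. q < m \<and> bit c q \<noteq> bit d q})"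
    for m r :: nat and bit :: "nat \<Rightarrow> nat \<Rightarrow> real"
  have "\<exists>r bit. Q m r bit" if "1 \<le> m" for m
    unfolding Q_def by (rule exists_sign_code[OF that])
  then obtain R B where RB: "\<And>m. 1 \<le> m \<Longrightarrow> Q m (R m) (B m)" by metis
  define m where "m = rec_nat 1 (\<lambda>_ x. x * R x)"
  have m: "m 0 = 1" "m (Suc i) = m i * R (m i)" for i by (simp_all add: m_def)
  have R1: "1 \<le> R x" if "1 \<le> x" for x
  proof -
    have "0 < (4 / 3 :: real) ^ x" by simp
    then have "0 < real (R x)" using RB[OF that] unfolding Q_def by linarith
    then show ?thesis by simp
  qed
  have m1: "1 \<le> m i" for i
  proof (induction i)
    case (Suc i)
    then show ?case using mult_le_mono[OF Suc R1[OF Suc]] by (simp add: m)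
  qed (simp add: m)
  have "sign_tower m (\<lambda>i. R (m i)) (\<lambda>i. B (m i))"
    by unfold_locales (use RB[OF m1] m in \<open>auto simp: Q_def\<close>)
  then show ?thesis by blast
qed

section \<open>The bipartite graph that mixes all levels\<close>

lemma sum_card_mod:
  fixes S :: "nat set"
  assumes "finite S" "0 < n"
  shows "(\<Sum>q<n. real (card {b \<in> S. b mod n = q})) = real (card S)"
proof -
  have "(\<Sum>q<n. real (card {b \<in> S. b mod n = q})) = (\<Sum>q<n. \<Sum>b\<in>S. if b mod n = q then 1 else 0)"
    using assms(1) by (simp add: sum.If_cases Int_def)
  also have "\<dots> = (\<Sum>b\<in>S. \<Sum>q<n. if b mod n = q then 1 else 0)" by (rule sum.swap)
  also have "\<dots> = (\<Sum>b\<in>S. 1)" using assms(2) by (intro sum.cong) auto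
  finally show ?thesis by simp
qed

locale sign_graph = sign_tower +
  fixes s T :: nat
  assumes s_pos: "0 < s" and T_pos: "0 < T"
begin

text \<open>An index below \<open>N\<close> has a residue modulo \<open>m s\<close>, its finest
  cell, and a quotient below \<open>s * T\<close>, which addresses the Latin square. The factor
  \<open>T\<close> makes the graph as large as desired.\<close>

definition N :: nat where "N = m s * (s * T)"

text \<open>Every vertex sees each of the \<open>s\<close> levels equally often, so that only one level has to be
  used per pair.\<close>

definition f :: "nat \<Rightarrow> nat \<Rightarrow> real" where
  "f a b = g ((a div m s + b div m s) mod s) a b"

lemma N_pos: "0 < N"
  using m_pos[of s] s_pos T_pos by (simp add: N_def)

lemma f_commute: "f a b = f b a"
  by (simp add: f_def g_commute add.commute)

lemma f_range: "f a b \<in> {-1, 1}"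
  unfolding f_def by (rule g_range)

text \<open>For fixed \<open>a\<close> every level is chosen by exactly \<open>T\<close> quotients
  of \<open>b\<close>, and neither \<open>\<phi>\<close> nor the sign at a level depends on that
  quotient.\<close>

lemma sum_f:
  "(\<Sum>b<N. \<phi> (b mod m s) * f a b) = real T * (\<Sum>j<s. \<Sum>b<m s. \<phi> b * g j a b)"
proof -
  have g_shift: "g ((k + v) mod s) a (u + m s * v) = g ((k + v) mod s) a u" for k u v
    using s_pos by (intro g_cong[of _ s]) auto
  have "(\<Sum>b<N. \<phi> (b mod m s) * f a b)
      = (\<Sum>v<s * T. \<Sum>u<m s. \<phi> ((u + m s * v) mod m s) * f a (u + m s * v))"
    unfolding N_def by (rule sum_lessThan_mult)
  also have "\<dots> = (\<Sum>v<s * T. \<Sum>u<m s. \<phi> u * g ((a div m s + v) mod s) a u)"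
    using m_pos[of s] by (intro sum.cong refl) (simp add: f_def g_shift)
  also have "\<dots> = (\<Sum>t<T. \<Sum>v<s. \<Sum>u<m s. \<phi> u * g ((a div m s + (v + s * t)) mod s) a u)"
    by (rule sum_lessThan_mult)
  also have "\<dots> = (\<Sum>t<T. \<Sum>v<s. \<Sum>u<m s. \<phi> u * g ((a div m s + v) mod s) a u)"
    by (simp only: add.assoc[symmetric] mod_mult_self2)
  also have "\<dots> = real T * (\<Sum>v<s. \<Sum>u<m s. \<phi> u * g ((a div m s + v) mod s) a u)"
    by simp
  also have "(\<Sum>v<s. \<Sum>u<m s. \<phi> u * g ((a div m s + v) mod s) a u) = (\<Sum>j<s. \<Sum>u<m s. \<phi> u * g j a u)"
    by (rule sum_lessThan_shift_mod)
  finally show ?thesis .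
qed

text \<open>Of all levels only \<open>i\<close> survives: finer ones sum to zero over the half,
  coarser ones agree for \<open>a\<close> and \<open>a'\<close>. The factor 1/\<open>s\<close> is
  the share of the pairs that level \<open>i\<close> decides.\<close>

lemma sum_half_f_diff:
  assumes i: "i < s" and q: "q < m i" and a: "a mod m i = C" "a' mod m i = C"
  shows "(\<Sum>b\<in>{b. b < N \<and> half i q C b}. f a b) - (\<Sum>b\<in>{b. b < N \<and> half i q C b}. f a' b)
    = (bit i (label i a) q - bit i (label i a') q) * (real N / (2 * real s * real (m i)))"
proof -
  let ?S = "\<lambda>j a. \<Sum>b<m s. of_bool (half i q C b) * g j a b"
  have H: "(\<Sum>b\<in>{b. b < N \<and> half i q C b}. f x b) = real T * (\<Sum>j<s. ?S j x)" for x
  proof -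
    have "(\<Sum>b\<in>{b. b < N \<and> half i q C b}. f x b) = (\<Sum>b<N. of_bool (half i q C (b mod m s)) * f x b)"
    proof -
      have "half i q C (b mod m s) = half i q C b" for b
        using half_cong[of "b mod m s" s b i q C] i by simp
      moreover have "{b. b < N \<and> half i q C b} = {b \<in> {..<N}. half i q C b}" by auto
      ultimately show ?thesis by (simp only: sum.inter_filter finite_lessThan) (intro sum.cong, auto)
    qed
    also have "\<dots> = real T * (\<Sum>j<s. ?S j x)" by (rule sum_f)
    finally show ?thesis .
  qed
  have S: "?S j a - ?S j a' = (if j = i then (bit i (label i a) q - bit i (label i a') q) *
      (real (m s) / (2 * real (m i))) else 0)" if "j < s" for j
  proof -
    consider "j < i" | "j = i" | "i < j" by linarith
    then show ?thesis
    proof cases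
      case 1
      then show ?thesis using g_eq_below[OF 1, of a a'] a by simp
    next
      case 2
      then show ?thesis
        using sum_half_g_same[OF i q, of a] sum_half_g_same[OF i q, of a'] a
        by (simp add: left_diff_distrib diff_divide_distrib)
    next
      case 3
      then show ?thesis using sum_half_g_above[OF 3 that] by simp
    qed
  qed
  have "(\<Sum>b\<in>{b. b < N \<and> half i q C b}. f a b) - (\<Sum>b\<in>{b. b < N \<and> half i q C b}. f a' b)
     = real T * (\<Sum>j<s. ?S j a - ?S j a')"
    unfolding H sum_subtractf by (simp add: right_diff_distrib)
  also have "(\<Sum>j<s. ?S j a - ?S j a') = (\<Sum>j<s. if j = i then (bit i (label i a) q - bit i (label i a') q) *
      (real (m s) / (2 * real (m i))) else 0)"
    using S by (intro sum.cong) auto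
  also have "\<dots> = (bit i (label i a) q - bit i (label i a') q) * (real (m s) / (2 * real (m i)))"
    using i by simp
  finally show ?thesis using s_pos by (simp add: N_def)
qed

definition e :: "nat set \<Rightarrow> nat set \<Rightarrow> real" where
  "e Z W = (\<Sum>a\<in>Z. \<Sum>b\<in>W. of_bool (f a b = 1))"

lemma e_nonneg: "0 \<le> e Z W"
  unfolding e_def by (intro sum_nonneg) simp

lemma e_le: "e Z W \<le> real (card Z) * real (card W)"
proof -
  have "e Z W \<le> (\<Sum>a\<in>Z. \<Sum>b\<in>W. 1)"
    unfolding e_def by (intro sum_mono) simp
  then show ?thesis by simp
qed

text \<open>Any vertex of \<open>Zp\<close> has more neighbours in the half than any vertex of
  \<open>Zn\<close>, always by the same amount. Average degrees are compared after
  cross-multiplication, which also covers empty \<open>Zp\<close> or \<open>Zn\<close>.\<close>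

lemma e_half_diff:
  assumes i: "i < s" and q: "q < m i"
    and Zp: "\<And>a. a \<in> Zp \<Longrightarrow> a mod m i = C \<and> bit i (label i a) q = 1"
    and Zn: "\<And>a. a \<in> Zn \<Longrightarrow> a mod m i = C \<and> bit i (label i a) q = -1"
  shows "real (card Zn) * e Zp {b. b < N \<and> half i q C b} - real (card Zp) * e Zn {b. b < N \<and> half i q C b}
     = real (card Zp) * real (card Zn) * (real N / (2 * real s * real (m i)))"
proof -
  let ?H = "{b. b < N \<and> half i q C b}" and ?K = "real N / (2 * real s * real (m i))"
  define d where "d a = (\<Sum>b\<in>?H. of_bool (f a b = 1) :: real)" for a
  have d: "d a = (real (card ?H) + (\<Sum>b\<in>?H. f a b)) / 2" for a
  proof -
    have "d a = (\<Sum>b\<in>?H. (1 + f a b) / 2)"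
      unfolding d_def
    proof (intro sum.cong refl)
      show "of_bool (f a b = 1) = (1 + f a b) / 2" for b
        using f_range[of a b] by auto
    qed
    then show ?thesis by (simp add: sum_divide_distrib[symmetric] sum.distrib)
  qed
  have diff: "d a - d a' = ?K" if "a \<in> Zp" "a' \<in> Zn" for a a'
    using sum_half_f_diff[OF i q, of a C a'] Zp[OF that(1)] Zn[OF that(2)] unfolding d
    by (simp add: field_simps)
  have "real (card Zn) * e Zp ?H - real (card Zp) * e Zn ?H = (\<Sum>a\<in>Zp. \<Sum>a'\<in>Zn. d a - d a')"
    unfolding e_def d_def[symmetric] sum_subtractf by (simp add: sum_distrib_left)
  also have "\<dots> = (\<Sum>a\<in>Zp. \<Sum>a'\<in>Zn. ?K)" using diff by (intro sum.cong refl) auto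
  finally show ?thesis by simp
qed

end

text \<open>In the application \<open>A X\<close> and \<open>B X\<close> index the vertices of the part \<open>X\<close> on the two sides, \<open>w X\<close>
  is the size of \<open>X\<close>, and \<open>R\<close> is regularity.\<close>

locale regular_cover = sign_graph m r bit s T
  for m r :: "nat \<Rightarrow> nat" and bit :: "nat \<Rightarrow> nat \<Rightarrow> nat \<Rightarrow> real" and s T :: nat +
  fixes P :: "'p set" and w :: "'p \<Rightarrow> real" and A B :: "'p \<Rightarrow> nat set"
    and R :: "'p \<Rightarrow> 'p \<Rightarrow> bool" and \<epsilon> :: real
  assumes finite_P: "finite P"
    and eps_nonneg: "0 \<le> \<epsilon>" and eps_le: "\<epsilon> \<le> 1 / (2 ^ 18 * real s ^ 3)"
    and cover_A: "\<Union>(A ` P) = {..<N}" and cover_B: "\<Union>(B ` P) = {..<N}"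
    and disj_A: "disjoint_family_on A P" and disj_B: "disjoint_family_on B P"
    and card_A: "X \<in> P \<Longrightarrow> real (card (A X)) \<le> w X" and card_B: "X \<in> P \<Longrightarrow> real (card (B X)) \<le> w X"
    and sum_w: "(\<Sum>X\<in>P. w X) = 2 * real N"
    and irregular: "(\<Sum>X\<in>P. \<Sum>Y\<in>P. of_bool (\<not> R X Y) * (w X * w Y)) \<le> \<epsilon> * (2 * real N)\<^sup>2"
    and regular_AB: "X \<in> P \<Longrightarrow> Y \<in> P \<Longrightarrow> R X Y \<Longrightarrow> Z1 \<subseteq> A X \<Longrightarrow> Z2 \<subseteq> A X \<Longrightarrow> W \<subseteq> B Y \<Longrightarrow>
      \<bar>real (card Z2) * e Z1 W - real (card Z1) * e Z2 W\<bar> \<le> \<epsilon> * (real (card Z1) + real (card Z2)) * (w X * w Y)"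
    and regular_BA: "X \<in> P \<Longrightarrow> Y \<in> P \<Longrightarrow> R X Y \<Longrightarrow> Z1 \<subseteq> B X \<Longrightarrow> Z2 \<subseteq> B X \<Longrightarrow> W \<subseteq> A Y \<Longrightarrow>
      \<bar>real (card Z2) * e Z1 W - real (card Z1) * e Z2 W\<bar> \<le> \<epsilon> * (real (card Z1) + real (card Z2)) * (w X * w Y)"
begin

section \<open>Parts that leave the cells, level by level\<close>

lemma swap: "regular_cover m r bit s T P w B A R \<epsilon>"
  by unfold_locales
    (fact finite_P eps_nonneg eps_le cover_A cover_B disj_A disj_B card_A card_B sum_w irregular
      regular_AB regular_BA)+

text \<open>The tolerance granted per level. Even \<open>s\<close> of them add up to 1 / (512
  \<open>s\<close>), well below the share 1/\<open>s\<close> of pairs decided by a single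
  level.\<close>

definition \<beta> :: real where "\<beta> = 1 / (512 * (real s)\<^sup>2)"

text \<open>The part is not essentially inside one cell of level \<open>i\<close> on the side
  \<open>D\<close>. The tolerance grows with \<open>i\<close>, so that a part turning bad at the
  next level has more than \<open>\<beta> * w X\<close> vertices leaving the best child. It is
  relative to the whole part, so parts with hardly any vertices on this side are good.\<close>

definition bad :: "('p \<Rightarrow> nat set) \<Rightarrow> nat \<Rightarrow> 'p \<Rightarrow> bool" where
  "bad D i X \<longleftrightarrow> (\<forall>C<m i. real i * \<beta> * w X < real (card {a \<in> D X. a mod m i \<noteq> C}))"

definition bad_weight :: "('p \<Rightarrow> nat set) \<Rightarrow> nat \<Rightarrow> real" where
  "bad_weight D i = (\<Sum>X\<in>P. of_bool (bad D i X) * w X)"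

lemma beta_pos: "0 < \<beta>"
  using s_pos by (simp add: \<beta>_def)

lemma w_nonneg: "X \<in> P \<Longrightarrow> 0 \<le> w X"
  using card_A[of X] by linarith

lemma finite_A: "X \<in> P \<Longrightarrow> finite (A X)"
  using cover_A by (metis SUP_upper finite_lessThan finite_subset)

lemma finite_B: "X \<in> P \<Longrightarrow> finite (B X)"
  using cover_B by (metis SUP_upper finite_lessThan finite_subset)

lemma e_split:
  assumes "W \<subseteq> {..<N}"
  shows "(\<Sum>Y\<in>P. e Z (W \<inter> B Y)) = e Z W"
proof -
  have "W = (\<Union>Y\<in>P. W \<inter> B Y)" using cover_B assms by auto
  moreover have "(\<Sum>b\<in>(\<Union>Y\<in>P. W \<inter> B Y). of_bool (f a b = 1) :: real) = (\<Sum>Y\<in>P. \<Sum>b\<in>W \<inter> B Y. of_bool (f a b = 1))" for a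
    using finite_P finite_B disj_B
    by (intro sum.UNION_disjoint) (auto simp: disjoint_family_on_def)
  ultimately show ?thesis unfolding e_def by (subst sum.swap) simp
qed

text \<open>\<open>X\<close> sits in a cell \<open>C\<close> but is spread over its children. For
  each opposite cell \<open>q\<close>, the two sign classes of \<open>X\<close> in \<open>C\<close>
  are compared on the half of \<open>q\<close>; summed over \<open>q\<close> and all parts
  \<open>Y\<close>, the differences are large by \<open>e_half_diff\<close> and the distance of the
  code. A part \<open>Y\<close> that is good and regular with \<open>X\<close> contributes little,
  and few parts are bad, so the irregular ones must carry much weight.\<close>

lemma new_bad_irregular:
  assumes i: "i < s" and X: "X \<in> P" and good: "\<not> bad A i X" and new: "bad A (Suc i) X"
    and prev: "bad_weight B i \<le> real N / (256 * real s)"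
  shows "real N / (64 * real s) \<le> (\<Sum>Y\<in>P. of_bool (\<not> R X Y) * w Y)"
proof -
  obtain C where C: "C < m i" and C_le: "real (card {a \<in> A X. a mod m i \<noteq> C}) \<le> real i * \<beta> * w X"
    using good by (auto simp: bad_def not_less)
  define Z where "Z = {a \<in> A X. a mod m i = C}"
  have finZ: "finite Z" using finite_A[OF X] by (simp add: Z_def)
  define t where "t c = card {a \<in> Z. label i a \<noteq> c}" for c
  \<comment> \<open>The most populated child; \<open>\<theta>\<close> counts the vertices of
    \<open>Z\<close> outside it.\<close>
  obtain c0 where c0: "c0 < r i" and t_min: "\<And>c. c < r i \<Longrightarrow> t c0 \<le> t c"
    using ex_has_least_nat[of "\<lambda>c. c < r i" 0 t] r_pos[of i] by auto
  define \<theta> where "\<theta> = t c0"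
  \<comment> \<open>Level \<open>i + 1\<close> tolerates one more \<open>\<beta> * w X\<close> than
    level \<open>i\<close>; what lies outside the child but not outside \<open>C\<close> must exceed
    this surplus.\<close>
  have \<theta>_large: "\<beta> * w X < real \<theta>"
  proof -
    let ?C = "m i * c0 + C"
    have "?C < m i * Suc c0" using C by simp
    also have "\<dots> \<le> m (Suc i)" unfolding m_Suc using c0 by (intro mult_le_mono) auto
    finally have "real (Suc i) * \<beta> * w X < real (card {a \<in> A X. a mod m (Suc i) \<noteq> ?C})"
      using new by (simp add: bad_def)
    also have "card {a \<in> A X. a mod m (Suc i) \<noteq> ?C} \<le> card ({a \<in> A X. a mod m i \<noteq> C} \<union> {a \<in> Z. label i a \<noteq> c0})"
      using finite_A[OF X] finZ by (intro card_mono) (auto simp: mod_m_Suc Z_def)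
    also have "\<dots> \<le> card {a \<in> A X. a mod m i \<noteq> C} + \<theta>"
      unfolding \<theta>_def t_def by (rule card_Un_le)
    finally show ?thesis using C_le by (simp add: algebra_simps)
  qed
  have \<theta>_pos: "0 < \<theta>"
  proof -
    have "0 \<le> \<beta> * w X" using w_nonneg[OF X] beta_pos by simp
    then show ?thesis using \<theta>_large by linarith
  qed
  have \<theta>_le: "\<theta> \<le> card Z" unfolding \<theta>_def t_def using finZ by (intro card_mono) auto
  then have Z_pos: "0 < card Z" using \<theta>_pos by linarith
  define Zp where "Zp q = {a \<in> Z. bit i (label i a) q = 1}" for q
  define Zn where "Zn q = {a \<in> Z. bit i (label i a) q = -1}" for q
  define H where "H q = {b. b < N \<and> half i q C b}" for q
  define \<tau> where "\<tau> q Y = real (card (Zn q)) * e (Zp q) (H q \<inter> B Y) - real (card (Zp q)) * e (Zn q) (H q \<inter> B Y)" for q Y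
  let ?K = "real N / (2 * real s * real (m i))"
  have split_le: "real (card (Zp q)) * real (card (Zn q)) \<le> real (card Z) * real \<theta>" for q
    using split_product_le[OF finZ, of i q c0] by (simp add: Zp_def Zn_def \<theta>_def t_def)
  have main: "(\<Sum>Y\<in>P. \<tau> q Y) = real (card (Zp q)) * real (card (Zn q)) * ?K" if q: "q < m i" for q
  proof -
    have "H q \<subseteq> {..<N}" by (auto simp: H_def)
    then have "(\<Sum>Y\<in>P. \<tau> q Y) = real (card (Zn q)) * e (Zp q) (H q) - real (card (Zp q)) * e (Zn q) (H q)"
      by (simp add: \<tau>_def sum_subtractf sum_distrib_left[symmetric] e_split)
    also have "\<dots> = real (card (Zp q)) * real (card (Zn q)) * ?K"
      unfolding H_def by (rule e_half_diff[OF i q]) (auto simp: Zp_def Zn_def Z_def)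
    finally show ?thesis .
  qed
  have \<tau>_le1: "\<tau> q Y \<le> real (card Z) * real \<theta> * real (card {b \<in> B Y. b mod m i = q})" if Y: "Y \<in> P" for q Y
  proof -
    have "\<tau> q Y \<le> real (card (Zn q)) * e (Zp q) (H q \<inter> B Y)"
      unfolding \<tau>_def using e_nonneg by simp
    also have "\<dots> \<le> real (card (Zn q)) * (real (card (Zp q)) * real (card (H q \<inter> B Y)))"
      using e_le by (intro mult_left_mono) auto
    also have "\<dots> = real (card (Zp q)) * real (card (Zn q)) * real (card (H q \<inter> B Y))" by simp
    also have "\<dots> \<le> real (card Z) * real \<theta> * real (card {b \<in> B Y. b mod m i = q})"
    proof -
      have "card (H q \<inter> B Y) \<le> card {b \<in> B Y. b mod m i = q}"
        using finite_B[OF Y] by (intro card_mono) (auto simp: H_def half_def)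
      then show ?thesis by (intro mult_mono[OF split_le]) auto
    qed
    finally show ?thesis .
  qed
  have \<tau>_le2: "\<tau> q Y \<le> \<epsilon> * real (card Z) * (w X * w Y)" if Y: "Y \<in> P" "R X Y" for q Y
  proof -
    have "\<tau> q Y \<le> \<bar>\<tau> q Y\<bar>" by simp
    also have "\<dots> \<le> \<epsilon> * (real (card (Zp q)) + real (card (Zn q))) * (w X * w Y)"
      unfolding \<tau>_def by (rule regular_AB[OF X Y]) (auto simp: Zp_def Zn_def Z_def)
    also have "\<dots> \<le> \<epsilon> * real (card Z) * (w X * w Y)"
    proof -
      have "card (Zp q) + card (Zn q) = card (Zp q \<union> Zn q)"
        using finZ by (intro card_Un_disjoint[symmetric]) (auto simp: Zp_def Zn_def)
      also have "\<dots> \<le> card Z" using finZ by (intro card_mono) (auto simp: Zp_def Zn_def)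
      finally have "real (card (Zp q)) + real (card (Zn q)) \<le> real (card Z)" by linarith
      then show ?thesis
        using eps_nonneg w_nonneg[OF X] w_nonneg[OF Y(1)]
        by (intro mult_right_mono mult_left_mono) auto
    qed
    finally show ?thesis .
  qed
  define u where "u Y = (of_bool (\<not> R X Y) + of_bool (bad B i Y) :: real)" for Y
  have \<tau>_sum_le: "(\<Sum>q<m i. \<tau> q Y) \<le> real (card Z) * real \<theta> * (u Y * w Y)
      + \<epsilon> * real (card Z) * (w X * w Y) + real (card Z) * real \<theta> * (real i * \<beta> * w Y)"
    if Y: "Y \<in> P" for Y
  proof -
    note wY = w_nonneg[OF Y] and wX = w_nonneg[OF X]
    have nn: "0 \<le> \<epsilon> * real (card Z) * (w X * w Y)" "0 \<le> real (card Z) * real \<theta> * (real i * \<beta> * w Y)"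
      "0 \<le> real (card Z) * real \<theta> * (u Y * w Y)"
      using eps_nonneg wX wY beta_pos by (auto simp: u_def)
    show ?thesis
    proof (cases "R X Y \<and> \<not> bad B i Y")
      case False
      \<comment> \<open>The trivial bound suffices: the residue classes partition
        \<open>B Y\<close>, so summing over \<open>q\<close> costs no factor
        \<open>m i\<close>.\<close>
      have "(\<Sum>q<m i. \<tau> q Y) \<le> (\<Sum>q<m i. real (card Z) * real \<theta> * real (card {b \<in> B Y. b mod m i = q}))"
        using \<tau>_le1[OF Y] by (intro sum_mono) auto
      also have "\<dots> = real (card Z) * real \<theta> * real (card (B Y))"
        using sum_card_mod[OF finite_B[OF Y] m_pos[of i]] by (simp only: sum_distrib_left[symmetric])
      also have "\<dots> \<le> real (card Z) * real \<theta> * (u Y * w Y)"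
      proof -
        have "real (card (B Y)) \<le> 1 * w Y" using card_B[OF Y] by simp
        also have "\<dots> \<le> u Y * w Y" using False wY by (intro mult_right_mono) (auto simp: u_def)
        finally show ?thesis by (intro mult_left_mono) auto
      qed
      finally show ?thesis using nn by linarith
    next
      case True
      then obtain q0 where q0: "q0 < m i" "real (card {b \<in> B Y. b mod m i \<noteq> q0}) \<le> real i * \<beta> * w Y"
        by (auto simp: bad_def not_less)
      have "(\<Sum>q<m i. \<tau> q Y) = \<tau> q0 Y + (\<Sum>q\<in>{..<m i} - {q0}. \<tau> q Y)"
        using q0 by (intro sum.remove) auto
      \<comment> \<open>Regularity is spent only on the cell holding most of \<open>B Y\<close>.
        Using it for every \<open>q\<close> would multiply the error by \<open>m i\<close>, which is
        of tower size; the other cells together contain only the tolerated remainder.\<close>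
      also have "\<tau> q0 Y \<le> \<epsilon> * real (card Z) * (w X * w Y)" using \<tau>_le2 Y True by blast
      also have "(\<Sum>q\<in>{..<m i} - {q0}. \<tau> q Y) \<le>
          (\<Sum>q\<in>{..<m i} - {q0}. real (card Z) * real \<theta> * real (card {b \<in> B Y. b mod m i = q}))"
        using \<tau>_le1[OF Y] by (intro sum_mono) auto
      also have "\<dots> = real (card Z) * real \<theta> * (\<Sum>q\<in>{..<m i} - {q0}. real (card {b \<in> B Y. b mod m i = q}))"
        by (simp only: sum_distrib_left[symmetric])
      also have "(\<Sum>q\<in>{..<m i} - {q0}. real (card {b \<in> B Y. b mod m i = q}))
          = real (card (B Y)) - real (card {b \<in> B Y. b mod m i = q0})"
        using sum_card_mod[OF finite_B[OF Y] m_pos[of i]] q0(1)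
        by (subst sum_diff1) auto
      also have "\<dots> = real (card {b \<in> B Y. b mod m i \<noteq> q0})"
      proof -
        have "card (B Y) = card ({b \<in> B Y. b mod m i = q0} \<union> {b \<in> B Y. b mod m i \<noteq> q0})"
          by (rule arg_cong[where f = card]) auto
        also have "\<dots> = card {b \<in> B Y. b mod m i = q0} + card {b \<in> B Y. b mod m i \<noteq> q0}"
          using finite_B[OF Y] by (intro card_Un_disjoint) auto
        finally show ?thesis by simp
      qed
      also have "real (card Z) * real \<theta> * real (card {b \<in> B Y. b mod m i \<noteq> q0})
          \<le> real (card Z) * real \<theta> * (real i * \<beta> * w Y)"
        using q0(2) by (intro mult_left_mono) auto
      finally show ?thesis using nn by linarith
    qed
  qed
  define irr where "irr = (\<Sum>Y\<in>P. of_bool (\<not> R X Y) * w Y)"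
  have sum_u: "(\<Sum>Y\<in>P. u Y * w Y) = irr + bad_weight B i"
    by (simp add: u_def irr_def bad_weight_def distrib_right sum.distrib)
  have "real (card Z) * real \<theta> * real (m i) / 16 * ?K \<le> (\<Sum>q<m i. real (card (Zp q)) * real (card (Zn q))) * ?K"
    using sum_split_products_ge[OF finZ, of i \<theta>] t_min
    by (intro mult_right_mono) (auto simp: Zp_def Zn_def \<theta>_def t_def)
  also have "\<dots> = (\<Sum>q<m i. \<Sum>Y\<in>P. \<tau> q Y)"
    unfolding sum_distrib_right using main by (intro sum.cong) auto
  also have "\<dots> = (\<Sum>Y\<in>P. \<Sum>q<m i. \<tau> q Y)" by (rule sum.swap)
  also have "\<dots> \<le> (\<Sum>Y\<in>P. real (card Z) * real \<theta> * (u Y * w Y)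
      + \<epsilon> * real (card Z) * (w X * w Y) + real (card Z) * real \<theta> * (real i * \<beta> * w Y))"
    using \<tau>_sum_le by (intro sum_mono)
  also have "\<dots> = real (card Z) * real \<theta> * (\<Sum>Y\<in>P. u Y * w Y)
      + \<epsilon> * real (card Z) * (w X * (\<Sum>Y\<in>P. w Y)) + real (card Z) * real \<theta> * (real i * \<beta> * (\<Sum>Y\<in>P. w Y))"
    unfolding sum.distrib sum_distrib_left[symmetric] ..
  also have "\<dots> = real (card Z) * (real \<theta> * (irr + bad_weight B i)
      + \<epsilon> * w X * (2 * real N) + real \<theta> * (real i * \<beta> * (2 * real N)))"
    unfolding sum_u sum_w by (simp only: algebra_simps)
  \<comment> \<open>The 1/16 from the code meets the 1/2 in \<open>?K\<close>; the number
    \<open>m i\<close> of opposite cells cancels.\<close>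
  finally have "real (card Z) * (real \<theta> * (real N / (32 * real s))) \<le> \<dots>"
    using m_pos[of i] s_pos by (simp add: field_simps)
  then have 1: "real \<theta> * (real N / (32 * real s)) \<le> real \<theta> * (irr + bad_weight B i)
      + \<epsilon> * w X * (2 * real N) + real \<theta> * (real i * \<beta> * (2 * real N))"
    using Z_pos by (simp only: mult_le_cancel_left_pos of_nat_0_less_iff)
  \<comment> \<open>Here the cube arises: \<open>w X\<close> is below \<open>\<theta>\<close> /
    \<open>\<beta>\<close>, which costs 512 \<open>s\<close>^2, and the outcome must still be 1 /
    (512 \<open>s\<close>).\<close>
  have 2: "\<epsilon> * w X * (2 * real N) \<le> real \<theta> * (real N / (256 * real s))"
  proof -
    have "\<epsilon> * w X \<le> 1 / (2 ^ 18 * real s ^ 3) * (real \<theta> / \<beta>)"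
      using eps_nonneg eps_le w_nonneg[OF X] \<theta>_large beta_pos
      by (intro mult_mono) (auto simp: pos_le_divide_eq mult.commute)
    also have "\<dots> = real \<theta> / (512 * real s)"
      using s_pos by (simp add: \<beta>_def power2_eq_square power3_eq_cube)
    finally have "\<epsilon> * w X * (2 * real N) \<le> real \<theta> / (512 * real s) * (2 * real N)"
      by (intro mult_right_mono) auto
    then show ?thesis by simp
  qed
  have 3: "real \<theta> * (real i * \<beta> * (2 * real N)) \<le> real \<theta> * (real N / (256 * real s))"
  proof (intro mult_left_mono)
    have "real i * \<beta> * (2 * real N) \<le> real s * \<beta> * (2 * real N)"
      using i beta_pos by (intro mult_right_mono) auto
    also have "\<dots> = real N / (256 * real s)"
      using s_pos by (simp add: \<beta>_def power2_eq_square)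
    finally show "real i * \<beta> * (2 * real N) \<le> real N / (256 * real s)" .
  qed simp
  have "real \<theta> * (real N / (32 * real s)) \<le>
      real \<theta> * (irr + bad_weight B i + real N / (256 * real s) + real N / (256 * real s))"
    using 1 2 3 unfolding distrib_left by linarith
  then have "real N / (32 * real s) \<le> irr + bad_weight B i + real N / (256 * real s) + real N / (256 * real s)"
    using \<theta>_pos by (simp only: mult_le_cancel_left_pos of_nat_0_less_iff)
  \<comment> \<open>In units of \<open>N\<close> / (256 \<open>s\<close>): the signal is 8, the
    already bad parts and the two errors cost 1 each, and 4 are claimed.\<close>
  moreover have "real N / (32 * real s) = real N / (64 * real s) + real N / (256 * real s)
      + real N / (256 * real s) + real N / (256 * real s) + real N / (256 * real s)"
    using s_pos by (simp add: field_simps)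
  moreover have "0 \<le> real N / (256 * real s)" by simp
  ultimately show ?thesis using prev unfolding irr_def by linarith
qed

text \<open>Each newly bad part lies in irregular pairs with parts of weight \<open>N\<close> / (64
  \<open>s\<close>), while all irregular pairs weigh at most 4 \<epsilon> \<open>N\<close>^2; the
  quotient bounds the new weight.\<close>

lemma bad_weight_Suc:
  assumes i: "i < s" and prev: "bad_weight B i \<le> real N / (256 * real s)"
  shows "bad_weight A (Suc i) \<le> bad_weight A i + 256 * \<epsilon> * real s * real N"
proof -
  define new where "new X \<longleftrightarrow> \<not> bad A i X \<and> bad A (Suc i) X" for X
  have "bad_weight A (Suc i) \<le> (\<Sum>X\<in>P. of_bool (bad A i X) * w X + of_bool (new X) * w X)"
    unfolding bad_weight_def using w_nonneg by (intro sum_mono) (auto simp: new_def)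
  then have 1: "bad_weight A (Suc i) \<le> bad_weight A i + (\<Sum>X\<in>P. of_bool (new X) * w X)"
    unfolding sum.distrib bad_weight_def .
  have "(\<Sum>X\<in>P. of_bool (new X) * w X) * (real N / (64 * real s))
      = (\<Sum>X\<in>P. w X * (of_bool (new X) * (real N / (64 * real s))))"
    unfolding sum_distrib_right by (intro sum.cong refl) (simp only: mult_ac)
  also have "\<dots> \<le> (\<Sum>X\<in>P. w X * (\<Sum>Y\<in>P. of_bool (\<not> R X Y) * w Y))"
  proof (intro sum_mono mult_left_mono w_nonneg)
    fix X assume X: "X \<in> P"
    show "of_bool (new X) * (real N / (64 * real s)) \<le> (\<Sum>Y\<in>P. of_bool (\<not> R X Y) * w Y)"
    proof (cases "new X")
      case True
      then show ?thesis using new_bad_irregular[OF i X _ _ prev] by (simp add: new_def)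
    next
      case False
      then show ?thesis using w_nonneg by (auto intro!: sum_nonneg)
    qed
  qed
  also have "\<dots> = (\<Sum>X\<in>P. \<Sum>Y\<in>P. of_bool (\<not> R X Y) * (w X * w Y))"
    unfolding sum_distrib_left by (intro sum.cong refl) (simp only: mult_ac)
  also have "\<dots> \<le> \<epsilon> * (2 * real N)\<^sup>2" by (rule irregular)
  also have "\<dots> = (256 * \<epsilon> * real s * real N) * (real N / (64 * real s))"
    using s_pos by (simp add: power2_eq_square)
  finally have "(\<Sum>X\<in>P. of_bool (new X) * w X) \<le> 256 * \<epsilon> * real s * real N"
    using N_pos s_pos by (elim mult_right_le_imp_le) simp
  then show ?thesis using 1 by linarith
qed

lemma bad_weight_0: "bad_weight A 0 = 0"
  unfolding bad_weight_def by (intro sum.neutral) (auto simp: bad_def m_0)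

text \<open>The losses of all levels together stay below the \<open>N\<close> / (256
  \<open>s\<close>) that \<open>new_bad_irregular\<close> allows for the other side, so the
  induction never stalls.\<close>

lemma level_weight_le:
  assumes "i \<le> s"
  shows "real i * (256 * \<epsilon> * real s * real N) \<le> real N / (1024 * real s)"
proof -
  have "real i * (256 * \<epsilon> * real s * real N) \<le> real s * (256 * (1 / (2 ^ 18 * real s ^ 3)) * real s * real N)"
    using assms eps_le eps_nonneg by (intro mult_mono) auto
  also have "\<dots> = real N / (1024 * real s)"
    using s_pos by (simp add: power3_eq_cube)
  finally show ?thesis .
qed

end

context regular_cover
begin

text \<open>\<open>bad\<close> and \<open>bad_weight\<close> take the side as an argument and do not
  depend on \<open>A\<close> and \<open>B\<close>, so the swapped copy speaks of the same
  constants.\<close>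

interpretation sw: regular_cover m r bit s T P w B A R \<epsilon>
  by (rule swap)

text \<open>Both sides are handled in one induction, because the step for one side needs the bound
  for the other.\<close>

lemma bad_weight_le:
  assumes "i \<le> s"
  shows "bad_weight A i \<le> real i * (256 * \<epsilon> * real s * real N) \<and>
    bad_weight B i \<le> real i * (256 * \<epsilon> * real s * real N)"
  using assms
proof (induction i)
  case 0
  then show ?case using bad_weight_0 sw.bad_weight_0 by simp
next
  case (Suc i)
  then have i: "i < s" by simp
  have IH: "bad_weight A i \<le> real i * (256 * \<epsilon> * real s * real N)"
    "bad_weight B i \<le> real i * (256 * \<epsilon> * real s * real N)" using Suc by auto
  have "real N / (1024 * real s) \<le> real N / (256 * real s)"
    using s_pos by (intro divide_left_mono) auto
  then have "bad_weight A i \<le> real N / (256 * real s)" "bad_weight B i \<le> real N / (256 * real s)"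
    using IH level_weight_le[of i] i by linarith+
  then show ?case
    using bad_weight_Suc[OF i] sw.bad_weight_Suc[OF i] IH by (simp add: distrib_right)
qed

text \<open>A finest cell has only \<open>N\<close> / \<open>m s\<close> indices, and a good part
  contains little else on side \<open>A\<close>. Bad parts and tolerated remainders cover at most
  half of the side, so many good parts are needed for the rest.\<close>

lemma card_P_ge: "real (m s) / 2 \<le> real (card P)"
proof -
  have part: "real (card (A X)) \<le> of_bool (bad A s X) * w X + real N / real (m s) + real s * \<beta> * w X"
    if X: "X \<in> P" for X
  proof (cases "bad A s X")
    case True
    have "0 \<le> real N / real (m s) + real s * \<beta> * w X" using w_nonneg[OF X] beta_pos by simp
    then show ?thesis using True card_A[OF X] by simp
  next
    case False
    then obtain C where C: "C < m s" "real (card {a \<in> A X. a mod m s \<noteq> C}) \<le> real s * \<beta> * w X"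
      by (auto simp: bad_def not_less)
    have "A X \<subseteq> {..<N}" using cover_A X by blast
    then have sub: "A X \<subseteq> (\<lambda>v. C + m s * v) ` {..<s * T} \<union> {a \<in> A X. a mod m s \<noteq> C}"
    proof (intro subsetI UnCI)
      fix a assume a: "a \<in> A X" "a \<notin> {a \<in> A X. a mod m s \<noteq> C}"
      then have "a = C + m s * (a div m s)" by auto
      moreover have "a div m s < s * T"
        using \<open>A X \<subseteq> {..<N}\<close> a(1) m_pos[of s] by (auto simp: N_def less_mult_imp_div_less mult.commute)
      ultimately show "a \<in> (\<lambda>v. C + m s * v) ` {..<s * T}" by blast
    qed
    have "card (A X) \<le> card ((\<lambda>v. C + m s * v) ` {..<s * T} \<union> {a \<in> A X. a mod m s \<noteq> C})"
      using finite_A[OF X] by (intro card_mono[OF _ sub]) auto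
    also have "\<dots> \<le> s * T + card {a \<in> A X. a mod m s \<noteq> C}"
      by (rule order_trans[OF card_Un_le]) (use card_image_le[of "{..<s * T}" "\<lambda>v. C + m s * v"] in auto)
    finally have "real (card (A X)) \<le> real (s * T) + real s * \<beta> * w X" using C(2) by linarith
    then show ?thesis using False m_pos[of s] by (simp add: N_def)
  qed
  have "N = card (\<Union>X\<in>P. A X)" using cover_A by simp
  also have "\<dots> = (\<Sum>X\<in>P. card (A X))"
    using finite_P finite_A disj_A by (intro card_UN_disjoint) (auto simp: disjoint_family_on_def)
  finally have "real N = (\<Sum>X\<in>P. real (card (A X)))" by simp
  also have "\<dots> \<le> (\<Sum>X\<in>P. of_bool (bad A s X) * w X + real N / real (m s) + real s * \<beta> * w X)"
    using part by (rule sum_mono)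
  also have "\<dots> = bad_weight A s + real (card P) * (real N / real (m s)) + real s * \<beta> * (2 * real N)"
    by (simp only: sum.distrib bad_weight_def sum_constant sum_distrib_left[symmetric] sum_w)
  also have "\<dots> \<le> real N / 4 + real (card P) * (real N / real (m s)) + real N / 4"
  proof -
    have "bad_weight A s \<le> real N / (1024 * real s)"
      using bad_weight_le[of s] level_weight_le[of s] by linarith
    also have "\<dots> \<le> real N / 4" using s_pos by (intro divide_left_mono) auto
    finally have 1: "bad_weight A s \<le> real N / 4" .
    have "real s * \<beta> * (2 * real N) = real N / (256 * real s)"
      using s_pos by (simp add: \<beta>_def power2_eq_square)
    also have "\<dots> \<le> real N / 4" using s_pos by (intro divide_left_mono) auto
    finally show ?thesis using 1 by linarith
  qed
  finally have "real N * (1 / 2) \<le> real (card P) * (real N / real (m s))" by linarith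
  then have "real N * (1 / 2) \<le> real N * (real (card P) / real (m s))" by (simp add: mult.commute)
  then have "1 / 2 \<le> real (card P) / real (m s)"
    using N_pos by (simp only: mult_le_cancel_left_pos of_nat_0_less_iff)
  then show ?thesis using m_pos[of s] by (simp add: field_simps)
qed

end

section \<open>Planting the pattern in a hereditary class\<close>

lemma exists_bipartite_pattern:
  fixes n :: nat
  assumes her: "hereditary \<H>" and vc: "\<And>k. \<exists>G\<in>\<H>. has_vc G k"
  shows "\<exists>G\<in>\<H>. \<exists>\<alpha> \<beta>. inj_on \<alpha> {..<n} \<and> inj_on \<beta> {..<n} \<and> \<alpha> ` {..<n} \<inter> \<beta> ` {..<n} = {} \<and>
    verts G = \<alpha> ` {..<n} \<union> \<beta> ` {..<n} \<and> (\<forall>i<n. \<forall>j<n. {\<alpha> i, \<beta> j} \<in> edges G \<longleftrightarrow> F i j)"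
proof -
  \<comment> \<open>The first \<open>n\<close> indices carry the first side; each of the
    \<open>n\<close> vertices of the second side gets \<open>n + 1\<close> further indices as
    private tags, one per candidate.\<close>
  define k where "k = n + n * (n + 1)"
  obtain G where G: "G \<in> \<H>" "has_vc G k" using vc by blast
  then obtain a b where a: "\<forall>i\<in>{1..k}. a i \<in> verts G" and b: "\<forall>S\<in>Pow {1..k}. b S \<in> verts G"
    and ab: "\<forall>i\<in>{1..k}. \<forall>S\<in>Pow {1..k}. {a i, b S} \<in> edges G \<longleftrightarrow> i \<in> S"
    unfolding has_vc_def by blast
  have b_inj: "S = T" if "S \<subseteq> {1..k}" "T \<subseteq> {1..k}" "b S = b T" for S T
  proof -
    have "i \<in> S \<longleftrightarrow> i \<in> T" if "i \<in> {1..k}" for i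
      using ab that \<open>S \<subseteq> {1..k}\<close> \<open>T \<subseteq> {1..k}\<close> \<open>b S = b T\<close> by (metis PowI)
    then show ?thesis using that by blast
  qed
  have a_inj: "i = j" if "i \<in> {1..k}" "j \<in> {1..k}" "a i = a j" for i j
  proof -
    have "{i} \<in> Pow {1..k}" using that by simp
    then show ?thesis using ab that by (metis singletonD singletonI)
  qed
  \<comment> \<open>The last element makes room for choosing the vertices on the second side outside the first
      one.\<close>
  define S where "S j e = insert (Suc (n + j * (n + 1) + e)) (Suc ` {i. i < n \<and> F i j})" for j e
  have S_sub: "S j e \<subseteq> {1..k}" if "j < n" "e \<le> n" for j e
  proof -
    have "Suc j * (n + 1) \<le> n * (n + 1)" using that by (intro mult_le_mono) auto
    then have "Suc (n + j * (n + 1) + e) \<le> k" using that by (simp add: k_def)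
    then show ?thesis by (auto simp: S_def)
  qed
  have S_ext: "Suc (n + j * (n + 1) + e) = Suc (n + j' * (n + 1) + e')" if "S j e = S j' e'" for j e j' e'
  proof -
    have "Suc (n + j * (n + 1) + e) \<in> S j' e'" using that by (auto simp: S_def)
    then show ?thesis by (auto simp: S_def)
  qed
  \<comment> \<open>The tags make the \<open>n + 1\<close> candidates distinct, so they cannot all
    lie among the \<open>n\<close> vertices of the first side.\<close>
  have "\<exists>e\<le>n. b (S j e) \<notin> a ` {1..n}" if j: "j < n" for j
  proof (rule ccontr)
    assume "\<not> ?thesis"
    then have "(\<lambda>e. b (S j e)) ` {..n} \<subseteq> a ` {1..n}" by auto
    moreover have "inj_on (\<lambda>e. b (S j e)) {..n}"
      using b_inj S_sub[OF j] S_ext[of j _ j] by (intro inj_onI) fastforce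
    ultimately have "card {..n} \<le> card (a ` {1..n})" by (intro card_inj_on_le) auto
    also have "\<dots> \<le> card {1..n}" by (rule card_image_le) simp
    finally show False by simp
  qed
  then obtain e where e: "\<And>j. j < n \<Longrightarrow> e j \<le> n \<and> b (S j (e j)) \<notin> a ` {1..n}" by metis
  define \<alpha> where "\<alpha> i = a (Suc i)" for i
  define \<beta> where "\<beta> j = b (S j (e j))" for j
  have nk: "n \<le> k" by (simp add: k_def)
  have \<alpha>_inj: "inj_on \<alpha> {..<n}"
    using a_inj nk by (intro inj_onI) (force simp: \<alpha>_def)
  have \<beta>_inj: "inj_on \<beta> {..<n}"
  proof (rule inj_onI)
    fix j j' assume jj: "j \<in> {..<n}" "j' \<in> {..<n}" "\<beta> j = \<beta> j'"
    then have "S j (e j) = S j' (e j')"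
      using b_inj[OF S_sub S_sub] e unfolding \<beta>_def by blast
    then have "j * (n + 1) + e j = j' * (n + 1) + e j'" using S_ext[of j "e j" j' "e j'"] by simp
    then have "(j * (n + 1) + e j) div (n + 1) = (j' * (n + 1) + e j') div (n + 1)" by simp
    moreover have "(x * (n + 1) + y) div (n + 1) = x" if "y \<le> n" for x y
      using that by (intro div_nat_eqI) auto
    ultimately show "j = j'" using e[of j] e[of j'] jj(1,2) by simp
  qed
  have disj: "\<alpha> ` {..<n} \<inter> \<beta> ` {..<n} = {}"
  proof -
    have "\<alpha> ` {..<n} \<subseteq> a ` {1..n}" by (auto simp: \<alpha>_def)
    moreover have "\<beta> j \<notin> a ` {1..n}" if "j < n" for j using e[OF that] by (simp add: \<beta>_def)
    ultimately have "\<beta> ` {..<n} \<inter> a ` {1..n} = {}" "\<alpha> ` {..<n} \<subseteq> a ` {1..n}" by auto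
    then show ?thesis by blast
  qed
  have edge: "{\<alpha> i, \<beta> j} \<in> edges G \<longleftrightarrow> F i j" if "i < n" "j < n" for i j
  proof -
    have "S j (e j) \<in> Pow {1..k}" "Suc i \<in> {1..k}"
      using S_sub[OF that(2)] e[OF that(2)] that(1) nk by simp_all
    then have "{\<alpha> i, \<beta> j} \<in> edges G \<longleftrightarrow> Suc i \<in> S j (e j)"
      unfolding \<alpha>_def \<beta>_def using ab by blast
    then show ?thesis using that by (auto simp: S_def)
  qed
  let ?W = "\<alpha> ` {..<n} \<union> \<beta> ` {..<n}"
  have "?W \<subseteq> verts G"
  proof -
    have "\<alpha> i \<in> verts G" if "i < n" for i using a that nk by (simp add: \<alpha>_def)
    moreover have "\<beta> j \<in> verts G" if "j < n" for j
      unfolding \<beta>_def using b S_sub[OF that] e[OF that] by blast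
    ultimately show ?thesis by blast
  qed
  then have "induced G ?W \<in> \<H>" using her G(1) by (simp add: hereditary_def)
  moreover have "\<forall>i<n. \<forall>j<n. {\<alpha> i, \<beta> j} \<in> edges (induced G ?W) \<longleftrightarrow> F i j"
    using edge by (auto simp: induced_def edges_def)
  moreover have "verts (induced G ?W) = ?W" by (simp add: induced_def verts_def)
  ultimately show ?thesis using \<alpha>_inj \<beta>_inj disj by blast
qed

lemma (in sign_tower) card_regular_partition_ge:
  assumes her: "hereditary \<H>" and vc: "\<And>k. \<exists>G\<in>\<H>. has_vc G k"
    and s: "0 < s" and eps: "0 < \<epsilon>" "\<epsilon> \<le> 1 / (2 ^ 18 * real s ^ 3)"
  shows "\<exists>G\<in>\<H>. n0 \<le> card (verts G) \<and>
    (\<forall>P. regular_partition G \<epsilon> P \<longrightarrow> real (m s) / 2 \<le> real (card P))"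
proof -
  interpret sign_graph m r bit s "Suc n0" by unfold_locales (simp_all add: s)
  obtain G \<alpha> \<beta> where G: "G \<in> \<H>" and inj: "inj_on \<alpha> {..<N}" "inj_on \<beta> {..<N}"
    and disj: "\<alpha> ` {..<N} \<inter> \<beta> ` {..<N} = {}" and V: "verts G = \<alpha> ` {..<N} \<union> \<beta> ` {..<N}"
    and edge: "\<forall>i<N. \<forall>j<N. {\<alpha> i, \<beta> j} \<in> edges G \<longleftrightarrow> f i j = 1"
    using exists_bipartite_pattern[OF her vc, of N "\<lambda>i j. f i j = 1"]
    by (elim bexE exE conjE) (rule that; assumption)
  have cardV: "card (verts G) = 2 * N"
    unfolding V using disj by (subst card_Un_disjoint) (auto simp: card_image inj)
  have finV: "finite (verts G)" unfolding V by simp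
  have "n0 \<le> 1 * (1 * Suc n0)" by simp
  also have "\<dots> \<le> N" unfolding N_def using m_pos[of s] s by (intro mult_le_mono) auto
  also have "\<dots> \<le> 2 * N" by simp
  finally have large: "n0 \<le> card (verts G)" unfolding cardV .
  have "real (m s) / 2 \<le> real (card P)" if P: "regular_partition G \<epsilon> P" for P
  proof -
    have part: "partition_on (verts G) P" and irr: "(\<Sum>X\<in>P. \<Sum>Y\<in>P. of_bool (\<not> regular_pair G \<epsilon> X Y) *
        (real (card X) * real (card Y))) \<le> \<epsilon> * (real (card (verts G)))\<^sup>2"
      using P regular_partition_iff[OF finV] by auto
    have finX: "finite X" if "X \<in> P" for X
      using that part finV by (metis Union_upper finite_subset partition_onD1)
    define A where "A X = {a. a < N \<and> \<alpha> a \<in> X}" for X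
    define B where "B X = {b. b < N \<and> \<beta> b \<in> X}" for X
    have injA: "inj_on \<alpha> Z" if "Z \<subseteq> A X" for Z X
      using that by (intro inj_on_subset[OF inj(1)]) (auto simp: A_def)
    have injB: "inj_on \<beta> Z" if "Z \<subseteq> B X" for Z X
      using that by (intro inj_on_subset[OF inj(2)]) (auto simp: B_def)
    have e_AB: "e Z W = ecount G (\<alpha> ` Z) (\<beta> ` W)" if "Z \<subseteq> A X" "W \<subseteq> B Y" for Z W X Y
    proof -
      have "ecount G (\<alpha> ` Z) (\<beta> ` W) = (\<Sum>a\<in>Z. \<Sum>b\<in>W. of_bool ({\<alpha> a, \<beta> b} \<in> edges G))"
        unfolding ecount_def using injA[OF that(1)] injB[OF that(2)] by (simp only: sum.reindex o_def)
      also have "\<dots> = e Z W"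
        unfolding e_def using that edge by (intro sum.cong refl) (auto simp: A_def B_def)
      finally show ?thesis ..
    qed
    have e_sym: "e Z W = e W Z" for Z W
      unfolding e_def by (subst sum.swap) (simp add: f_commute)
    have e_BA: "e Z W = ecount G (\<beta> ` Z) (\<alpha> ` W)" if "Z \<subseteq> B X" "W \<subseteq> A Y" for Z W X Y
      using e_AB[OF that(2,1)] by (simp add: e_sym[of Z] ecount_commute[of G "\<beta> ` Z"])
    have reg: "\<bar>real z2 * ecount G X1 W - real z1 * ecount G X2 W\<bar> \<le> \<epsilon> * (real z1 + real z2) * (real (card X) * real (card Y))"
      if XY: "X \<in> P" "Y \<in> P" "regular_pair G \<epsilon> X Y" and sub: "X1 \<subseteq> X" "X2 \<subseteq> X" "W \<subseteq> Y"
        and z: "card X1 = z1" "card X2 = z2" for X Y X1 X2 W z1 z2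
    proof -
      let ?d = "density G X Y" and ?c = "\<epsilon> * (real (card X) * real (card Y))"
      have 1: "\<bar>ecount G X1 W - ?d * (real z1 * real (card W))\<bar> \<le> ?c"
        using regular_pair_ecount[OF XY(3) finX finX sub(1,3)] XY z by simp
      have 2: "\<bar>ecount G X2 W - ?d * (real z2 * real (card W))\<bar> \<le> ?c"
        using regular_pair_ecount[OF XY(3) finX finX sub(2,3)] XY z by simp
      \<comment> \<open>Weighting by the other cardinality makes the two terms with
        \<open>?d\<close> cancel; only here would the edges inside the two sides have
        entered.\<close>
      have "real z2 * ecount G X1 W - real z1 * ecount G X2 W =
        real z2 * (ecount G X1 W - ?d * (real z1 * real (card W)))
        - real z1 * (ecount G X2 W - ?d * (real z2 * real (card W)))"
        by (simp add: algebra_simps)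
      also have "\<bar>\<dots>\<bar> \<le> real z2 * ?c + real z1 * ?c"
        using mult_left_mono[OF 1, of "real z2"] mult_left_mono[OF 2, of "real z1"]
        by (intro order_trans[OF abs_triangle_ineq4] add_mono) (simp_all add: abs_mult)
      also have "\<dots> = \<epsilon> * (real z1 + real z2) * (real (card X) * real (card Y))"
        by (simp add: algebra_simps)
      finally show ?thesis .
    qed
    have sumw: "(\<Sum>X\<in>P. real (card X)) = 2 * real N"
    proof -
      have "verts G \<inter> X = X" if "X \<in> P" for X using that part by (auto simp: partition_on_def)
      then show ?thesis using sum_card_Int_parts[OF finV part, of "verts G"] cardV by simp
    qed
    interpret regular_cover m r bit s "Suc n0" P "\<lambda>X. real (card X)" A B "regular_pair G \<epsilon>" \<epsilon>
    proof unfold_locales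
      show "finite P" using finite_elements[OF finV part] .
      show "0 \<le> \<epsilon>" "\<epsilon> \<le> 1 / (2 ^ 18 * real s ^ 3)" using eps by auto
      have "\<Union>P = \<alpha> ` {..<N} \<union> \<beta> ` {..<N}" using part V by (simp add: partition_on_def)
      then show "\<Union>(A ` P) = {..<N}" "\<Union>(B ` P) = {..<N}" by (auto simp: A_def B_def)
      show "disjoint_family_on A P" "disjoint_family_on B P"
        using part by (auto simp: disjoint_family_on_def A_def B_def partition_on_def disjoint_def)
      show "(\<Sum>X\<in>P. real (card X)) = 2 * real N" by (rule sumw)
      show "(\<Sum>X\<in>P. \<Sum>Y\<in>P. of_bool (\<not> regular_pair G \<epsilon> X Y) * (real (card X) * real (card Y))) \<le> \<epsilon> * (2 * real N)\<^sup>2"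
        using irr cardV by simp
    next
      fix X assume X: "X \<in> P"
      have "card (A X) \<le> card X" "card (B X) \<le> card X"
        using finX[OF X] injA[of "A X" X] injB[of "B X" X]
        by (auto intro!: card_inj_on_le simp: A_def B_def)
      then show "real (card (A X)) \<le> real (card X)" "real (card (B X)) \<le> real (card X)" by auto
    next
      fix X Y Z1 Z2 W
      assume XY: "X \<in> P" "Y \<in> P" "regular_pair G \<epsilon> X Y" and sub: "Z1 \<subseteq> A X" "Z2 \<subseteq> A X" "W \<subseteq> B Y"
      show "\<bar>real (card Z2) * e Z1 W - real (card Z1) * e Z2 W\<bar>
         \<le> \<epsilon> * (real (card Z1) + real (card Z2)) * (real (card X) * real (card Y))"
        unfolding e_AB[OF sub(1,3)] e_AB[OF sub(2,3)] using sub injA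
        by (intro reg[OF XY] card_image) (auto simp: A_def B_def)
    next
      fix X Y Z1 Z2 W
      assume XY: "X \<in> P" "Y \<in> P" "regular_pair G \<epsilon> X Y" and sub: "Z1 \<subseteq> B X" "Z2 \<subseteq> B X" "W \<subseteq> A Y"
      show "\<bar>real (card Z2) * e Z1 W - real (card Z1) * e Z2 W\<bar>
         \<le> \<epsilon> * (real (card Z1) + real (card Z2)) * (real (card X) * real (card Y))"
        unfolding e_BA[OF sub(1,3)] e_BA[OF sub(2,3)] using sub injB
        by (intro reg[OF XY] card_image) (auto simp: A_def B_def)
    qed
    show ?thesis by (rule card_P_ge)
  qed
  then show ?thesis using G large by blast
qed

text \<open>The index \<open>s - 4\<close> reflects the four starting levels of \<open>m_ge\<close>;
  the factor 3 there pays for the 1/2 lost in \<open>card_regular_partition_ge\<close>.\<close>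

lemma Tw_le_card_regular_partition:
  assumes "hereditary \<H>" "\<And>k. \<exists>G\<in>\<H>. has_vc G k"
    and "4 < s" "0 < \<epsilon>" "\<epsilon> \<le> 1 / (2 ^ 18 * real s ^ 3)"
    and M: "\<forall>G\<in>\<H>. n0 \<le> card (verts G) \<longrightarrow> (\<exists>P. regular_partition G \<epsilon> P \<and> card P \<le> M)"
  shows "Tw (s - 4) \<le> M"
proof -
  obtain m r bit where "sign_tower m r bit" using exists_sign_tower by blast
  then interpret sign_tower m r bit .
  obtain G where "G \<in> \<H>" "n0 \<le> card (verts G)"
    and G: "\<And>P. regular_partition G \<epsilon> P \<Longrightarrow> real (m s) / 2 \<le> real (card P)"
    using card_regular_partition_ge[of \<H> s \<epsilon> n0] assms(1-5) by auto
  then obtain P where "regular_partition G \<epsilon> P" "card P \<le> M" using M by blast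
  then have "real (m s) / 2 \<le> real M" using G[of P] by linarith
  then have "m s \<le> 2 * M" by linarith
  moreover have "3 * (Tw (s - 4) + 4) \<le> m s" using m_ge[of "s - 4"] assms(3) by simp
  moreover have "t \<le> M" if "3 * (t + 4) \<le> x" "x \<le> 2 * M" for t x :: nat using that by simp
  ultimately show ?thesis by blast
qed

section \<open>The regularity lemma\<close>

lemma finite_part: "finite V \<Longrightarrow> partition_on V P \<Longrightarrow> X \<in> P \<Longrightarrow> finite X"
  by (metis Union_upper finite_subset partition_onD1)

lemma sum_partition_on:
  assumes "finite V" "partition_on V P"
  shows "(\<Sum>X\<in>P. \<Sum>x\<in>X. f x) = (\<Sum>x\<in>V. f x)"
proof -
  have "(\<Sum>x\<in>\<Union>P. f x) = (\<Sum>X\<in>P. \<Sum>x\<in>X. f x)"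
    using assms finite_elements[OF assms] finite_part[OF assms]
    by (subst sum.Union_disjoint) (auto simp: partition_on_def disjoint_def)
  then show ?thesis using assms by (simp add: partition_on_def)
qed

lemma sum_card_partition_on:
  assumes "finite V" "partition_on V P"
  shows "(\<Sum>X\<in>P. real (card X)) = real (card V)"
  using sum_partition_on[OF assms, of "\<lambda>_. 1 :: real"] by simp

lemma sum_ecount_partition_on:
  assumes "finite X" "partition_on X \<Z>" "finite Y" "partition_on Y \<W>"
  shows "(\<Sum>Z\<in>\<Z>. \<Sum>W\<in>\<W>. ecount G Z W) = ecount G X Y"
proof -
  have "(\<Sum>W\<in>\<W>. ecount G Z W) = ecount G Z Y" for Z
    unfolding ecount_def by (subst sum.swap) (simp only: sum_partition_on[OF assms(3,4)])
  then show ?thesis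
    unfolding ecount_def by (simp only: sum_partition_on[OF assms(1,2)])
qed

lemma sum_card_mult_partition_on:
  assumes "finite X" "partition_on X \<Z>" "finite Y" "partition_on Y \<W>"
  shows "(\<Sum>Z\<in>\<Z>. \<Sum>W\<in>\<W>. real (card Z) * real (card W)) = real (card X) * real (card Y)"
  by (simp only: sum_card_partition_on[OF assms(1,2)] sum_card_partition_on[OF assms(3,4)] flip: sum_product)

lemma sum_sum_distrib_left:
  fixes c :: "'a :: semiring_0"
  shows "(\<Sum>x\<in>A. \<Sum>y\<in>B. c * h x y) = c * (\<Sum>x\<in>A. \<Sum>y\<in>B. h x y)"
  by (simp add: sum_distrib_left)

lemma sum_density_deviation:
  assumes "finite X" "partition_on X \<Z>" "finite Y" "partition_on Y \<W>"
  shows "(\<Sum>Z\<in>\<Z>. \<Sum>W\<in>\<W>. real (card Z) * real (card W) * (density G Z W - density G X Y)) = 0"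
proof -
  have "(\<Sum>Z\<in>\<Z>. \<Sum>W\<in>\<W>. real (card Z) * real (card W) * (density G Z W - density G X Y))
     = (\<Sum>Z\<in>\<Z>. \<Sum>W\<in>\<W>. ecount G Z W - density G X Y * (real (card Z) * real (card W)))"
    using ecount_eq_density finite_part[OF assms(1,2)] finite_part[OF assms(3,4)]
    by (intro sum.cong refl) (simp add: algebra_simps)
  also have "\<dots> = ecount G X Y - density G X Y * (real (card X) * real (card Y))"
    by (simp only: sum_subtractf sum_sum_distrib_left sum_ecount_partition_on[OF assms]
        sum_card_mult_partition_on[OF assms])
  finally show ?thesis using ecount_eq_density[OF assms(1,3), of G] by simp
qed

text \<open>Convexity of the square: \<open>density G X Y\<close> is the weighted mean of the
  densities of the pieces. The cross term has mean zero and may be added freely.\<close>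

lemma density_variance_ge:
  assumes "finite X" "partition_on X \<Z>" "finite Y" "partition_on Y \<W>"
  shows "real (card X) * real (card Y) * (density G X Y - c)\<^sup>2
    \<le> (\<Sum>Z\<in>\<Z>. \<Sum>W\<in>\<W>. real (card Z) * real (card W) * (density G Z W - c)\<^sup>2)"
proof -
  let ?D = "density G X Y"
  have "real (card X) * real (card Y) * (?D - c)\<^sup>2 =
     (\<Sum>Z\<in>\<Z>. \<Sum>W\<in>\<W>. real (card Z) * real (card W)) * (?D - c)\<^sup>2 +
     2 * (?D - c) * (\<Sum>Z\<in>\<Z>. \<Sum>W\<in>\<W>. real (card Z) * real (card W) * (density G Z W - ?D))"
    unfolding sum_density_deviation[OF assms] sum_card_mult_partition_on[OF assms] by simp
  also have "\<dots> = (\<Sum>Z\<in>\<Z>. \<Sum>W\<in>\<W>. real (card Z) * real (card W) * (?D - c)\<^sup>2 +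
      2 * (?D - c) * (real (card Z) * real (card W) * (density G Z W - ?D)))"
    by (simp only: sum.distrib sum_distrib_left sum_distrib_right)
  also have "\<dots> \<le> (\<Sum>Z\<in>\<Z>. \<Sum>W\<in>\<W>. real (card Z) * real (card W) * (density G Z W - c)\<^sup>2)"
  proof (intro sum_mono)
    fix Z W
    have "0 \<le> real (card Z) * real (card W) * (density G Z W - ?D)\<^sup>2" by simp
    then show "real (card Z) * real (card W) * (?D - c)\<^sup>2 +
      2 * (?D - c) * (real (card Z) * real (card W) * (density G Z W - ?D))
      \<le> real (card Z) * real (card W) * (density G Z W - c)\<^sup>2"
      by (simp add: power2_eq_square algebra_simps)
  qed
  finally show ?thesis .
qed

section \<open>Energy increment\<close>

definition energy :: "ngraph \<Rightarrow> nat set set \<Rightarrow> real" where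
  "energy G P = (\<Sum>X\<in>P. \<Sum>Y\<in>P. real (card X) * real (card Y) * (density G X Y)\<^sup>2)"

lemma energy_nonneg: "0 \<le> energy G P"
  unfolding energy_def by (intro sum_nonneg) simp

lemma energy_le:
  assumes "finite V" "partition_on V P"
  shows "energy G P \<le> (real (card V))\<^sup>2"
proof -
  have "energy G P \<le> (\<Sum>X\<in>P. \<Sum>Y\<in>P. real (card X) * real (card Y))"
    unfolding energy_def
  proof (intro sum_mono)
    fix X Y assume "X \<in> P" "Y \<in> P"
    then have "(density G X Y)\<^sup>2 \<le> 1"
      using density_le_1 density_nonneg finite_part[OF assms] by (simp add: power_le_one)
    then show "real (card X) * real (card Y) * (density G X Y)\<^sup>2 \<le> real (card X) * real (card Y)"
      by (simp add: mult_left_le)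
  qed
  then show ?thesis
    by (simp only: sum_card_mult_partition_on[OF assms assms] power2_eq_square)
qed

lemma sum_refinement:
  assumes "finite V" "partition_on V P" "partition_on V Q"
    and ref: "\<And>X Z. X \<in> P \<Longrightarrow> Z \<in> Q \<Longrightarrow> Z \<subseteq> X \<or> Z \<inter> X = {}"
  shows "(\<Sum>X\<in>P. \<Sum>Z\<in>{Z\<in>Q. Z \<subseteq> X}. h Z) = (\<Sum>Z\<in>Q. h Z)"
proof -
  have fin: "finite P" "finite Q" using assms finite_elements by blast+
  have Q: "Q = (\<Union>X\<in>P. {Z\<in>Q. Z \<subseteq> X})"
  proof (intro equalityI subsetI)
    fix Z assume Z: "Z \<in> Q"
    then have "Z \<noteq> {}" "Z \<subseteq> V" using assms(3) by (auto simp: partition_on_def)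
    then obtain z where z: "z \<in> Z" "z \<in> V" by blast
    then obtain X where "X \<in> P" "z \<in> X" using assms(2) by (auto simp: partition_on_def)
    then show "Z \<in> (\<Union>X\<in>P. {Z\<in>Q. Z \<subseteq> X})" using ref[of X Z] Z z by blast
  qed auto
  have "{Z\<in>Q. Z \<subseteq> X} \<inter> {Z\<in>Q. Z \<subseteq> Y} = {}" if "X \<in> P" "Y \<in> P" "X \<noteq> Y" for X Y
  proof -
    have "X \<inter> Y = {}" "{} \<notin> Q" using that assms(2,3) by (auto simp: partition_on_def disjoint_def)
    moreover from this have "Z = {}" if "Z \<subseteq> X" "Z \<subseteq> Y" for Z using that by blast
    ultimately show ?thesis by auto
  qed
  then have "(\<Sum>Z\<in>(\<Union>X\<in>P. {Z\<in>Q. Z \<subseteq> X}). h Z) = (\<Sum>X\<in>P. \<Sum>Z\<in>{Z\<in>Q. Z \<subseteq> X}. h Z)"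
    using fin by (intro sum.UNION_disjoint) auto
  then show ?thesis using Q by simp
qed

lemma partition_on_subparts:
  assumes "partition_on V Q" "S \<subseteq> V" "\<And>Z. Z \<in> Q \<Longrightarrow> Z \<subseteq> S \<or> Z \<inter> S = {}"
  shows "partition_on S {Z\<in>Q. Z \<subseteq> S}"
proof -
  have "\<Union>{Z\<in>Q. Z \<subseteq> S} = S"
  proof (intro equalityI subsetI)
    fix x assume x: "x \<in> S"
    then obtain Z where "Z \<in> Q" "x \<in> Z" using assms(1,2) by (auto simp: partition_on_def)
    then show "x \<in> \<Union>{Z\<in>Q. Z \<subseteq> S}" using assms(3)[of Z] x by blast
  qed auto
  then show ?thesis using assms(1) by (auto simp: partition_on_def disjoint_def)
qed

text \<open>Pythagoras: the energy gained by refining is exactly the variance of the densities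
  inside the old pairs.\<close>

lemma energy_refinement:
  assumes V: "finite V" and P: "partition_on V P" and Q: "partition_on V Q"
    and ref: "\<And>X Z. X \<in> P \<Longrightarrow> Z \<in> Q \<Longrightarrow> Z \<subseteq> X \<or> Z \<inter> X = {}"
  shows "energy G Q = energy G P + (\<Sum>X\<in>P. \<Sum>Y\<in>P. \<Sum>Z\<in>{Z\<in>Q. Z \<subseteq> X}. \<Sum>W\<in>{W\<in>Q. W \<subseteq> Y}.
     real (card Z) * real (card W) * (density G Z W - density G X Y)\<^sup>2)"
proof -
  let ?Q = "\<lambda>X. {Z\<in>Q. Z \<subseteq> X}"
  let ?c = "\<lambda>Z W. real (card Z) * real (card W)"
  have part: "partition_on X (?Q X)" "finite X" if "X \<in> P" for X
    using that ref partition_on_subparts[OF Q, of X] P finite_part[OF V P]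
    by (auto simp: partition_on_def)
  have "energy G Q = (\<Sum>X\<in>P. \<Sum>Z\<in>?Q X. \<Sum>Y\<in>P. \<Sum>W\<in>?Q Y. ?c Z W * (density G Z W)\<^sup>2)"
    unfolding energy_def by (simp only: sum_refinement[OF V P Q ref])
  also have "\<dots> = (\<Sum>X\<in>P. \<Sum>Y\<in>P. \<Sum>Z\<in>?Q X. \<Sum>W\<in>?Q Y. ?c Z W * (density G Z W)\<^sup>2)"
    by (intro sum.cong refl sum.swap)
  also have "\<dots> = (\<Sum>X\<in>P. \<Sum>Y\<in>P. ?c X Y * (density G X Y)\<^sup>2 +
      (\<Sum>Z\<in>?Q X. \<Sum>W\<in>?Q Y. ?c Z W * (density G Z W - density G X Y)\<^sup>2))"
  proof (intro sum.cong refl)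
    fix X Y assume XY: "X \<in> P" "Y \<in> P"
    note p = part(2,1)[OF XY(1)] part(2,1)[OF XY(2)]
    let ?d = "density G X Y"
    have "(\<Sum>Z\<in>?Q X. \<Sum>W\<in>?Q Y. ?c Z W * (density G Z W)\<^sup>2) =
      (\<Sum>Z\<in>?Q X. \<Sum>W\<in>?Q Y. ?c Z W * (density G Z W - ?d)\<^sup>2 + ?d\<^sup>2 * ?c Z W
        + 2 * ?d * (?c Z W * (density G Z W - ?d)))"
      by (intro sum.cong refl) (simp add: power2_eq_square algebra_simps)
    also have "\<dots> = (\<Sum>Z\<in>?Q X. \<Sum>W\<in>?Q Y. ?c Z W * (density G Z W - ?d)\<^sup>2) + ?d\<^sup>2 * ?c X Y"
      by (simp only: sum.distrib sum_sum_distrib_left sum_density_deviation[OF p]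
          sum_card_mult_partition_on[OF p] mult_zero_right add_0_right)
    finally show "(\<Sum>Z\<in>?Q X. \<Sum>W\<in>?Q Y. ?c Z W * (density G Z W)\<^sup>2) = ?c X Y * ?d\<^sup>2 +
      (\<Sum>Z\<in>?Q X. \<Sum>W\<in>?Q Y. ?c Z W * (density G Z W - ?d)\<^sup>2)" by simp
  qed
  finally show ?thesis unfolding energy_def sum.distrib .
qed

definition atoms :: "'a set \<Rightarrow> 'a set set \<Rightarrow> 'a set set" where
  "atoms V \<S> = (\<lambda>x. {y \<in> V. \<forall>S\<in>\<S>. x \<in> S \<longleftrightarrow> y \<in> S}) ` V"

lemma partition_on_atoms: "partition_on V (atoms V \<S>)"
  unfolding partition_on_def atoms_def disjoint_def by auto

lemma atom_subset_or_disjoint: "S \<in> \<S> \<Longrightarrow> Z \<in> atoms V \<S> \<Longrightarrow> Z \<subseteq> S \<or> Z \<inter> S = {}"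
  unfolding atoms_def by auto

lemma card_atoms_le:
  assumes "finite \<S>"
  shows "card (atoms V \<S>) \<le> 2 ^ card \<S>"
proof -
  have "atoms V \<S> \<subseteq> (\<lambda>\<T>. {y \<in> V. \<forall>S\<in>\<S>. S \<in> \<T> \<longleftrightarrow> y \<in> S}) ` Pow \<S>"
  proof
    fix Z assume "Z \<in> atoms V \<S>"
    then obtain x where "Z = {y \<in> V. \<forall>S\<in>\<S>. x \<in> S \<longleftrightarrow> y \<in> S}" by (auto simp: atoms_def)
    then have "Z = {y \<in> V. \<forall>S\<in>\<S>. S \<in> {S \<in> \<S>. x \<in> S} \<longleftrightarrow> y \<in> S}" by auto
    then show "Z \<in> (\<lambda>\<T>. {y \<in> V. \<forall>S\<in>\<S>. S \<in> \<T> \<longleftrightarrow> y \<in> S}) ` Pow \<S>" by blast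
  qed
  then have "card (atoms V \<S>) \<le> card ((\<lambda>\<T>. {y \<in> V. \<forall>S\<in>\<S>. S \<in> \<T> \<longleftrightarrow> y \<in> S}) ` Pow \<S>)"
    using assms by (intro card_mono) auto
  also have "\<dots> \<le> card (Pow \<S>)" using assms by (intro card_image_le) auto
  finally show ?thesis using assms by (simp add: card_Pow)
qed

text \<open>Cutting by a witness for each irregular pair gains at least \<epsilon>^2 times its
  weight for the size of the witness, times \<epsilon>^2 for the squared deviation. The irregular
  pairs weigh more than \<epsilon> |V|^2, whence \<epsilon>^5.\<close>

lemma energy_increment:
  assumes fin: "finite (verts G)" and P: "partition_on (verts G) P"
    and eps: "0 < \<epsilon>" and irr: "\<not> regular_partition G \<epsilon> P"
  shows "\<exists>Q. partition_on (verts G) Q \<and> card Q \<le> 2 ^ (card P + 2 * (card P)\<^sup>2) \<and>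
    energy G P + \<epsilon> ^ 5 * (real (card (verts G)))\<^sup>2 \<le> energy G Q"
proof -
  let ?V = "verts G" and ?c = "\<lambda>X Y. real (card X) * real (card Y)"
  have finP: "finite P" using finite_elements[OF fin P] .
  \<comment> \<open>Regular pairs get arbitrary subsets, so that the choice functions
    \<open>L\<close> and \<open>R\<close> serve all pairs.\<close>
  have "\<exists>X' Y'. X' \<subseteq> X \<and> Y' \<subseteq> Y \<and> (\<not> regular_pair G \<epsilon> X Y \<longrightarrow> \<epsilon> * real (card X) \<le> real (card X') \<and>
      \<epsilon> * real (card Y) \<le> real (card Y') \<and> \<epsilon> < \<bar>density G X' Y' - density G X Y\<bar>)"
    if "X \<in> P" "Y \<in> P" for X Y
  proof (cases "regular_pair G \<epsilon> X Y")
    case False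
    have "X \<noteq> {}" "Y \<noteq> {}" using that P by (auto simp: partition_on_def)
    then show ?thesis using False unfolding regular_pair_def
      by (auto simp: not_le abs_minus_commute)
  qed blast
  then obtain L R where LR: "\<And>X Y. X \<in> P \<Longrightarrow> Y \<in> P \<Longrightarrow> L X Y \<subseteq> X \<and> R X Y \<subseteq> Y \<and>
      (\<not> regular_pair G \<epsilon> X Y \<longrightarrow> \<epsilon> * real (card X) \<le> real (card (L X Y)) \<and>
      \<epsilon> * real (card Y) \<le> real (card (R X Y)) \<and> \<epsilon> < \<bar>density G (L X Y) (R X Y) - density G X Y\<bar>)"
    by metis
  \<comment> \<open>\<open>P\<close> itself is included to make the atoms refine it.\<close>
  define \<S> where "\<S> = P \<union> ((\<lambda>(X, Y). L X Y) ` (P \<times> P) \<union> (\<lambda>(X, Y). R X Y) ` (P \<times> P))"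
  define Q where "Q = atoms ?V \<S>"
  have finS: "finite \<S>" using finP by (simp add: \<S>_def)
  have "card \<S> \<le> card P + (card (P \<times> P) + card (P \<times> P))"
    unfolding \<S>_def using finP
    by (intro order_trans[OF card_Un_le] add_mono card_image_le order_refl) auto
  also have "\<dots> = card P + 2 * (card P)\<^sup>2"
    by (simp add: card_cartesian_product power2_eq_square)
  finally have cardS: "card \<S> \<le> card P + 2 * (card P)\<^sup>2" .
  have Q: "partition_on ?V Q" unfolding Q_def by (rule partition_on_atoms)
  have "card Q \<le> 2 ^ card \<S>" unfolding Q_def using finS by (rule card_atoms_le)
  also have "\<dots> \<le> 2 ^ (card P + 2 * (card P)\<^sup>2)" using cardS by simp
  finally have cardQ: "card Q \<le> 2 ^ (card P + 2 * (card P)\<^sup>2)" .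
  have ref: "Z \<subseteq> S \<or> Z \<inter> S = {}" if "S \<in> \<S>" "Z \<in> Q" for S Z
    using atom_subset_or_disjoint that unfolding Q_def by blast
  have inS: "X \<in> \<S>" "L X Y \<in> \<S>" "R X Y \<in> \<S>" if "X \<in> P" "Y \<in> P" for X Y
    using that by (auto simp: \<S>_def)
  have sub: "X \<subseteq> ?V" if "X \<in> P" for X using that P by (auto simp: partition_on_def)
  let ?Q = "\<lambda>X. {Z\<in>Q. Z \<subseteq> X}"
  have finQ: "finite Q" using finite_elements[OF fin Q] .
  have gain: "\<epsilon> ^ 4 * (of_bool (\<not> regular_pair G \<epsilon> X Y) * ?c X Y) \<le>
      (\<Sum>Z\<in>?Q X. \<Sum>W\<in>?Q Y. ?c Z W * (density G Z W - density G X Y)\<^sup>2)"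
    if XY: "X \<in> P" "Y \<in> P" for X Y
  proof (cases "regular_pair G \<epsilon> X Y")
    case True
    then show ?thesis by (auto intro!: sum_nonneg)
  next
    case False
    let ?L = "L X Y" and ?R = "R X Y" and ?d = "density G X Y"
    have LR': "?L \<subseteq> X" "?R \<subseteq> Y" "\<epsilon> * real (card X) \<le> real (card ?L)"
      "\<epsilon> * real (card Y) \<le> real (card ?R)" "\<epsilon> < \<bar>density G ?L ?R - ?d\<bar>"
      using LR[OF XY] False by auto
    have finLR: "finite ?L" "finite ?R"
      using LR'(1,2) finite_part[OF fin P] XY finite_subset by blast+
    have "?L \<subseteq> ?V" "?R \<subseteq> ?V" using LR'(1,2) sub XY by blast+
    then have pLR: "partition_on ?L (?Q ?L)" "partition_on ?R (?Q ?R)"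
      using partition_on_subparts[OF Q] ref inS[OF XY] by blast+
    have "\<epsilon> ^ 4 * ?c X Y = (\<epsilon> * real (card X)) * (\<epsilon> * real (card Y)) * \<epsilon>\<^sup>2"
      by (simp add: power2_eq_square power4_eq_xxxx)
    also have "\<dots> \<le> ?c ?L ?R * (density G ?L ?R - ?d)\<^sup>2"
    proof (intro mult_mono LR')
      have "\<epsilon>\<^sup>2 \<le> \<bar>density G ?L ?R - ?d\<bar>\<^sup>2" using LR'(5) eps by (intro power_mono) auto
      then show "\<epsilon>\<^sup>2 \<le> (density G ?L ?R - ?d)\<^sup>2" by simp
    qed (use eps in auto)
    also have "\<dots> \<le> (\<Sum>Z\<in>?Q ?L. \<Sum>W\<in>?Q ?R. ?c Z W * (density G Z W - ?d)\<^sup>2)"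
      by (rule density_variance_ge[OF finLR(1) pLR(1) finLR(2) pLR(2)])
    also have "\<dots> \<le> (\<Sum>Z\<in>?Q X. \<Sum>W\<in>?Q Y. ?c Z W * (density G Z W - ?d)\<^sup>2)"
    proof (rule order_trans)
      show "(\<Sum>Z\<in>?Q ?L. \<Sum>W\<in>?Q ?R. ?c Z W * (density G Z W - ?d)\<^sup>2)
          \<le> (\<Sum>Z\<in>?Q ?L. \<Sum>W\<in>?Q Y. ?c Z W * (density G Z W - ?d)\<^sup>2)"
        using finQ LR'(2) by (intro sum_mono sum_mono2) auto
      show "(\<Sum>Z\<in>?Q ?L. \<Sum>W\<in>?Q Y. ?c Z W * (density G Z W - ?d)\<^sup>2)
          \<le> (\<Sum>Z\<in>?Q X. \<Sum>W\<in>?Q Y. ?c Z W * (density G Z W - ?d)\<^sup>2)"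
        using finQ LR'(1) by (intro sum_mono2) (auto intro!: sum_nonneg)
    qed
    finally show ?thesis using False by simp
  qed
  have "\<epsilon> * (real (card ?V))\<^sup>2 < (\<Sum>X\<in>P. \<Sum>Y\<in>P. of_bool (\<not> regular_pair G \<epsilon> X Y) * ?c X Y)"
    using irr P unfolding regular_partition_iff[OF fin] by (simp add: not_le)
  then have "\<epsilon> ^ 4 * (\<epsilon> * (real (card ?V))\<^sup>2) \<le>
      \<epsilon> ^ 4 * (\<Sum>X\<in>P. \<Sum>Y\<in>P. of_bool (\<not> regular_pair G \<epsilon> X Y) * ?c X Y)"
    using eps by (intro mult_left_mono) auto
  also have "\<dots> = (\<Sum>X\<in>P. \<Sum>Y\<in>P. \<epsilon> ^ 4 * (of_bool (\<not> regular_pair G \<epsilon> X Y) * ?c X Y))"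
    by (simp only: sum_distrib_left)
  also have "\<dots> \<le> (\<Sum>X\<in>P. \<Sum>Y\<in>P. \<Sum>Z\<in>?Q X. \<Sum>W\<in>?Q Y. ?c Z W * (density G Z W - density G X Y)\<^sup>2)"
    using gain by (intro sum_mono)
  also have "\<dots> = energy G Q - energy G P"
    using energy_refinement[OF fin P Q] ref inS(1) by simp
  finally have "energy G P + \<epsilon> ^ 5 * (real (card ?V))\<^sup>2 \<le> energy G Q"
    by (simp add: power_Suc numeral_eq_Suc mult.assoc)
  then show ?thesis using Q cardQ by blast
qed

text \<open>Turns the number of atoms after one increment into three exponentials, that is, three
  steps of \<open>Tw\<close>.\<close>

lemma quadratic_le_double_exp: "t + 2 * t\<^sup>2 \<le> 2 ^ 2 ^ t" for t :: nat
proof (induction t)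
  case (Suc t)
  show ?case
  proof (cases "t = 0")
    case False
    then have t: "1 \<le> t" by simp
    then obtain u where u: "t = Suc u" by (cases t) auto
    have "Suc t + 2 * (Suc t)\<^sup>2 \<le> 4 * (t + 2 * t\<^sup>2)" by (simp add: u power2_eq_square algebra_simps)
    also have "\<dots> \<le> 4 * 2 ^ 2 ^ t" using Suc.IH by simp
    also have "\<dots> = 2 ^ (2 + 2 ^ t)" by (simp add: power_add)
    also have "\<dots> \<le> 2 ^ 2 ^ Suc t"
    proof (rule power_increasing)
      have "(2::nat) ^ 1 \<le> 2 ^ t" using t by (intro power_increasing) auto
      then show "2 + 2 ^ t \<le> (2::nat) ^ Suc t" by simp
    qed simp
    finally show ?thesis .
  qed simp
qed simp

lemma Tw_mono: "i \<le> j \<Longrightarrow> Tw i \<le> Tw j"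
proof (induction j rule: dec_induct)
  case (step n)
  have "Tw n < Tw (Suc n)" using less_exp[of "Tw n"] by simp
  then show ?case using step by linarith
qed simp

text \<open>Starts at the one-part partition, of size \<open>Tw 1\<close>; each failure of
  regularity buys energy for three tower steps.\<close>

lemma regularity_iteration:
  assumes fin: "finite (verts G)" and ne: "verts G \<noteq> {}" and eps: "0 < \<epsilon>"
  shows "\<exists>P. partition_on (verts G) P \<and> card P \<le> Tw (3 * k + 1) \<and>
    (regular_partition G \<epsilon> P \<or> real k * (\<epsilon> ^ 5 * (real (card (verts G)))\<^sup>2) \<le> energy G P)"
proof (induction k)
  case 0
  have "partition_on (verts G) {verts G}" using ne by (rule partition_on_space)
  then show ?case using energy_nonneg[of G "{verts G}"] by (intro exI[of _ "{verts G}"]) simp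
next
  case (Suc k)
  then obtain P where P: "partition_on (verts G) P" "card P \<le> Tw (3 * k + 1)"
    "regular_partition G \<epsilon> P \<or> real k * (\<epsilon> ^ 5 * (real (card (verts G)))\<^sup>2) \<le> energy G P" by blast
  show ?case
  proof (cases "regular_partition G \<epsilon> P")
    case True
    then show ?thesis using P Tw_mono[of "3 * k + 1" "3 * Suc k + 1"] by (meson add_le_mono1 le_SucI le_refl le_trans mult_le_mono)
  next
    case False
    then obtain Q where Q: "partition_on (verts G) Q" "card Q \<le> 2 ^ (card P + 2 * (card P)\<^sup>2)"
      "energy G P + \<epsilon> ^ 5 * (real (card (verts G)))\<^sup>2 \<le> energy G Q"
      using energy_increment[OF fin P(1) eps] by blast
    have "card P + 2 * (card P)\<^sup>2 \<le> Tw (3 * k + 1) + 2 * (Tw (3 * k + 1))\<^sup>2"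
      using P(2) by (intro add_mono mult_le_mono power_mono) auto
    also have "\<dots> \<le> 2 ^ 2 ^ Tw (3 * k + 1)" by (rule quadratic_le_double_exp)
    finally have "2 ^ (card P + 2 * (card P)\<^sup>2) \<le> (2 ^ 2 ^ 2 ^ Tw (3 * k + 1) :: nat)"
      by (intro power_increasing) auto
    also have "\<dots> = Tw (Suc (Suc (Suc (3 * k + 1))))" by (simp only: Tw.simps)
    also have "Suc (Suc (Suc (3 * k + 1))) = 3 * Suc k + 1" by simp
    finally have "card Q \<le> Tw (3 * Suc k + 1)" using Q(2) by linarith
    moreover have "real (Suc k) * (\<epsilon> ^ 5 * (real (card (verts G)))\<^sup>2) \<le> energy G Q"
      using P(3) Q(3) False by (simp add: algebra_simps)
    ultimately show ?thesis using Q(1) by blast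
  qed
qed

text \<open>After \<open>k\<close> failures the energy would exceed its maximum |V|^2.\<close>

theorem szemeredi_regularity:
  assumes fin: "finite (verts G)" and eps: "0 < \<epsilon>" and k: "1 < real k * \<epsilon> ^ 5"
  shows "\<exists>P. regular_partition G \<epsilon> P \<and> card P \<le> Tw (3 * k + 1)"
proof (cases "verts G = {}")
  case True
  have "regular_partition G \<epsilon> {}"
    using True by (simp add: regular_partition_iff partition_on_empty)
  then show ?thesis by (intro exI[of _ "{}"]) simp
next
  case False
  obtain P where P: "partition_on (verts G) P" "card P \<le> Tw (3 * k + 1)"
    "regular_partition G \<epsilon> P \<or> real k * (\<epsilon> ^ 5 * (real (card (verts G)))\<^sup>2) \<le> energy G P"
    using regularity_iteration[OF fin False eps] by blast
  have "1 * (real (card (verts G)))\<^sup>2 < real k * \<epsilon> ^ 5 * (real (card (verts G)))\<^sup>2"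
    using k False fin by (intro mult_strict_right_mono) (auto simp: card_gt_0_iff)
  then have "energy G P < real k * (\<epsilon> ^ 5 * (real (card (verts G)))\<^sup>2)"
    using energy_le[OF fin P(1), of G] by (simp add: mult.assoc)
  then show ?thesis using P by auto
qed

section \<open>Regular partitions for bounded VC-dimension\<close>

definition shatters :: "'a set set \<Rightarrow> 'a set \<Rightarrow> bool" where
  "shatters \<F> S \<longleftrightarrow> (\<forall>T\<subseteq>S. \<exists>F\<in>\<F>. F \<inter> S = T)"

text \<open>Pajor's form of the Sauer-Shelah lemma. Split by membership of \<open>x\<close> and
  delete \<open>x\<close>: the traces \<open>A\<close> and \<open>B\<close> satisfy |A| + |B| = |A
  \<union> B| + |A \<inter> B|. The union accounts for shattered sets without \<open>x\<close>; a
  set shattered by the intersection stays shattered when \<open>x\<close> is added.\<close>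

lemma card_le_card_shattered:
  assumes "finite M" "\<F> \<subseteq> Pow M"
  shows "card \<F> \<le> card {S. S \<subseteq> M \<and> shatters \<F> S}"
  using assms
proof (induction M arbitrary: \<F> rule: finite_induct)
  case empty
  then consider "\<F> = {}" | "\<F> = {{}}" by (auto simp: subset_singleton_iff)
  then show ?case
  proof cases
    case 2
    then have "{S. S \<subseteq> {} \<and> shatters \<F> S} = {{}}" by (auto simp: shatters_def)
    then show ?thesis using 2 by simp
  qed simp
next
  case (insert x M)
  define A where "A = {F \<in> \<F>. x \<notin> F}"
  define B where "B = (\<lambda>F. F - {x}) ` {F \<in> \<F>. x \<in> F}"
  have finF: "finite \<F>" using insert.prems by (rule finite_subset) (simp add: insert.hyps)
  then have fin: "finite A" "finite B" by (simp_all add: A_def B_def)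
  have AB: "A \<subseteq> Pow M" "B \<subseteq> Pow M" using insert.prems by (auto simp: A_def B_def)
  have "\<F> = A \<union> {F \<in> \<F>. x \<in> F}" by (auto simp: A_def)
  then have "card \<F> = card (A \<union> {F \<in> \<F>. x \<in> F})" by simp
  also have "\<dots> = card A + card {F \<in> \<F>. x \<in> F}"
    using finF by (intro card_Un_disjoint) (auto simp: A_def)
  also have "card {F \<in> \<F>. x \<in> F} = card B"
    unfolding B_def by (intro card_image[symmetric] inj_onI) blast
  also have "card A + card B = card (A \<union> B) + card (A \<inter> B)"
    using fin by (rule card_Un_Int)
  also have "\<dots> \<le> card {S. S \<subseteq> M \<and> shatters (A \<union> B) S} + card {S. S \<subseteq> M \<and> shatters (A \<inter> B) S}"
    using AB by (intro add_mono insert.IH) auto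
  also have "card {S. S \<subseteq> M \<and> shatters (A \<inter> B) S} = card (Set.insert x ` {S. S \<subseteq> M \<and> shatters (A \<inter> B) S})"
  proof (intro card_image[symmetric] inj_onI)
    fix S T
    assume "S \<in> {S. S \<subseteq> M \<and> shatters (A \<inter> B) S}" "T \<in> {S. S \<subseteq> M \<and> shatters (A \<inter> B) S}"
      "Set.insert x S = Set.insert x T"
    moreover from this have "x \<notin> S" "x \<notin> T" using insert.hyps by auto
    ultimately show "S = T" by (simp add: insert_ident)
  qed
  also have "card {S. S \<subseteq> M \<and> shatters (A \<union> B) S} + \<dots> =
      card ({S. S \<subseteq> M \<and> shatters (A \<union> B) S} \<union> Set.insert x ` {S. S \<subseteq> M \<and> shatters (A \<inter> B) S})"
  proof (intro card_Un_disjoint[symmetric])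
    show "finite {S. S \<subseteq> M \<and> shatters (A \<union> B) S}"
      "finite (Set.insert x ` {S. S \<subseteq> M \<and> shatters (A \<inter> B) S})" using insert.hyps by simp_all
    show "{S. S \<subseteq> M \<and> shatters (A \<union> B) S} \<inter> Set.insert x ` {S. S \<subseteq> M \<and> shatters (A \<inter> B) S} = {}"
      using insert.hyps by auto
  qed
  also have "\<dots> \<le> card {S. S \<subseteq> Set.insert x M \<and> shatters \<F> S}"
  proof (rule card_mono)
    show "finite {S. S \<subseteq> Set.insert x M \<and> shatters \<F> S}"
      using insert.hyps by simp
    have "shatters \<F> S" if S: "S \<subseteq> M" "shatters (A \<union> B) S" for S
      unfolding shatters_def
    proof (intro allI impI)
      fix T assume "T \<subseteq> S"
      then obtain F where F: "F \<in> A \<union> B" "F \<inter> S = T" using S(2) unfolding shatters_def by blast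
      show "\<exists>F\<in>\<F>. F \<inter> S = T"
      proof (cases "F \<in> A")
        case True
        then show ?thesis using F(2) unfolding A_def by blast
      next
        case False
        then obtain F' where "F' \<in> \<F>" "F = F' - {x}" using F(1) unfolding B_def by blast
        moreover from this have "F' \<inter> S = T" using F(2) S(1) insert.hyps by blast
        ultimately show ?thesis by blast
      qed
    qed
    moreover have "shatters \<F> (Set.insert x S)" if S: "S \<subseteq> M" "shatters (A \<inter> B) S" for S
      unfolding shatters_def
    proof (intro allI impI)
      fix T assume T: "T \<subseteq> Set.insert x S"
      then have "T - {x} \<subseteq> S" by auto
      then obtain F where F: "F \<in> A" "F \<in> B" "F \<inter> S = T - {x}"
        using S(2) unfolding shatters_def by blast
      from F(1) have FF: "F \<in> \<F>" "x \<notin> F" by (simp_all add: A_def)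
      obtain F' where F': "F' \<in> \<F>" "x \<in> F'" "F = F' - {x}" using F(2) unfolding B_def by blast
      then have "Set.insert x F = F'" by blast
      then have FF': "Set.insert x F \<in> \<F>" using F'(1) by simp
      have "x \<notin> S" using S insert.hyps by auto
      show "\<exists>F\<in>\<F>. F \<inter> Set.insert x S = T"
      proof (cases "x \<in> T")
        case True
        then have "Set.insert x F \<inter> Set.insert x S = T" using F(3) by blast
        then show ?thesis using FF' by blast
      next
        case False
        then have "F \<inter> Set.insert x S = T" using F(3) FF(2) by blast
        then show ?thesis using FF by blast
      qed
    qed
    ultimately show "{S. S \<subseteq> M \<and> shatters (A \<union> B) S} \<union> Set.insert x ` {S. S \<subseteq> M \<and> shatters (A \<inter> B) S}
        \<subseteq> {S. S \<subseteq> Set.insert x M \<and> shatters \<F> S}" by auto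
  qed
  finally show ?case .
qed

lemma card_small_subsets_le:
  assumes "finite M" "card M \<le> m"
  shows "card {S. S \<subseteq> M \<and> card S < k} \<le> k * (m + 1) ^ k"
proof -
  have "{S. S \<subseteq> M \<and> card S < k} = (\<Union>i<k. {S. S \<subseteq> M \<and> card S = i})" by auto
  then have "card {S. S \<subseteq> M \<and> card S < k} \<le> (\<Sum>i<k. card {S. S \<subseteq> M \<and> card S = i})"
    by (simp add: card_UN_le)
  also have "\<dots> = (\<Sum>i<k. card M choose i)"
    using n_subsets[OF assms(1)] by simp
  also have "\<dots> \<le> (\<Sum>i<k. (m + 1) ^ k)"
  proof (rule sum_mono)
    fix i assume i: "i \<in> {..<k}"
    have "card M choose i \<le> card M ^ i"
      by (cases "i \<le> card M") (auto intro: binomial_le_pow simp: binomial_eq_0)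
    also have "\<dots> \<le> (m + 1) ^ i" using assms by (intro power_mono) auto
    also have "\<dots> \<le> (m + 1) ^ k" using i by (intro power_increasing) auto
    finally show "card M choose i \<le> (m + 1) ^ k" .
  qed
  finally show ?thesis by simp
qed

definition neighbours :: "ngraph \<Rightarrow> nat \<Rightarrow> nat set" where
  "neighbours G v = {u \<in> verts G. {u, v} \<in> edges G}"

lemma has_vc_if_shatters:
  assumes fin: "finite (verts G)" and S: "S \<subseteq> verts G"
    and sh: "shatters ((\<lambda>v. neighbours G v \<inter> M) ` W) S" "W \<subseteq> verts G" and k: "k \<le> card S"
  shows "has_vc G k"
proof -
  obtain S' where S': "S' \<subseteq> S" "card S' = k"
    using obtain_subset_with_card_n[OF k] by blast
  have "finite S'" using finite_subset[OF subset_trans[OF S'(1) S] fin] .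
  then obtain a where a: "bij_betw a {1..k} S'"
    using ex_bij_betw_nat_finite_1[of S'] S'(2) by auto
  have "\<exists>v\<in>verts G. \<forall>i\<in>{1..k}. {a i, v} \<in> edges G \<longleftrightarrow> i \<in> T" if T: "T \<subseteq> {1..k}" for T
  proof -
    have aS: "a i \<in> S" if "i \<in> {1..k}" for i using a S'(1) that by (auto simp: bij_betw_def)
    have "a ` T \<subseteq> S" using aS T by auto
    then have shT: "\<exists>F\<in>(\<lambda>v. neighbours G v \<inter> M) ` W. F \<inter> S = a ` T"
      by (rule sh(1)[unfolded shatters_def, rule_format])
    \<comment> \<open>The full set is also a trace, which forces \<open>S\<close> to lie inside
      \<open>M\<close>.\<close>
    have "\<exists>F\<in>(\<lambda>v. neighbours G v \<inter> M) ` W. F \<inter> S = S"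
      by (rule sh(1)[unfolded shatters_def, rule_format]) simp
    then have SM: "S \<subseteq> M" by auto
    obtain v where v: "v \<in> W" "neighbours G v \<inter> M \<inter> S = a ` T" using shT by auto
    have "{a i, v} \<in> edges G \<longleftrightarrow> i \<in> T" if i: "i \<in> {1..k}" for i
    proof -
      have "{a i, v} \<in> edges G \<longleftrightarrow> a i \<in> neighbours G v \<inter> M \<inter> S"
        using aS[OF i] SM S by (auto simp: neighbours_def)
      also have "\<dots> \<longleftrightarrow> i \<in> T"
        unfolding v(2) using a T i by (intro inj_on_image_mem_iff) (auto simp: bij_betw_def)
      finally show ?thesis .
    qed
    then show ?thesis using v(1) sh(2) by blast
  qed
  then obtain b where b: "\<And>T. T \<subseteq> {1..k} \<Longrightarrow> b T \<in> verts G \<and> (\<forall>i\<in>{1..k}. {a i, b T} \<in> edges G \<longleftrightarrow> i \<in> T)"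
    by metis
  have "a i \<in> verts G" if "i \<in> {1..k}" for i
    using bij_betwE[OF a] S'(1) S that by blast
  then show ?thesis unfolding has_vc_def using b by (intro exI[of _ a] exI[of _ b]) auto
qed

text \<open>A random \<open>m\<close>-tuple separates all pairs of sets at once: count the tuples missing a given
  pair.\<close>

lemma exists_separating_set:
  fixes B :: "'i \<Rightarrow> 'a set"
  assumes fin: "finite V" "finite J" and V: "V \<noteq> {}"
    and B: "\<And>u v. u \<in> J \<Longrightarrow> v \<in> J \<Longrightarrow> u \<noteq> v \<Longrightarrow> \<delta> * real (card V) \<le> real (card (sym_diff (B u) (B v)))"
    and sub: "\<And>u. u \<in> J \<Longrightarrow> B u \<subseteq> V" and \<delta>: "\<delta> \<le> 1"
    and m: "(real (card J))\<^sup>2 * (1 - \<delta>) ^ m < 1"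
  shows "\<exists>M\<subseteq>V. card M \<le> m \<and> inj_on (\<lambda>u. B u \<inter> M) J"
proof -
  let ?bad = "\<lambda>u v. PiE {..<m} (\<lambda>_. V - sym_diff (B u) (B v))"
  let ?I = "{(u, v) \<in> J \<times> J. u \<noteq> v}"
  have card_bad: "real (card (?bad u v)) \<le> ((1 - \<delta>) * real (card V)) ^ m" if "(u, v) \<in> ?I" for u v
  proof -
    have "sym_diff (B u) (B v) \<subseteq> V" using that sub by blast
    then have "real (card (V - sym_diff (B u) (B v))) = real (card V) - real (card (sym_diff (B u) (B v)))"
      using fin by (subst card_Diff_subset) (auto intro: finite_subset simp: of_nat_diff card_mono)
    also have "\<dots> \<le> (1 - \<delta>) * real (card V)" using B[of u v] that by (simp add: algebra_simps)
    finally have "real (card (V - sym_diff (B u) (B v))) ^ m \<le> ((1 - \<delta>) * real (card V)) ^ m"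
      by (intro power_mono) auto
    then show ?thesis by (simp add: card_PiE)
  qed
  have finI: "finite ?I" using fin by (auto intro: finite_subset[of _ "J \<times> J"])
  have "card ?I \<le> card (J \<times> J)" using fin by (intro card_mono) auto
  then have cardI: "real (card ?I) \<le> (real (card J))\<^sup>2"
    by (simp add: card_cartesian_product power2_eq_square flip: of_nat_mult)
  have "real (card (\<Union>(u, v)\<in>?I. ?bad u v)) \<le> (\<Sum>p\<in>?I. real (card (case p of (u, v) \<Rightarrow> ?bad u v)))"
    using card_UN_le[OF finI, of "\<lambda>(u, v). ?bad u v"] by (simp only: of_nat_sum[symmetric] of_nat_le_iff)
  also have "\<dots> \<le> (\<Sum>p\<in>?I. ((1 - \<delta>) * real (card V)) ^ m)"
    using card_bad by (intro sum_mono) auto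
  also have "\<dots> = real (card ?I) * ((1 - \<delta>) * real (card V)) ^ m" by simp
  also have "\<dots> \<le> (real (card J))\<^sup>2 * ((1 - \<delta>) * real (card V)) ^ m"
    using cardI \<delta> by (intro mult_right_mono) auto
  also have "\<dots> = ((real (card J))\<^sup>2 * (1 - \<delta>) ^ m) * real (card V) ^ m"
    by (simp add: power_mult_distrib)
  also have "\<dots> < 1 * real (card V) ^ m"
    using m fin V by (intro mult_strict_right_mono) (auto simp: card_gt_0_iff)
  also have "\<dots> = real (card (PiE {..<m} (\<lambda>_. V)))" by (simp add: card_PiE)
  finally have "card (\<Union>(u, v)\<in>?I. ?bad u v) < card (PiE {..<m} (\<lambda>_. V))"
    by (simp only: of_nat_less_iff)
  moreover have "finite (\<Union>(u, v)\<in>?I. ?bad u v)" using finI fin by (auto intro!: finite_PiE)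
  ultimately have "\<not> PiE {..<m} (\<lambda>_. V) \<subseteq> (\<Union>(u, v)\<in>?I. ?bad u v)"
    by (meson card_mono not_less)
  then obtain \<phi> where \<phi>: "\<phi> \<in> PiE {..<m} (\<lambda>_. V)" "\<phi> \<notin> (\<Union>(u, v)\<in>?I. ?bad u v)"
    unfolding subset_eq ball_simps(10) by (elim bexE)
  define M where "M = \<phi> ` {..<m}"
  have "M \<subseteq> V" using \<phi>(1) by (auto simp: M_def PiE_def)
  moreover have "card M \<le> m" unfolding M_def using card_image_le[of "{..<m}" \<phi>] by simp
  moreover have "inj_on (\<lambda>u. B u \<inter> M) J"
  proof (rule inj_onI, rule ccontr)
    fix u v assume uv: "u \<in> J" "v \<in> J" "B u \<inter> M = B v \<inter> M" "u \<noteq> v"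
    then have "\<phi> \<notin> ?bad u v" using \<phi>(2) by auto
    then obtain j where "j < m" "\<phi> j \<in> sym_diff (B u) (B v)"
      using \<phi>(1) by (auto simp: PiE_iff)
    then show False using uv(3) by (auto simp: M_def)
  qed
  ultimately show ?thesis by blast
qed

text \<open>For a separated family of exactly 2^D vertices, 2 D^2 samples suffice, because 4^D (1 -
  1/D)^(2 D^2) is at most (2/e)^(2 D) < 1. The 2^D distinct traces on so few vertices then
  contradict Sauer-Shelah.\<close>

lemma card_separated_less:
  assumes fin: "finite (verts G)" and vc: "\<not> has_vc G k" and D: "1 \<le> D"
    and large: "k * (2 * D\<^sup>2 + 1) ^ k < 2 ^ D"
    and J: "J \<subseteq> verts G"
    and sep: "\<And>u v. u \<in> J \<Longrightarrow> v \<in> J \<Longrightarrow> u \<noteq> v \<Longrightarrow>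
      real (card (verts G)) / real D \<le> real (card (sym_diff (neighbours G u) (neighbours G v)))"
  shows "card J < 2 ^ D"
proof (rule ccontr)
  assume "\<not> ?thesis"
  then obtain W where W: "W \<subseteq> J" "card W = 2 ^ D"
    using obtain_subset_with_card_n[of "2 ^ D" J] by (auto simp: not_less)
  have WV: "W \<subseteq> verts G" using W(1) J by (rule subset_trans)
  have finW: "finite W" using WV fin by (rule finite_subset)
  have "W \<noteq> {}" using W(2) by auto
  then have Vne: "verts G \<noteq> {}" using WV by auto
  define m where "m = 2 * D\<^sup>2"
  have "(real (2 ^ D))\<^sup>2 * (1 - 1 / real D) ^ m < 1"
  proof -
    have "(1 - 1 / real D) ^ m \<le> exp (- 1 / real D) ^ m"
      using D exp_ge_add_one_self[of "- 1 / real D"] by (intro power_mono) auto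
    also have "\<dots> = exp (- (2 * real D))"
      using D by (simp add: m_def power2_eq_square flip: exp_of_nat_mult)
    finally have "(real (2 ^ D))\<^sup>2 * (1 - 1 / real D) ^ m \<le> (real (2 ^ D))\<^sup>2 * exp (- (2 * real D))"
      by (intro mult_left_mono) auto
    also have "\<dots> = (2 * exp (- 1)) ^ (2 * D)"
    proof -
      have "exp (- (2 * real D)) = exp (- 1) ^ (2 * D)" by (simp flip: exp_of_nat_mult)
      moreover have "(real (2 ^ D))\<^sup>2 = 2 ^ (2 * D)" by (simp add: power_even_eq)
      ultimately show ?thesis by (simp only: power_mult_distrib)
    qed
    also have "\<dots> < 1"
    proof -
      have "2 < exp (1 :: real)" using exp_lower_Taylor_quadratic[of "1 :: real"] by simp
      then have "2 * exp (- 1) < (1 :: real)" by (simp add: exp_minus field_simps)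
      then show ?thesis using D power_strict_mono[of "2 * exp (- 1)" "1 :: real" "2 * D"] by simp
    qed
    finally show ?thesis .
  qed
  then have "(real (card W))\<^sup>2 * (1 - 1 / real D) ^ m < 1" using W(2) by simp
  then obtain M where M: "M \<subseteq> verts G" "card M \<le> m" "inj_on (\<lambda>u. neighbours G u \<inter> M) W"
    using exists_separating_set[OF fin finW Vne, of "1 / real D" "neighbours G" m] sep W D
    by (auto simp: neighbours_def)
  let ?F = "(\<lambda>u. neighbours G u \<inter> M) ` W"
  have finM: "finite M" using M(1) fin by (rule finite_subset)
  have "2 ^ D = card ?F" using M(3) W(2) by (simp add: card_image)
  also have "\<dots> \<le> card {S. S \<subseteq> M \<and> shatters ?F S}"
    using finM by (intro card_le_card_shattered) auto
  also have "\<dots> \<le> card {S. S \<subseteq> M \<and> card S < k}"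
  proof (intro card_mono Collect_mono impI conjI)
    show "finite {S. S \<subseteq> M \<and> card S < k}" using finM by simp
    fix S assume S: "S \<subseteq> M \<and> shatters ?F S"
    then show "S \<subseteq> M" ..
    show "card S < k"
      using has_vc_if_shatters[OF fin _ _ WV, of S M k] S M(1) vc by (meson not_less subset_trans)
  qed
  also have "\<dots> \<le> k * (2 * D\<^sup>2 + 1) ^ k"
    using card_small_subsets_le[OF finM M(2)] by (simp add: m_def)
  finally show False using large by simp
qed

section \<open>Near-twins force densities close to 0 or 1\<close>

text \<open>The left side counts ordered pairs of positions with different truth values. Moving from
  (x, y) to (x', y') through (x', y), one of the two moves must change the value.\<close>

lemma sum_of_bool_neq:
  fixes P :: "'a \<Rightarrow> 'b \<Rightarrow> bool" and X :: "'a set" and Y :: "'b set"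
  defines "e \<equiv> (\<Sum>x\<in>X. \<Sum>y\<in>Y. of_bool (P x y) :: real)" and "c \<equiv> real (card X) * real (card Y)"
  shows "2 * (e * (c - e)) \<le>
    real (card Y) * (\<Sum>x\<in>X. \<Sum>x'\<in>X. \<Sum>y\<in>Y. of_bool (P x y \<noteq> P x' y)) +
    real (card X) * (\<Sum>y\<in>Y. \<Sum>y'\<in>Y. \<Sum>x\<in>X. of_bool (P x y \<noteq> P x y'))"
proof -
  let ?I = "\<lambda>x y. of_bool (P x y) :: real"
  have inner: "(\<Sum>x'\<in>X. \<Sum>y'\<in>Y. of_bool (P x y \<noteq> P x' y')) = ?I x y * (c - e) + (1 - ?I x y) * e" for x y
  proof -
    have "(\<Sum>x'\<in>X. \<Sum>y'\<in>Y. of_bool (P x y \<noteq> P x' y')) =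
        (\<Sum>x'\<in>X. \<Sum>y'\<in>Y. ?I x y * (1 - ?I x' y') + (1 - ?I x y) * ?I x' y')"
      by (intro sum.cong refl) auto
    also have "\<dots> = ?I x y * (\<Sum>x'\<in>X. \<Sum>y'\<in>Y. 1 - ?I x' y') + (1 - ?I x y) * e"
      unfolding e_def by (simp only: sum.distrib sum_sum_distrib_left)
    also have "(\<Sum>x'\<in>X. \<Sum>y'\<in>Y. 1 - ?I x' y') = c - e"
      unfolding e_def c_def by (simp only: sum_subtractf) simp
    finally show ?thesis .
  qed
  have "2 * (e * (c - e)) = e * (c - e) + (c - e) * e" by simp
  also have "\<dots> = (\<Sum>x\<in>X. \<Sum>y\<in>Y. (c - e) * ?I x y + e * (1 - ?I x y))"
  proof -
    have "(\<Sum>x\<in>X. \<Sum>y\<in>Y. 1 - ?I x y) = c - e"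
      unfolding e_def c_def by (simp only: sum_subtractf) simp
    then show ?thesis by (simp only: sum.distrib sum_sum_distrib_left flip: e_def)
  qed
  also have "\<dots> = (\<Sum>x\<in>X. \<Sum>y\<in>Y. \<Sum>x'\<in>X. \<Sum>y'\<in>Y. of_bool (P x y \<noteq> P x' y'))"
    unfolding inner by (simp only: mult.commute[of "c - e"] mult.commute[of e])
  also have "\<dots> \<le> (\<Sum>x\<in>X. \<Sum>y\<in>Y. \<Sum>x'\<in>X. \<Sum>y'\<in>Y. of_bool (P x y \<noteq> P x' y) + of_bool (P x' y \<noteq> P x' y'))"
    by (intro sum_mono) auto
  also have "\<dots> = (\<Sum>x\<in>X. \<Sum>y\<in>Y. \<Sum>x'\<in>X. real (card Y) * of_bool (P x y \<noteq> P x' y)) +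
      (\<Sum>x\<in>X. \<Sum>y\<in>Y. \<Sum>x'\<in>X. \<Sum>y'\<in>Y. of_bool (P x' y \<noteq> P x' y'))"
    by (simp only: sum.distrib sum_constant)
  also have "(\<Sum>x\<in>X. \<Sum>y\<in>Y. \<Sum>x'\<in>X. real (card Y) * of_bool (P x y \<noteq> P x' y)) =
      real (card Y) * (\<Sum>x\<in>X. \<Sum>x'\<in>X. \<Sum>y\<in>Y. of_bool (P x y \<noteq> P x' y))"
    unfolding sum_distrib_left by (intro sum.cong refl sum.swap)
  also have "(\<Sum>x\<in>X. \<Sum>y\<in>Y. \<Sum>x'\<in>X. \<Sum>y'\<in>Y. of_bool (P x' y \<noteq> P x' y')) =
      real (card X) * (\<Sum>y\<in>Y. \<Sum>y'\<in>Y. \<Sum>x\<in>X. of_bool (P x y \<noteq> P x y'))"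
  proof -
    have "(\<Sum>x'\<in>X. \<Sum>y'\<in>Y. of_bool (P x' y \<noteq> P x' y') :: real) = (\<Sum>y'\<in>Y. \<Sum>x\<in>X. of_bool (P x y \<noteq> P x y'))" for y
      by (rule sum.swap)
    then show ?thesis by (simp only: sum_constant)
  qed
  finally show ?thesis .
qed

lemma card_sym_diff_neighbours:
  assumes "finite (verts G)"
  shows "(\<Sum>y\<in>verts G. of_bool (({y, u} \<in> edges G) \<noteq> ({y, v} \<in> edges G)) :: real)
    = real (card (sym_diff (neighbours G u) (neighbours G v)))"
proof -
  have "sym_diff (neighbours G u) (neighbours G v) = {y \<in> verts G. ({y, u} \<in> edges G) \<noteq> ({y, v} \<in> edges G)}"
    by (auto simp: neighbours_def)
  then show ?thesis using assms by (simp only:) (simp add: of_bool_def sum.If_cases Int_def)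
qed

text \<open>Exchanging a vertex for another of its part changes few adjacencies, so by
  \<open>sum_of_bool_neq\<close> edges and non-edges rarely coexist between two parts.\<close>

lemma sum_density_variance_le:
  assumes fin: "finite (verts G)" and P: "partition_on (verts G) P"
    and twins: "\<And>X u v. X \<in> P \<Longrightarrow> u \<in> X \<Longrightarrow> v \<in> X \<Longrightarrow>
      real (card (sym_diff (neighbours G u) (neighbours G v))) \<le> \<eta>"
  shows "(\<Sum>X\<in>P. \<Sum>Y\<in>P. real (card X) * real (card Y) * (density G X Y * (1 - density G X Y)))
    \<le> real (card (verts G)) * \<eta>"
proof -
  let ?V = "verts G"
  let ?h = "\<lambda>u v y. of_bool (({y, u} \<in> edges G) \<noteq> ({y, v} \<in> edges G)) :: real"
  \<comment> \<open>Divided by \<open>card X\<close>, the sum over all \<open>Y\<close> is at most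
    \<open>card X\<close> times \<open>\<eta>\<close>, so that the parts add up to the number of
    vertices.\<close>
  define S where "S X Y = (\<Sum>u\<in>X. \<Sum>v\<in>X. \<Sum>y\<in>Y. ?h u v y) / real (card X)" for X Y
  have finX: "finite X" "0 < card X" if "X \<in> P" for X
    using finite_part[OF fin P that] that P by (auto simp: partition_on_def card_gt_0_iff)
  have le: "2 * (real (card X) * real (card Y) * (density G X Y * (1 - density G X Y))) \<le> S X Y + S Y X"
    if XY: "X \<in> P" "Y \<in> P" for X Y
  proof -
    let ?x = "real (card X)" and ?y = "real (card Y)"
    have pos: "0 < ?x" "0 < ?y" using finX XY by auto
    have e: "ecount G X Y = density G X Y * (?x * ?y)"
      using ecount_eq_density finX XY by blast
    have "2 * (ecount G X Y * (?x * ?y - ecount G X Y)) \<le>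
        ?y * (\<Sum>u\<in>X. \<Sum>v\<in>X. \<Sum>y\<in>Y. of_bool (({u, y} \<in> edges G) \<noteq> ({v, y} \<in> edges G))) +
        ?x * (\<Sum>u\<in>Y. \<Sum>v\<in>Y. \<Sum>y\<in>X. ?h u v y)"
      unfolding ecount_def by (rule sum_of_bool_neq)
    also have "\<dots> = (?x * ?y) * (S X Y + S Y X)"
      using pos by (simp only: S_def insert_commute[of _ _ "{}"]) (simp add: field_simps)
    finally have "(?x * ?y) * (2 * (?x * ?y * (density G X Y * (1 - density G X Y)))) \<le> (?x * ?y) * (S X Y + S Y X)"
      unfolding e by (simp add: algebra_simps)
    then show ?thesis using pos by (simp only: mult_le_cancel_left_pos mult_pos_pos)
  qed
  have S_sum: "(\<Sum>Y\<in>P. S X Y) \<le> real (card X) * \<eta>" if X: "X \<in> P" for X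
  proof -
    have "(\<Sum>Y\<in>P. \<Sum>u\<in>X. \<Sum>v\<in>X. \<Sum>y\<in>Y. ?h u v y) = (\<Sum>u\<in>X. \<Sum>v\<in>X. \<Sum>Y\<in>P. \<Sum>y\<in>Y. ?h u v y)"
      by (subst sum.swap, intro sum.cong refl, rule sum.swap)
    also have "\<dots> = (\<Sum>u\<in>X. \<Sum>v\<in>X. real (card (sym_diff (neighbours G u) (neighbours G v))))"
      by (simp only: sum_partition_on[OF fin P] card_sym_diff_neighbours[OF fin])
    also have "\<dots> \<le> (\<Sum>u\<in>X. \<Sum>v\<in>X. \<eta>)"
      using twins[OF X] by (intro sum_mono) auto
    also have "\<dots> = real (card X) * (real (card X) * \<eta>)" by simp
    finally have "(\<Sum>Y\<in>P. \<Sum>u\<in>X. \<Sum>v\<in>X. \<Sum>y\<in>Y. ?h u v y) / real (card X) \<le> real (card X) * \<eta>"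
      using finX[OF X] by (simp add: pos_divide_le_eq mult.commute)
    then show ?thesis unfolding S_def sum_divide_distrib .
  qed
  have total: "(\<Sum>X\<in>P. \<Sum>Y\<in>P. S X Y) \<le> real (card ?V) * \<eta>"
  proof -
    have "(\<Sum>X\<in>P. \<Sum>Y\<in>P. S X Y) \<le> (\<Sum>X\<in>P. real (card X) * \<eta>)" using S_sum by (rule sum_mono)
    then show ?thesis by (simp only: sum_card_partition_on[OF fin P] flip: sum_distrib_right)
  qed
  have "2 * (\<Sum>X\<in>P. \<Sum>Y\<in>P. real (card X) * real (card Y) * (density G X Y * (1 - density G X Y)))
     = (\<Sum>X\<in>P. \<Sum>Y\<in>P. 2 * (real (card X) * real (card Y) * (density G X Y * (1 - density G X Y))))"
    by (simp only: sum_sum_distrib_left)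
  also have "\<dots> \<le> (\<Sum>X\<in>P. \<Sum>Y\<in>P. S X Y + S Y X)"
    using le by (intro sum_mono)
  also have "\<dots> = 2 * (\<Sum>X\<in>P. \<Sum>Y\<in>P. S X Y)"
    using sum.swap[of "\<lambda>X Y. S Y X" P P] by (simp only: sum.distrib)
  finally show ?thesis using total by linarith
qed

lemma ecount_mono:
  assumes "finite X" "finite Y" "X' \<subseteq> X" "Y' \<subseteq> Y"
  shows "ecount G X' Y' \<le> ecount G X Y"
proof -
  have "ecount G X' Y' \<le> (\<Sum>x\<in>X'. \<Sum>y\<in>Y. of_bool ({x, y} \<in> edges G))"
    unfolding ecount_def using assms by (intro sum_mono sum_mono2) auto
  also have "\<dots> \<le> ecount G X Y"
    unfolding ecount_def using assms by (intro sum_mono2) (auto intro: sum_nonneg)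
  finally show ?thesis .
qed

lemma card_minus_ecount_mono:
  assumes "finite X" "finite Y" "X' \<subseteq> X" "Y' \<subseteq> Y"
  shows "real (card X') * real (card Y') - ecount G X' Y' \<le> real (card X) * real (card Y) - ecount G X Y"
proof -
  have eq: "real (card X) * real (card Y) - ecount G X Y = (\<Sum>x\<in>X. \<Sum>y\<in>Y. 1 - of_bool ({x, y} \<in> edges G))" for X Y
    unfolding ecount_def by (simp only: sum_subtractf) simp
  have "(\<Sum>x\<in>X'. \<Sum>y\<in>Y'. 1 - of_bool ({x, y} \<in> edges G) :: real) \<le> (\<Sum>x\<in>X'. \<Sum>y\<in>Y. 1 - of_bool ({x, y} \<in> edges G))"
    using assms by (intro sum_mono sum_mono2) auto
  also have "\<dots> \<le> (\<Sum>x\<in>X. \<Sum>y\<in>Y. 1 - of_bool ({x, y} \<in> edges G))"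
    using assms by (intro sum_mono2) (auto intro: sum_nonneg)
  finally show ?thesis unfolding eq .
qed

text \<open>Large subsets cannot increase the density, or that of the complement, by more than a factor
  \<open>\<epsilon>\<^sup>-\<^sup>2\<close>.\<close>

lemma regular_pair_if_extreme_density:
  assumes fin: "finite X" "finite Y" and ne: "X \<noteq> {}" "Y \<noteq> {}" and eps: "0 < \<epsilon>"
    and small: "density G X Y * (1 - density G X Y) \<le> \<epsilon> ^ 3 / 2"
  shows "regular_pair G \<epsilon> X Y"
  unfolding regular_pair_def
proof (intro conjI ne allI impI)
  fix X' Y' assume sub: "X' \<subseteq> X" "Y' \<subseteq> Y"
    and large: "\<epsilon> * real (card X) \<le> real (card X')" "\<epsilon> * real (card Y) \<le> real (card Y')"
  have fin': "finite X'" "finite Y'" using fin sub by (auto intro: finite_subset)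
  let ?d = "density G X Y" and ?d' = "density G X' Y'"
  let ?c = "real (card X) * real (card Y)" and ?c' = "real (card X') * real (card Y')"
  have d: "0 \<le> ?d" "?d \<le> 1" "0 \<le> ?d'" "?d' \<le> 1"
    using density_nonneg density_le_1 fin fin' by auto
  have pos: "0 < real (card X)" "0 < real (card Y)" using fin ne by (auto simp: card_gt_0_iff)
  have "0 < \<epsilon> * real (card X)" "0 < \<epsilon> * real (card Y)" using pos eps by simp_all
  then have pos': "0 < ?c'" using large by (intro mult_pos_pos) linarith+
  have cc: "\<epsilon>\<^sup>2 * ?c \<le> ?c'"
  proof -
    have "\<epsilon>\<^sup>2 * ?c = (\<epsilon> * real (card X)) * (\<epsilon> * real (card Y))" by (simp add: power2_eq_square)
    also have "\<dots> \<le> ?c'" using large eps by (intro mult_mono) auto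
    finally show ?thesis .
  qed
  show "\<bar>?d - ?d'\<bar> \<le> \<epsilon>"
  proof (cases "1 \<le> \<epsilon>")
    case True
    then show ?thesis using d by linarith
  next
    case False
    have e3: "\<epsilon> ^ 3 \<le> \<epsilon>" using eps False by (simp add: power3_eq_cube mult_le_one mult_left_le)
    \<comment> \<open>Needed for the density when it is small and for its complement when it is
      large.\<close>
    have trans: "t' \<le> \<epsilon>" if "t \<le> \<epsilon> ^ 3" "t' * ?c' \<le> t * ?c" for t t'
    proof -
      have "t' * ?c' \<le> \<epsilon> ^ 3 * ?c" using that pos by (meson mult_pos_pos mult_right_mono less_imp_le order_trans)
      also have "\<dots> = \<epsilon> * (\<epsilon>\<^sup>2 * ?c)" by (simp add: power3_eq_cube power2_eq_square)
      also have "\<dots> \<le> \<epsilon> * ?c'" using cc eps by (intro mult_left_mono) auto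
      finally show ?thesis using pos' by (simp only: mult_le_cancel_right_pos)
    qed
    show ?thesis
    proof (cases "?d \<le> 1 / 2")
      case True
      have "?d * (1 / 2) \<le> ?d * (1 - ?d)" using True d by (intro mult_left_mono) auto
      then have "?d \<le> \<epsilon> ^ 3" using small by linarith
      moreover have "?d' * ?c' \<le> ?d * ?c"
        using ecount_mono[OF fin sub, of G] ecount_eq_density[OF fin, of G] ecount_eq_density[OF fin', of G] by simp
      ultimately have "?d' \<le> \<epsilon>" by (rule trans)
      then show ?thesis using \<open>?d \<le> \<epsilon> ^ 3\<close> e3 d by linarith
    next
      case False
      have "(1 / 2) * (1 - ?d) \<le> ?d * (1 - ?d)" using False d by (intro mult_right_mono) auto
      then have "(1 / 2) * (1 - ?d) \<le> \<epsilon> ^ 3 / 2" using small by (rule order_trans)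
      then have "1 - ?d \<le> \<epsilon> ^ 3" by simp
      moreover have "(1 - ?d') * ?c' \<le> (1 - ?d) * ?c"
        using card_minus_ecount_mono[OF fin sub, of G] ecount_eq_density[OF fin, of G] ecount_eq_density[OF fin', of G]
        by (simp add: left_diff_distrib)
      ultimately have "1 - ?d' \<le> \<epsilon>" by (rule trans)
      then show ?thesis using \<open>1 - ?d \<le> \<epsilon> ^ 3\<close> e3 d by linarith
    qed
  qed
qed

text \<open>Markov's inequality: an irregular pair has d (1 - d) above \<epsilon>^3 / 2, while the
  weighted sum of d (1 - d) is at most \<epsilon>^4 / 2 times |V|^2.\<close>

lemma regular_partition_if_twins:
  assumes fin: "finite (verts G)" and P: "partition_on (verts G) P" and eps: "0 < \<epsilon>"
    and twins: "\<And>X u v. X \<in> P \<Longrightarrow> u \<in> X \<Longrightarrow> v \<in> X \<Longrightarrow>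
      real (card (sym_diff (neighbours G u) (neighbours G v))) \<le> \<epsilon> ^ 4 / 2 * real (card (verts G))"
  shows "regular_partition G \<epsilon> P"
proof -
  let ?c = "\<lambda>X Y. real (card X) * real (card Y)"
  have "(\<epsilon> ^ 3 / 2) * (\<Sum>X\<in>P. \<Sum>Y\<in>P. of_bool (\<not> regular_pair G \<epsilon> X Y) * ?c X Y)
     = (\<Sum>X\<in>P. \<Sum>Y\<in>P. (\<epsilon> ^ 3 / 2) * (of_bool (\<not> regular_pair G \<epsilon> X Y) * ?c X Y))"
    by (simp only: sum_sum_distrib_left)
  also have "\<dots> \<le> (\<Sum>X\<in>P. \<Sum>Y\<in>P. ?c X Y * (density G X Y * (1 - density G X Y)))"
  proof (intro sum_mono)
    fix X Y assume XY: "X \<in> P" "Y \<in> P"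
    have finXY: "finite X" "finite Y" using finite_part[OF fin P] XY by auto
    have ne: "X \<noteq> {}" "Y \<noteq> {}" using XY P by (auto simp: partition_on_def)
    have nn: "0 \<le> density G X Y * (1 - density G X Y)"
      using density_nonneg density_le_1[OF finXY] by simp
    show "(\<epsilon> ^ 3 / 2) * (of_bool (\<not> regular_pair G \<epsilon> X Y) * ?c X Y) \<le> ?c X Y * (density G X Y * (1 - density G X Y))"
    proof (cases "regular_pair G \<epsilon> X Y")
      case True
      then show ?thesis using nn by simp
    next
      case False
      then have "\<epsilon> ^ 3 / 2 \<le> density G X Y * (1 - density G X Y)"
        using regular_pair_if_extreme_density[OF finXY ne eps, of G] by linarith
      then have "?c X Y * (\<epsilon> ^ 3 / 2) \<le> ?c X Y * (density G X Y * (1 - density G X Y))"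
        by (intro mult_left_mono) auto
      then show ?thesis using False by (simp add: mult.commute)
    qed
  qed
  also have "\<dots> \<le> real (card (verts G)) * (\<epsilon> ^ 4 / 2 * real (card (verts G)))"
    by (rule sum_density_variance_le[OF fin P twins])
  also have "\<dots> = (\<epsilon> ^ 3 / 2) * (\<epsilon> * (real (card (verts G)))\<^sup>2)"
    by (simp add: power2_eq_square numeral_eq_Suc)
  finally show ?thesis
    unfolding regular_partition_iff[OF fin] using P eps by (simp only: mult_le_cancel_left_pos) simp
qed

text \<open>By maximality every vertex is within |V| / D of its representative, so two vertices of a
  part differ by at most 2 |V| / D; the bound on \<open>D\<close> makes this \<epsilon>^4 |V| /
  2.\<close>

lemma regular_partition_if_no_vc:
  assumes fin: "finite (verts G)" and vc: "\<not> has_vc G k" and D: "1 \<le> D"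
    and large: "k * (2 * D\<^sup>2 + 1) ^ k < 2 ^ D" and eps: "0 < \<epsilon>" "4 / \<epsilon> ^ 4 \<le> real D"
  shows "\<exists>P. regular_partition G \<epsilon> P \<and> card P \<le> 2 ^ D"
proof -
  let ?V = "verts G" and ?\<delta> = "real (card (verts G)) / real D"
  let ?dist = "\<lambda>u v. real (card (sym_diff (neighbours G u) (neighbours G v)))"
  have finN: "finite (neighbours G u)" for u using fin by (simp add: neighbours_def)
  define sep where "sep J \<longleftrightarrow> (\<forall>u\<in>J. \<forall>v\<in>J. u \<noteq> v \<longrightarrow> ?\<delta> \<le> ?dist u v)" for J
  define \<F> where "\<F> = {J. J \<subseteq> ?V \<and> sep J}"
  have "finite \<F>" "\<F> \<noteq> {}" using fin by (auto simp: \<F>_def sep_def)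
  then obtain J where JF: "J \<in> \<F>" and maxF: "\<forall>K\<in>\<F>. J \<subseteq> K \<longrightarrow> J = K"
    using finite_has_maximal[of \<F>] by blast
  have J: "J \<subseteq> ?V" "sep J" using JF by (simp_all add: \<F>_def)
  have max: "J = K" if "K \<subseteq> ?V" "sep K" "J \<subseteq> K" for K
    using maxF that by (simp add: \<F>_def)
  have dist_sym: "?dist u v = ?dist v u" for u v by (simp add: Un_commute)
  have near: "\<exists>u\<in>J. ?dist u v \<le> ?\<delta>" if v: "v \<in> ?V" for v
  proof (cases "v \<in> J")
    case True
    then show ?thesis by (intro bexI[of _ v]) simp_all
  next
    case False
    then have "\<not> sep (insert v J)" using max[of "insert v J"] J(1) v by blast
    then obtain x y where xy: "x \<in> insert v J" "y \<in> insert v J" "x \<noteq> y" "?dist x y < ?\<delta>"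
      unfolding sep_def by (auto simp: not_le)
    then have "x = v \<or> y = v" using J(2) unfolding sep_def by (metis insertE not_le)
    then show ?thesis using xy dist_sym[of x y] by (metis insertE less_imp_le)
  qed
  then obtain rep where rep: "\<And>v. v \<in> ?V \<Longrightarrow> rep v \<in> J \<and> ?dist (rep v) v \<le> ?\<delta>" by metis
  define P where "P = (\<lambda>u. {v \<in> ?V. rep v = u}) ` J - {{}}"
  have "finite J" using J(1) fin by (rule finite_subset)
  then have "card P \<le> card ((\<lambda>u. {v \<in> ?V. rep v = u}) ` J)" unfolding P_def by (intro card_mono) auto
  also have "\<dots> \<le> card J" using \<open>finite J\<close> by (rule card_image_le)
  also have "card J < 2 ^ D"
    by (rule card_separated_less[OF fin vc D large J(1)]) (use J(2) in \<open>simp add: sep_def\<close>)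
  finally have cardP: "card P \<le> 2 ^ D" by simp
  have P: "partition_on ?V P"
    unfolding P_def partition_on_def disjoint_def using rep by auto
  have "regular_partition G \<epsilon> P"
  proof (rule regular_partition_if_twins[OF fin P eps(1)])
    fix X u v assume X: "X \<in> P" "u \<in> X" "v \<in> X"
    then have uv: "u \<in> ?V" "v \<in> ?V" "rep u = rep v" by (auto simp: P_def)
    have "card (sym_diff (neighbours G u) (neighbours G v)) \<le>
        card (sym_diff (neighbours G (rep u)) (neighbours G u) \<union> sym_diff (neighbours G (rep u)) (neighbours G v))"
      using finN by (intro card_mono) auto
    also have "\<dots> \<le> card (sym_diff (neighbours G (rep u)) (neighbours G u)) +
        card (sym_diff (neighbours G (rep u)) (neighbours G v))"
      by (rule card_Un_le)
    finally have "?dist u v \<le> ?dist (rep u) u + ?dist (rep u) v" by linarith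
    also have "\<dots> \<le> ?\<delta> + ?\<delta>" using rep[OF uv(1)] rep[OF uv(2)] uv(3) by (intro add_mono) auto
    also have "\<dots> = 2 / real D * real (card ?V)" by simp
    also have "\<dots> \<le> \<epsilon> ^ 4 / 2 * real (card ?V)"
    proof (intro mult_right_mono)
      have "4 \<le> real D * \<epsilon> ^ 4" using eps by (simp add: pos_divide_le_eq)
      then show "2 / real D \<le> \<epsilon> ^ 4 / 2" using D by (simp add: field_simps)
    qed simp
    finally show "?dist u v \<le> \<epsilon> ^ 4 / 2 * real (card ?V)" .
  qed
  then show ?thesis using cardP by blast
qed

section \<open>The equivalence\<close>

definition M_reg_bound :: "ngraph set \<Rightarrow> real \<Rightarrow> nat \<Rightarrow> bool" where
  "M_reg_bound \<H> \<epsilon> M \<longleftrightarrow> (\<exists>N. \<forall>G\<in>\<H>. card (verts G) \<ge> N \<longrightarrow>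
     (\<exists>P. regular_partition G \<epsilon> P \<and> card P \<le> M))"

lemma M_reg_eq: "M_reg \<H> \<epsilon> = (LEAST M. M_reg_bound \<H> \<epsilon> M)"
  by (simp add: M_reg_def M_reg_bound_def)

lemma M_reg_le: "(\<And>G. G \<in> \<H> \<Longrightarrow> \<exists>P. regular_partition G \<epsilon> P \<and> card P \<le> M) \<Longrightarrow> M_reg \<H> \<epsilon> \<le> M"
  unfolding M_reg_eq by (rule Least_le) (auto simp: M_reg_bound_def)

lemma finite_verts_hereditary: "hereditary \<H> \<Longrightarrow> G \<in> \<H> \<Longrightarrow> finite (verts G)"
  by (simp add: hereditary_def wf_graph_def)

lemma exists_iteration_number:
  assumes "0 < \<epsilon>"
  obtains k where "1 < real k * \<epsilon> ^ 5" "real k \<le> \<epsilon> powr (-5) + 1"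
proof
  let ?k = "nat (\<lfloor>\<epsilon> powr (-5)\<rfloor> + 1)"
  have "0 < \<epsilon> powr (-5)" using assms by simp
  then have k: "\<epsilon> powr (-5) < real ?k" "real ?k \<le> \<epsilon> powr (-5) + 1" by linarith+
  have "\<epsilon> powr (-5) * \<epsilon> ^ 5 = 1" using assms by (simp add: powr_minus powr_numeral)
  then show "1 < real ?k * \<epsilon> ^ 5" using k(1) assms mult_strict_right_mono[of "\<epsilon> powr (-5)" "real ?k" "\<epsilon> ^ 5"] by simp
  show "real ?k \<le> \<epsilon> powr (-5) + 1" by (rule k(2))
qed

text \<open>Some bound must exist for the LEAST to be attained; hence the lower bound on
  \<open>M_reg\<close> also rests on the regularity lemma.\<close>

lemma M_reg_bound_M_reg:
  assumes "hereditary \<H>" "0 < \<epsilon>"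
  shows "M_reg_bound \<H> \<epsilon> (M_reg \<H> \<epsilon>)"
proof -
  obtain k where "1 < real k * \<epsilon> ^ 5" using exists_iteration_number[OF assms(2)] by blast
  then have "M_reg_bound \<H> \<epsilon> (Tw (3 * k + 1))"
    unfolding M_reg_bound_def using szemeredi_regularity finite_verts_hereditary assms by blast
  then show ?thesis unfolding M_reg_eq by (rule LeastI)
qed

lemma M_reg_le_Tw:
  assumes her: "hereditary \<H>" and eps: "0 < \<epsilon>" "3 * \<epsilon> powr (-5) + 4 \<le> \<epsilon> powr (-6)"
  shows "M_reg \<H> \<epsilon> \<le> Tw_real (\<epsilon> powr (-6))"
proof -
  obtain k where k: "1 < real k * \<epsilon> ^ 5" "real k \<le> \<epsilon> powr (-5) + 1"
    using exists_iteration_number[OF eps(1)] by blast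
  have "M_reg \<H> \<epsilon> \<le> Tw (3 * k + 1)"
    using her k(1) eps(1) by (intro M_reg_le szemeredi_regularity finite_verts_hereditary)
  also have "\<dots> \<le> Tw_real (\<epsilon> powr (-6))"
    unfolding Tw_real_def
  proof (rule Tw_mono)
    have "real (3 * k + 1) \<le> \<epsilon> powr (-6)" using k(2) eps(2) by simp
    then show "3 * k + 1 \<le> nat \<lceil>\<epsilon> powr (-6)\<rceil>" by linarith
  qed
  finally show ?thesis .
qed

text \<open>\<open>s\<close> is chosen as the tower height plus 4, at most \<epsilon>^(-1/4) + 5.
  Its cube is of order \<epsilon>^(-3/4), which leaves room for the constant; any exponent below 1/3
  would do.\<close>

lemma Tw_le_M_reg:
  assumes her: "hereditary \<H>" and vc: "\<And>k. \<exists>G\<in>\<H>. has_vc G k"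
    and eps: "0 < \<epsilon>" "\<epsilon> \<le> 1 / (2 ^ 18 * (\<epsilon> powr (-1/4) + 5) ^ 3)"
  shows "Tw_real (\<epsilon> powr (-1/4)) \<le> M_reg \<H> \<epsilon>"
proof -
  define x n where "x = \<epsilon> powr (-1/4)" and "n = nat \<lceil>x\<rceil>"
  have pos: "0 < x" using eps(1) by (simp add: x_def)
  then have n: "0 < n" "real n \<le> x + 1" unfolding n_def by linarith+
  have "1 / (2 ^ 18 * (x + 5) ^ 3) \<le> 1 / (2 ^ 18 * real (n + 4) ^ 3)"
    using n pos by (intro divide_left_mono mult_left_mono power_mono mult_pos_pos zero_less_power) auto
  then have "\<epsilon> \<le> 1 / (2 ^ 18 * real (n + 4) ^ 3)" using eps(2) unfolding x_def[symmetric] by linarith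
  moreover obtain N where "\<forall>G\<in>\<H>. N \<le> card (verts G) \<longrightarrow> (\<exists>P. regular_partition G \<epsilon> P \<and> card P \<le> M_reg \<H> \<epsilon>)"
    using M_reg_bound_M_reg[OF her eps(1)] unfolding M_reg_bound_def by blast
  ultimately have "Tw (n + 4 - 4) \<le> M_reg \<H> \<epsilon>"
    using n(1) eps(1) by (intro Tw_le_card_regular_partition[OF her vc]) auto
  then show ?thesis by (simp add: Tw_real_def n_def x_def)
qed

lemma Tw_ge: "n \<le> Tw n"
proof (induction n)
  case (Suc n)
  have "Tw n < Tw (Suc n)" using less_exp[of "Tw n"] by simp
  then show ?case using Suc by linarith
qed simp

text \<open>2^D with \<open>D\<close> about 4 / \<epsilon>^4 is compared with the top of the tower
  only: 2^2^(Tw n) is at least 2^2^n, and 2^n already exceeds any fixed power of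
  1/\<epsilon>.\<close>

lemma M_reg_less_Tw:
  assumes her: "hereditary \<H>" and vc: "\<And>G. G \<in> \<H> \<Longrightarrow> \<not> has_vc G k" and C: "0 < C"
  shows "\<forall>\<^sub>F \<epsilon> in at_right 0. M_reg \<H> \<epsilon> < Tw_real (\<epsilon> powr (-C))"
proof -
  \<comment> \<open>Stated for all larger \<open>y\<close>, because it is applied to
    \<open>D\<close>, the rounded value of 4 / \<epsilon>^4.\<close>
  have "\<forall>\<^sub>F x::real in at_top. \<forall>y\<ge>x. real k * (2 * y\<^sup>2 + 1) ^ k < 2 powr y"
    by (rule eventually_all_ge_at_top) real_asymp
  moreover have "filterlim (\<lambda>\<epsilon>::real. 4 / \<epsilon> ^ 4) at_top (at_right 0)" by real_asymp
  ultimately have "\<forall>\<^sub>F \<epsilon> in at_right 0. \<forall>y\<ge>4 / \<epsilon> ^ 4. real k * (2 * y\<^sup>2 + 1) ^ k < 2 powr y"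
    by (rule eventually_compose_filterlim)
  moreover have "\<forall>\<^sub>F \<epsilon>::real in at_right 0. 4 / \<epsilon> ^ 4 + 1 < 2 powr (\<epsilon> powr (-C) - 3)"
    using C by real_asymp
  moreover have "\<forall>\<^sub>F \<epsilon>::real in at_right 0. 3 < \<epsilon> powr (-C)"
    using C by real_asymp
  moreover have "\<forall>\<^sub>F \<epsilon>::real in at_right 0. 0 < \<epsilon>"
    by (rule eventually_at_right_less)
  ultimately show ?thesis
  proof eventually_elim
    case (elim \<epsilon>)
    define D where "D = nat \<lceil>4 / \<epsilon> ^ 4\<rceil>"
    have "0 < 4 / \<epsilon> ^ 4" using elim(4) by simp
    then have D: "4 / \<epsilon> ^ 4 \<le> real D" "real D \<le> 4 / \<epsilon> ^ 4 + 1" "1 \<le> D"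
      unfolding D_def by linarith+
    have "real k * (2 * (real D)\<^sup>2 + 1) ^ k < 2 powr real D" using elim(1) D(1) by blast
    then have "real (k * (2 * D\<^sup>2 + 1) ^ k) < real (2 ^ D)" by (simp add: powr_realpow add.commute)
    then have large: "k * (2 * D\<^sup>2 + 1) ^ k < 2 ^ D" by (simp only: of_nat_less_iff)
    have "M_reg \<H> \<epsilon> \<le> 2 ^ D"
      using her vc D(1,3) large elim(4)
      by (intro M_reg_le regular_partition_if_no_vc finite_verts_hereditary) auto
    also have "2 ^ D < Tw_real (\<epsilon> powr (-C))"
    proof -
      \<comment> \<open>Two levels are set aside as the exponentials above \<open>Tw n\<close>;
        rounding accounts for the third unit in the exponent
        \<open>\<epsilon> powr (-C) - 3\<close>.\<close>
      define n where "n = nat \<lceil>\<epsilon> powr (-C)\<rceil> - 2"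
      have n: "\<epsilon> powr (-C) - 3 \<le> real n" "nat \<lceil>\<epsilon> powr (-C)\<rceil> = Suc (Suc n)"
        using elim(3) unfolding n_def by linarith+
      have "real D < 2 powr (\<epsilon> powr (-C) - 3)" using elim(2) D(2) by linarith
      also have "\<dots> \<le> 2 powr real n" using n(1) by simp
      finally have "real D < real (2 ^ n)" by (simp add: powr_realpow)
      then have "D < 2 ^ n" by (simp only: of_nat_less_iff)
      also have "\<dots> \<le> 2 ^ Tw n" by (intro power_increasing Tw_ge) simp
      finally have "(2::nat) ^ D < 2 ^ 2 ^ Tw n" by (intro power_strict_increasing) auto
      then show ?thesis by (simp add: Tw_real_def n(2))
    qed
    finally show ?case .
  qed
qed

theorem theorem1p14:
  assumes "hereditary \<H>"
  shows "((\<exists>C>0. \<exists>C'>0. \<exists>\<epsilon>0>0. \<forall>\<epsilon>::real. 0 < \<epsilon> \<and> \<epsilon> < \<epsilon>0 \<longrightarrow>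
             Tw_real (\<epsilon> powr (-C)) \<le> M_reg \<H> \<epsilon> \<and> M_reg \<H> \<epsilon> \<le> Tw_real (\<epsilon> powr (-C')))
          \<longleftrightarrow> (\<forall>k\<ge>1. U k \<in> Bip_class \<H>))
       \<and> ((\<forall>k\<ge>1. U k \<in> Bip_class \<H>) \<longleftrightarrow> vc_dim_class \<H> = \<infinity>)"
proof (intro conjI)
  show "(\<forall>k\<ge>1. U k \<in> Bip_class \<H>) \<longleftrightarrow> vc_dim_class \<H> = \<infinity>"
    using U_in_Bip_class_iff[OF assms] vc_dim_class_infinite_iff[OF assms] by simp
next
  show "(\<exists>C>0. \<exists>C'>0. \<exists>\<epsilon>0>0. \<forall>\<epsilon>::real. 0 < \<epsilon> \<and> \<epsilon> < \<epsilon>0 \<longrightarrow>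
             Tw_real (\<epsilon> powr (-C)) \<le> M_reg \<H> \<epsilon> \<and> M_reg \<H> \<epsilon> \<le> Tw_real (\<epsilon> powr (-C')))
          \<longleftrightarrow> (\<forall>k\<ge>1. U k \<in> Bip_class \<H>)"
    unfolding U_in_Bip_class_iff[OF assms]
  proof
    assume "\<exists>C>0. \<exists>C'>0. \<exists>\<epsilon>0>0. \<forall>\<epsilon>::real. 0 < \<epsilon> \<and> \<epsilon> < \<epsilon>0 \<longrightarrow>
             Tw_real (\<epsilon> powr (-C)) \<le> M_reg \<H> \<epsilon> \<and> M_reg \<H> \<epsilon> \<le> Tw_real (\<epsilon> powr (-C'))"
    then obtain C \<epsilon>0 :: real where C: "0 < C" "0 < \<epsilon>0"
      and le: "\<And>\<epsilon>. 0 < \<epsilon> \<Longrightarrow> \<epsilon> < \<epsilon>0 \<Longrightarrow> Tw_real (\<epsilon> powr (-C)) \<le> M_reg \<H> \<epsilon>" by blast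
    show "\<forall>k. \<exists>G\<in>\<H>. has_vc G k"
    proof (rule ccontr)
      assume "\<not> (\<forall>k. \<exists>G\<in>\<H>. has_vc G k)"
      then obtain k where "\<And>G. G \<in> \<H> \<Longrightarrow> \<not> has_vc G k" by blast
      then have "\<forall>\<^sub>F \<epsilon> in at_right 0. M_reg \<H> \<epsilon> < Tw_real (\<epsilon> powr (-C))"
        using M_reg_less_Tw[OF assms _ C(1)] by blast
      moreover have "\<forall>\<^sub>F \<epsilon> in at_right 0. Tw_real (\<epsilon> powr (-C)) \<le> M_reg \<H> \<epsilon>"
        using le C(2) unfolding eventually_at_right_field by blast
      \<comment> \<open>The two eventual inequalities contradict each other, and
        \<open>at_right 0\<close> is a proper filter.\<close>
      ultimately have "\<forall>\<^sub>F \<epsilon> in at_right (0::real). False" by eventually_elim simp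
      then show False by simp
    qed
  next
    assume vc: "\<forall>k. \<exists>G\<in>\<H>. has_vc G k"
    have "\<forall>\<^sub>F \<epsilon>::real in at_right 0. \<epsilon> \<le> 1 / (2 ^ 18 * (\<epsilon> powr (-1/4) + 5) ^ 3)" by real_asymp
    moreover have "\<forall>\<^sub>F \<epsilon>::real in at_right 0. 3 * \<epsilon> powr (-5) + 4 \<le> \<epsilon> powr (-6)" by real_asymp
    moreover have "\<forall>\<^sub>F \<epsilon>::real in at_right 0. 0 < \<epsilon>" by (rule eventually_at_right_less)
    ultimately have "\<forall>\<^sub>F \<epsilon> in at_right 0. Tw_real (\<epsilon> powr (-(1/4))) \<le> M_reg \<H> \<epsilon> \<and>
        M_reg \<H> \<epsilon> \<le> Tw_real (\<epsilon> powr (-6))"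
    proof eventually_elim
      case (elim \<epsilon>)
      then show ?case using Tw_le_M_reg[OF assms] M_reg_le_Tw[OF assms] vc by simp
    qed
    then obtain \<epsilon>0 where "0 < \<epsilon>0" "\<forall>\<epsilon>>0. \<epsilon> < \<epsilon>0 \<longrightarrow> Tw_real (\<epsilon> powr (-(1/4))) \<le> M_reg \<H> \<epsilon> \<and>
        M_reg \<H> \<epsilon> \<le> Tw_real (\<epsilon> powr (-6))"
      unfolding eventually_at_right_field by blast
    then show "\<exists>C>0. \<exists>C'>0. \<exists>\<epsilon>0>0. \<forall>\<epsilon>::real. 0 < \<epsilon> \<and> \<epsilon> < \<epsilon>0 \<longrightarrow>
             Tw_real (\<epsilon> powr (-C)) \<le> M_reg \<H> \<epsilon> \<and> M_reg \<H> \<epsilon> \<le> Tw_real (\<epsilon> powr (-C'))"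
      by (intro exI[of _ "1/4 :: real"] exI[of _ "6 :: real"] exI[of _ \<epsilon>0] conjI) auto
  qed
qed

end
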